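(* Suppose that $f_\epsilon$ is ordinary smooth with parameter $a>1/2$, i.e. there is a constant $d>0$ such that $d\le(1+t^2)^a|[\mathcal{F}f_\epsilon](t)|^2\le d^{-1}$ for all $t\in\mathbb{R}$, and that $f_X\in H_p$ for some $p>0$. Let $\widehat{f_Y}$ be the kernel estimator constructed using a kernel $K\in\mathcal{K}_{p+a}$ and a bandwidth $h=c\,n^{-1/(2(p+a)+1)}$, $c>0$. For $0\le s<p$ consider the estimator $\widehat{f_X}_s$ with threshold $\alpha=c'\{n^{-2(s+a)/(2(p+a)+1)}+m^{-1}\}$, $c'>0$. Then $$\mathbb{E}\|\widehat{f_X}_s-f_X\|_s^2=O\big(n^{-2(p-s)/(2(p+a)+1)}+m^{-(1\wedge(p-s)/(a+s))}\big)\qquad\text{as }n,m\to\infty .$$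
   Context: $\|\cdot\|$ is the norm of $L^2(\mathbb{R})$ and $[\mathcal{F}g](t)=\frac{1}{\sqrt{2\pi}}\int_{-\infty}^\infty e^{-itx}g(x)\,dx$ for $g\in L^1(\mathbb{R})\cap L^2(\mathbb{R})$, extended as a unitary operator to $L^2(\mathbb{R})$. $\mathcal{D}$ is the set of all probability densities in $L^2(\mathbb{R})$. $X$ and $\epsilon$ are independent real random variables with densities $f_X,f_\epsilon\in\mathcal{D}$, with $|[\mathcal{F}f_\epsilon](t)|^2>0$ for all $t\in\mathbb{R}$; $Y=X+\epsilon$ has density $f_Y=f_X\star f_\epsilon$ (convolution). $Y_1,\dots,Y_n$ and $\epsilon_1,\dots,\epsilon_m$ are i.i.d. samples from $f_Y$ and $f_\epsilon$, respectively; $f_\epsilon$ is unknown. For $s\in\mathbb{R}$ let $\ell_s(t):=(1+t^2)^{s/2}$, and for $s\ge0$ let $\|f\|_s^2:=\int_{-\infty}^\infty(1+t^2)^s|[\mathcal{F}f](t)|^2\,dt$ and $H_s:=\{f\in L^2(\mathbb{R}):\|f\|_s<\infty\}$. The kernel estimator with kernel $K$ and bandwidth $h>0$ is $\widehat{f_Y}(y):=\frac1{nh}\sum_{j=1}^nK\big(\frac{Y_j-y}{h}\big)$, and for $r\ge0$ $$\mathcal{K}_r:=\Big\{K\in L^1(\mathbb{R})\cap L^2(\mathbb{R}):\lim_{t\to0}\frac{|1-\sqrt{2\pi}[\mathcal{F}K](t)|}{|t|^r}=\kappa_r<\infty\Big\}.$$ Put $[\widehat{\mathcal{F}f_\epsilon}](t):=\frac{1}{m\sqrt{2\pi}}\sum_{j=1}^me^{-it\epsilon_j}$.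 For a threshold $\alpha=\alpha(n,m)>0$ the estimator $\widehat{f_X}_s$ is defined by $$\mathcal{F}\widehat{f_X}_s:=\frac{\mathcal{F}\widehat{f_Y}\cdot\overline{\widehat{\mathcal{F}f_\epsilon}}}{\sqrt{2\pi}\,|\widehat{\mathcal{F}f_\epsilon}|^2}\cdot\mathbb{1}\{|\widehat{\mathcal{F}f_\epsilon}/\ell_s|^2\ge\alpha\}.$$ $x\wedge y=\min(x,y)$, and $1\wedge(p-s)/(a+s)$ means $\min\{1,(p-s)/(a+s)\}$. *)

theory Defs
  imports "HOL-Probability.Probability"
begin

definition L2 :: "(real \<Rightarrow> complex) set" where
  "L2 = {f \<in> borel_measurable lborel. integrable lborel (\<lambda>x. (cmod (f x))\<^sup>2)}"

definition fourier_int :: "(real \<Rightarrow> complex) \<Rightarrow> real \<Rightarrow> complex" where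
  "fourier_int g t = complex_of_real (1 / sqrt (2 * pi)) *
     (LINT x|lborel. exp (- (\<i> * of_real t * of_real x)) * g x)"

text \<open>The unitary (Plancherel) extension to \<open>L2\<close>: for a non-integrable \<open>g\<close> in \<open>L2\<close> the transform is a
  representative of the \<open>L2\<close> limit of the transforms of the truncations of \<open>g\<close> to \<open>[-N, N]\<close>.
  For integrable \<open>g\<close> it is the continuous representative given by the integral, so that pointwise
  conditions on the transform make sense.\<close>

definition fourier :: "(real \<Rightarrow> complex) \<Rightarrow> real \<Rightarrow> complex" where
  "fourier g =
     (if integrable lborel g then fourier_int g
      else (SOME G. G \<in> L2 \<and>
        ((\<lambda>N. \<integral>\<^sup>+ t. ennreal
            ((cmod (fourier_int (\<lambda>x. indicator {- real N..real N} x * g x) t - G t))\<^sup>2) \<partial>lborel)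
          \<longlonglongrightarrow> 0)))"

text \<open>Determined up to null sets; for \<open>G\<close> in \<open>L2\<close> a preimage exists because the transform is
  onto \<open>L2\<close>.\<close>

definition fourier_inv :: "(real \<Rightarrow> complex) \<Rightarrow> real \<Rightarrow> complex" where
  "fourier_inv G = (SOME f. f \<in> L2 \<and> (AE t in lborel. fourier f t = G t))"

definition ell :: "real \<Rightarrow> real \<Rightarrow> real" where
  "ell s t = (1 + t\<^sup>2) powr (s / 2)"

text \<open>The squared norm is valued in \<open>[0, \<infinity>]\<close>, so that no integrability is presupposed.\<close>

definition sobolev_norm_sq :: "real \<Rightarrow> (real \<Rightarrow> complex) \<Rightarrow> ennreal" where
  "sobolev_norm_sq s f = (\<integral>\<^sup>+ t. ennreal ((1 + t\<^sup>2) powr s * (cmod (fourier f t))\<^sup>2) \<partial>lborel)"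

definition sobolev_space :: "real \<Rightarrow> (real \<Rightarrow> complex) set" where
  "sobolev_space s = {f \<in> L2. sobolev_norm_sq s f < \<infinity>}"

definition densities_L2 :: "(real \<Rightarrow> real) set" where
  "densities_L2 = {f. f \<in> borel_measurable lborel \<and> (\<forall>x. 0 \<le> f x) \<and>
     prob_space (density lborel f) \<and> (\<lambda>x. complex_of_real (f x)) \<in> L2}"

definition conv :: "(real \<Rightarrow> real) \<Rightarrow> (real \<Rightarrow> real) \<Rightarrow> real \<Rightarrow> real" where
  "conv f g y = (LINT x|lborel. f (y - x) * g x)"

definition ordinary_smooth :: "real \<Rightarrow> (real \<Rightarrow> real) \<Rightarrow> bool" where
  "ordinary_smooth a f \<longleftrightarrow> (\<exists>d>0. \<forall>t.
     d \<le> (1 + t\<^sup>2) powr a * (cmod (fourier (\<lambda>x. complex_of_real (f x)) t))\<^sup>2 \<and>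
     (1 + t\<^sup>2) powr a * (cmod (fourier (\<lambda>x. complex_of_real (f x)) t))\<^sup>2 \<le> 1 / d)"

definition kernel_class :: "real \<Rightarrow> (real \<Rightarrow> complex) set" where
  "kernel_class r = {K. integrable lborel K \<and> K \<in> L2 \<and>
     (\<exists>\<kappa>::real. ((\<lambda>t. cmod (1 - complex_of_real (sqrt (2 * pi)) * fourier K t) / \<bar>t\<bar> powr r)
        \<longlongrightarrow> \<kappa>) (at 0))}"

text \<open>Samples are given as the first \<open>n\<close> terms \<open>y 0, \<dots>, y (n - 1)\<close> of a sequence.\<close>

definition kernel_estimator ::
    "(real \<Rightarrow> complex) \<Rightarrow> real \<Rightarrow> nat \<Rightarrow> (nat \<Rightarrow> real) \<Rightarrow> real \<Rightarrow> complex" where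
  "kernel_estimator K h n y x = complex_of_real (1 / (real n * h)) * (\<Sum>j<n. K ((y j - x) / h))"

definition empirical_fourier :: "nat \<Rightarrow> (nat \<Rightarrow> real) \<Rightarrow> real \<Rightarrow> complex" where
  "empirical_fourier m e t = complex_of_real (1 / (real m * sqrt (2 * pi))) *
     (\<Sum>j<m. exp (- (\<i> * of_real t * of_real (e j))))"

definition deconv_estimator ::
    "real \<Rightarrow> real \<Rightarrow> (real \<Rightarrow> complex) \<Rightarrow> (real \<Rightarrow> complex) \<Rightarrow> real \<Rightarrow> complex" where
  "deconv_estimator s \<alpha> fY_hat phi_hat = fourier_inv (\<lambda>t.
     fourier fY_hat t * cnj (phi_hat t) / complex_of_real (sqrt (2 * pi) * (cmod (phi_hat t))\<^sup>2) *
     indicator {u. (cmod (phi_hat u / complex_of_real (ell s u)))\<^sup>2 \<ge> \<alpha>} t)"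

end

theory Submission
  imports Defs
begin

text \<open>The unitary Fourier transform turns the Sobolev loss into a weighted mean-square loss on the
frequency side, where the estimator is explicit. Write $v$ for the transform of the kernel estimator,
$z$ for the empirical transform of the errors, $\phi$ for the transform of \<open>feps\<close>, $g$ for that of \<open>fX\<close>
and $q = \sqrt{2\pi}$, so that the density of the observations has transform $q \phi g$. At a frequency
where $|z|^2 \ge \alpha (1+t^2)^s$, so that it is kept, the error of the estimator is
\[ \frac{v}{q z} - g = \frac{v - q \phi g}{q z} - \frac{(z - \phi) g}{z}, \]
and at the other frequencies it is $-g$ (\<open>deconvolution_error_split\<close>). This gives two contributions.

The first one is weighted by $(1+t^2)^s / |z|^2 \le 1/\alpha$ and is therefore at most $1/\alpha$ times
the mean-square error of the kernel estimator of the density of the observations. That density inherits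
the smoothness $p + a$, so the usual bias and variance computation in the frequency domain
(\<open>kernel_estimator_risk\<close>) gives $n^{-2(p+a)/(2(p+a)+1)}$, and the choice of $\alpha$ turns this
into $n^{-2(p-s)/(2(p+a)+1)}$.

The second one compares $z$ with $\phi$; it is $|g|^2$ times the quantity \<open>inversion_error\<close>.
In mean that quantity is bounded by a constant multiple of $\min(1, 1/(m|\phi|^2))$, except at
frequencies with $|\phi|^2 < 4 \alpha (1+t^2)^s$, where it can be of order one
(\<open>expectation_inversion_error_le\<close>; this uses second and fourth moments of $z - \phi$). Ordinary
smoothness of \<open>feps\<close> makes these exceptional frequencies large, and the surplus smoothness $p - s$ of \<open>fX\<close>
pays for both effects (\<open>spectral_cutoff_rate\<close>), which gives
$\alpha^{(p-s)/(a+s)} + m^{-\min(1, (p-s)/(a+s))}$.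

The passage to the frequency side rests on the Plancherel theorem: \<open>Plancherel_L1_L2\<close> for integrable
functions, its extension to all square-integrable functions by completeness, and surjectivity
(\<open>fourier_surj\<close>). The latter is what gives the function \<open>deconv_estimator\<close>, defined through
its transform, the prescribed transform almost everywhere.\<close>

section \<open>Square-integrable functions\<close>

text \<open>The squared norm takes values in $[0,\infty]$, so that all estimates can be made before finiteness
is known. They use \<open>norm_add_sq_le\<close> in place of the triangle inequality, since only convergence
to zero and orders of magnitude matter.\<close>

definition l2sq :: "(real \<Rightarrow> complex) \<Rightarrow> ennreal" where
  "l2sq f = (\<integral>\<^sup>+x. ennreal ((cmod (f x))\<^sup>2) \<partial>lborel)"

lemma L2_iff: "f \<in> L2 \<longleftrightarrow> f \<in> borel_measurable borel \<and> l2sq f < \<infinity>"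
  by (auto simp: L2_def l2sq_def integrable_iff_bounded)

lemma L2_measurable [measurable_dest]: "f \<in> L2 \<Longrightarrow> f \<in> borel_measurable borel"
  by (simp add: L2_iff)

lemma norm_add_sq_le: "(norm (x + y))\<^sup>2 \<le> 2 * (norm x)\<^sup>2 + 2 * (norm y)\<^sup>2"
  for x y :: "'a::real_normed_vector"
proof -
  have "(norm (x + y))\<^sup>2 \<le> (norm x + norm y)\<^sup>2"
    by (intro power_mono norm_triangle_ineq) auto
  also have "\<dots> \<le> 2 * (norm x)\<^sup>2 + 2 * (norm y)\<^sup>2"
    using sum_squares_bound[of "norm x" "norm y"] by (simp add: power2_sum)
  finally show ?thesis .
qed

lemma l2sq_add_le:
  assumes [measurable]: "f \<in> borel_measurable borel" "g \<in> borel_measurable borel"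
  shows "l2sq (\<lambda>x. f x + g x) \<le> 2 * l2sq f + 2 * l2sq g"
proof -
  have "l2sq (\<lambda>x. f x + g x) \<le> (\<integral>\<^sup>+x. 2 * ennreal ((cmod (f x))\<^sup>2) + 2 * ennreal ((cmod (g x))\<^sup>2) \<partial>lborel)"
    unfolding l2sq_def
  proof (intro nn_integral_mono)
    fix x
    have "ennreal ((cmod (f x + g x))\<^sup>2) \<le> ennreal (2 * (cmod (f x))\<^sup>2 + 2 * (cmod (g x))\<^sup>2)"
      by (intro ennreal_leI norm_add_sq_le)
    also have "\<dots> = 2 * ennreal ((cmod (f x))\<^sup>2) + 2 * ennreal ((cmod (g x))\<^sup>2)"
      by (simp add: ennreal_plus ennreal_mult)
    finally show "ennreal ((cmod (f x + g x))\<^sup>2) \<le> \<dots>" .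
  qed
  also have "\<dots> = 2 * l2sq f + 2 * l2sq g"
    unfolding l2sq_def by (simp add: nn_integral_add nn_integral_cmult)
  finally show ?thesis .
qed

lemma l2sq_cmult:
  assumes [measurable]: "f \<in> borel_measurable borel"
  shows "l2sq (\<lambda>x. c * f x) = ennreal ((cmod c)\<^sup>2) * l2sq f"
  unfolding l2sq_def by (simp add: norm_mult power_mult_distrib ennreal_mult nn_integral_cmult)

lemma l2sq_minus_commute: "l2sq (\<lambda>x. f x - g x) = l2sq (\<lambda>x. g x - f x)"
  by (simp add: l2sq_def norm_minus_commute)

lemma l2sq_diff_le:
  assumes [measurable]: "f \<in> borel_measurable borel" "g \<in> borel_measurable borel"
  shows "l2sq (\<lambda>x. f x - g x) \<le> 2 * l2sq f + 2 * l2sq g"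
  using l2sq_add_le[of f "\<lambda>x. - g x"] by (simp add: l2sq_def)

lemma l2sq_triangle:
  assumes [measurable]: "f \<in> borel_measurable borel" "g \<in> borel_measurable borel" "k \<in> borel_measurable borel"
  shows "l2sq (\<lambda>x. f x - g x) \<le> 2 * l2sq (\<lambda>x. f x - k x) + 2 * l2sq (\<lambda>x. k x - g x)"
  using l2sq_add_le[of "\<lambda>x. f x - k x" "\<lambda>x. k x - g x"] by simp

lemma l2sq_affine:
  assumes [measurable]: "f \<in> borel_measurable borel" and c: "c \<noteq> 0"
  shows "l2sq f = \<bar>c\<bar> * l2sq (\<lambda>x. f (b + c * x))"
  unfolding l2sq_def using c by (subst nn_integral_real_affine[where c = c and t = b]) auto

lemma l2sq_shift:
  assumes [measurable]: "f \<in> borel_measurable borel"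
  shows "l2sq (\<lambda>x. f (x + b)) = l2sq f"
  using l2sq_affine[of f 1 b] by (simp add: add.commute)

lemma l2sq_0_iff:
  assumes [measurable]: "f \<in> borel_measurable borel"
  shows "l2sq f = 0 \<longleftrightarrow> (AE x in lborel. f x = 0)"
  unfolding l2sq_def by (simp add: nn_integral_0_iff_AE)

lemma L2_add: "f \<in> L2 \<Longrightarrow> g \<in> L2 \<Longrightarrow> (\<lambda>x. f x + g x) \<in> L2"
  using l2sq_add_le[of f g] by (auto simp: L2_iff ennreal_mult_eq_top_iff less_top[symmetric] top_unique)

lemma L2_diff: "f \<in> L2 \<Longrightarrow> g \<in> L2 \<Longrightarrow> (\<lambda>x. f x - g x) \<in> L2"
  using l2sq_diff_le[of f g] by (auto simp: L2_iff ennreal_mult_eq_top_iff less_top[symmetric] top_unique)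

lemma L2_cmult:
  assumes "f \<in> L2"
  shows "(\<lambda>x. c * f x) \<in> L2"
proof -
  have [measurable]: "f \<in> borel_measurable borel" using assms by auto
  show ?thesis using assms by (simp add: L2_iff l2sq_cmult ennreal_mult_less_top)
qed

lemma l2sq_mono: "(\<And>x. cmod (f x) \<le> cmod (g x)) \<Longrightarrow> l2sq f \<le> l2sq g"
  unfolding l2sq_def by (intro nn_integral_mono ennreal_leI power_mono) auto

lemma ennreal_tendsto_0I:
  assumes "\<And>e::real. e > 0 \<Longrightarrow> eventually (\<lambda>k. a k \<le> ennreal e) F"
  shows "(a \<longlongrightarrow> (0::ennreal)) F"
proof (rule order_tendstoI)
  fix b :: ennreal assume "0 < b"
  have "\<exists>e>0. ennreal e < b"
  proof (cases b)
    case (real r)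
    then show ?thesis using \<open>0 < b\<close> by (intro exI[of _ "r / 2"]) (auto simp: ennreal_less_iff)
  qed (auto intro!: exI[of _ 1])
  then obtain e where e: "0 < e" "ennreal e < b" by auto
  show "eventually (\<lambda>k. a k < b) F"
    using assms[OF e(1)] by eventually_elim (use e(2) in auto)
qed auto

lemma ennreal_tendsto_0D:
  assumes "(a \<longlongrightarrow> (0::ennreal)) F" "(e::real) > 0"
  shows "eventually (\<lambda>k. a k \<le> ennreal e) F"
  using order_tendstoD(2)[OF assms(1), of "ennreal e"] assms(2)
  by (auto elim: eventually_mono)

lemma ennreal_tendsto_0_le:
  assumes "\<And>k. a k \<le> b k" "(b \<longlongrightarrow> (0::ennreal)) F"
  shows "(a \<longlongrightarrow> 0) F"
  by (rule tendsto_sandwich[OF _ _ tendsto_const assms(2)]) (use assms(1) in auto)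

lemma ennreal_tendsto_0_cmult:
  assumes "(a \<longlongrightarrow> (0::ennreal)) F" "c < top"
  shows "((\<lambda>k. c * a k) \<longlongrightarrow> 0) F"
  using ennreal_tendsto_cmult[OF assms(2,1)] by simp

lemma ennreal_tendsto_0_add:
  assumes "(a \<longlongrightarrow> (0::ennreal)) F" "(b \<longlongrightarrow> 0) F"
  shows "((\<lambda>k. a k + b k) \<longlongrightarrow> 0) F"
  using tendsto_add[OF assms] by simp

section \<open>Continuity of translation in the mean square\<close>

definition l2_translation_cont :: "(real \<Rightarrow> complex) \<Rightarrow> bool" where
  "l2_translation_cont f \<longleftrightarrow>
     (\<forall>h. h \<longlonglongrightarrow> 0 \<longrightarrow> (\<lambda>k::nat. l2sq (\<lambda>x. f (x + h k) - f x)) \<longlonglongrightarrow> 0)"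

lemma l2_translation_cont_add:
  assumes "l2_translation_cont f" "l2_translation_cont g"
    and [measurable]: "f \<in> borel_measurable borel" "g \<in> borel_measurable borel"
  shows "l2_translation_cont (\<lambda>x. f x + g x)"
  unfolding l2_translation_cont_def
proof (intro allI impI)
  fix h :: "nat \<Rightarrow> real" assume h: "h \<longlonglongrightarrow> 0"
  show "(\<lambda>k. l2sq (\<lambda>x. f (x + h k) + g (x + h k) - (f x + g x))) \<longlonglongrightarrow> 0"
  proof (rule ennreal_tendsto_0_le)
    show "l2sq (\<lambda>x. f (x + h k) + g (x + h k) - (f x + g x))
        \<le> 2 * l2sq (\<lambda>x. f (x + h k) - f x) + 2 * l2sq (\<lambda>x. g (x + h k) - g x)" for k
      using l2sq_add_le[of "\<lambda>x. f (x + h k) - f x" "\<lambda>x. g (x + h k) - g x"]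
      by (simp add: algebra_simps)
    show "(\<lambda>k. 2 * l2sq (\<lambda>x. f (x + h k) - f x) + 2 * l2sq (\<lambda>x. g (x + h k) - g x)) \<longlonglongrightarrow> 0"
      using assms(1,2) h by (intro ennreal_tendsto_0_add ennreal_tendsto_0_cmult) (auto simp: l2_translation_cont_def)
  qed
qed

lemma l2_translation_cont_cmult:
  assumes "l2_translation_cont f" and [measurable]: "f \<in> borel_measurable borel"
  shows "l2_translation_cont (\<lambda>x. c * f x)"
proof -
  have "l2sq (\<lambda>x. c * f (x + b) - c * f x) = ennreal ((cmod c)\<^sup>2) * l2sq (\<lambda>x. f (x + b) - f x)" for b
    by (subst l2sq_cmult[symmetric]) (auto simp: right_diff_distrib)
  then show ?thesis
    using assms(1) unfolding l2_translation_cont_def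
    by (auto intro!: ennreal_tendsto_0_cmult)
qed

text \<open>Translations are isometries, so an error made in approximating $f$ is counted once for $f$ and once for
its translate, uniformly in the shift. Hence the functions with continuous translation are closed in the
mean square, and it suffices to treat a dense set.\<close>

lemma l2_translation_cont_closed:
  assumes [measurable]: "f \<in> borel_measurable borel"
    and approx: "\<And>e::real. e > 0 \<Longrightarrow>
      \<exists>g. g \<in> borel_measurable borel \<and> l2_translation_cont g \<and> l2sq (\<lambda>x. f x - g x) \<le> ennreal e"
  shows "l2_translation_cont f"
  unfolding l2_translation_cont_def
proof (intro allI impI ennreal_tendsto_0I)
  fix h :: "nat \<Rightarrow> real" and e :: real assume h: "h \<longlonglongrightarrow> 0" and e: "e > 0"
  obtain g where [measurable]: "g \<in> borel_measurable borel" and g: "l2_translation_cont g"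
    and fg: "l2sq (\<lambda>x. f x - g x) \<le> ennreal (e / 12)"
    using approx[of "e/12"] e by auto
  have "eventually (\<lambda>k. l2sq (\<lambda>x. g (x + h k) - g x) \<le> ennreal (e / 12)) sequentially"
    using g h e by (intro ennreal_tendsto_0D) (auto simp: l2_translation_cont_def)
  then show "eventually (\<lambda>k. l2sq (\<lambda>x. f (x + h k) - f x) \<le> ennreal e) sequentially"
  proof eventually_elim
    case (elim k)
    have "l2sq (\<lambda>x. f (x + h k) - g (x + h k)) = l2sq (\<lambda>x. f x - g x)"
      using l2sq_shift[of "\<lambda>x. f x - g x" "h k"] by simp
    then have 1: "l2sq (\<lambda>x. f (x + h k) - g (x + h k)) \<le> ennreal (e / 12)"
      using fg by simp
    have 2: "l2sq (\<lambda>x. g x - f x) \<le> ennreal (e / 12)"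
      using fg l2sq_minus_commute[of g f] by simp
    have "l2sq (\<lambda>x. f (x + h k) - f x)
      \<le> 2 * l2sq (\<lambda>x. f (x + h k) - g (x + h k)) + 2 * l2sq (\<lambda>x. g (x + h k) - f x)"
      by (rule l2sq_triangle) auto
    also have "l2sq (\<lambda>x. g (x + h k) - f x) \<le> 2 * l2sq (\<lambda>x. g (x + h k) - g x) + 2 * l2sq (\<lambda>x. g x - f x)"
      by (rule l2sq_triangle) auto
    also have "2 * l2sq (\<lambda>x. f (x + h k) - g (x + h k)) + 2 * (2 * l2sq (\<lambda>x. g (x + h k) - g x) + 2 * l2sq (\<lambda>x. g x - f x))
       \<le> 2 * ennreal (e / 12) + 2 * (2 * ennreal (e / 12) + 2 * ennreal (e / 12))"
      by (intro add_mono mult_left_mono 1 2 elim) auto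
    also have "\<dots> = ennreal (2 * (e/12) + 2 * (2 * (e/12) + 2 * (e/12)))"
      using e by (simp add: ennreal_plus ennreal_mult del: times_divide_eq_right flip: distrib_right)
    also have "\<dots> \<le> ennreal e" using e by (intro ennreal_leI) auto
    finally show ?case by (auto simp: add_left_mono mult_left_mono)
  qed
qed

text \<open>Every point of an open set stays in the set under small shifts, so the measure of the points of $U$ that
leave $U$ tends to zero by dominated convergence. The points that enter $U$ are, after a change of
variables, those that leave it under the opposite shift.\<close>

lemma l2_translation_cont_indicator_open:
  assumes U: "open U" and fin: "emeasure lborel U < \<infinity>"
  shows "l2_translation_cont (indicator U)"
  unfolding l2_translation_cont_def
proof (intro allI impI)
  fix h :: "nat \<Rightarrow> real" assume h: "h \<longlonglongrightarrow> 0"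
  have [measurable]: "U \<in> sets borel" using U by auto
  \<comment> \<open>the measure of the points that the shift by \<open>b\<close> moves out of \<open>U\<close>\<close>
  define D where "D b = (\<integral>\<^sup>+x. indicator U x * (1 - indicator U (x + b)) \<partial>lborel :: ennreal)" for b
  have D0: "(\<lambda>k. D (b k)) \<longlonglongrightarrow> 0" if b: "b \<longlonglongrightarrow> 0" for b :: "nat \<Rightarrow> real"
  proof -
    have "(\<lambda>k. D (b k)) \<longlonglongrightarrow> (\<integral>\<^sup>+(x::real). 0 \<partial>lborel)"
      unfolding D_def
    proof (rule nn_integral_dominated_convergence[where w = "indicator U"])
      show "AE x in lborel. (\<lambda>k. indicator U x * (1 - indicator U (x + b k)) :: ennreal) \<longlonglongrightarrow> 0"
      proof (rule AE_I2)
        fix x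
        show "(\<lambda>k. indicator U x * (1 - indicator U (x + b k)) :: ennreal) \<longlonglongrightarrow> 0"
        proof (cases "x \<in> U")
          case True
          have "(\<lambda>k. x + b k) \<longlonglongrightarrow> x" using tendsto_add[OF tendsto_const b, of x] by simp
          from topological_tendstoD[OF this U True]
          have "eventually (\<lambda>k. indicator U x * (1 - indicator U (x + b k)) = (0::ennreal)) sequentially"
            by eventually_elim auto
          then show ?thesis by (rule tendsto_eventually)
        qed auto
      qed
    qed (use fin in \<open>auto split: split_indicator\<close>)
    then show ?thesis by simp
  qed
  have "l2sq (\<lambda>x. indicator U (x + b) - indicator U x) = D b + D (- b)" for b
  proof -
    have "D (- b) = (\<integral>\<^sup>+x. indicator U (x + b) * (1 - indicator U x) \<partial>lborel)"
      unfolding D_def by (subst nn_integral_real_affine[where c = 1 and t = b]) (auto simp: add.commute)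
    moreover have "l2sq (\<lambda>x. indicator U (x + b) - indicator U x)
      = (\<integral>\<^sup>+x. indicator U x * (1 - indicator U (x + b)) + indicator U (x + b) * (1 - indicator U x) \<partial>lborel)"
      unfolding l2sq_def by (intro nn_integral_cong) (auto split: split_indicator)
    ultimately show ?thesis
      by (simp add: nn_integral_add D_def[of b])
  qed
  moreover have "(\<lambda>k. D (h k) + D (- h k)) \<longlonglongrightarrow> 0"
    using h tendsto_minus[OF h] by (intro ennreal_tendsto_0_add D0) auto
  ultimately show "(\<lambda>k. l2sq (\<lambda>x. indicator U (x + h k) - indicator U x)) \<longlonglongrightarrow> 0"
    by simp
qed

text \<open>Outer regularity of Lebesgue measure reduces Borel sets to open sets.\<close>

lemma l2_translation_cont_indicator:
  assumes A[measurable]: "A \<in> sets borel" and fin: "emeasure lborel A < \<infinity>"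
  shows "l2_translation_cont (indicator A)"
proof (rule l2_translation_cont_closed)
  fix e :: real assume e: "e > 0"
  obtain U where U: "open U" "A \<subseteq> U" "emeasure lborel (U - A) < e"
    using outer_regular_lborel[OF A e] .
  have [measurable]: "U \<in> sets borel" using U by auto
  have "emeasure lborel U = emeasure lborel A + emeasure lborel (U - A)"
    using U by (subst plus_emeasure) (auto simp: Un_absorb1)
  also have "\<dots> < \<infinity>" using fin U(3) by (auto simp: less_top[symmetric])
  finally have "l2_translation_cont (indicator U)"
    using U(1) by (intro l2_translation_cont_indicator_open) auto
  moreover have "l2sq (\<lambda>x. indicator A x - indicator U x) = (\<integral>\<^sup>+x. indicator (U - A) x \<partial>lborel)"
    unfolding l2sq_def using U(2) by (intro nn_integral_cong) (auto split: split_indicator)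
  ultimately show "\<exists>g. g \<in> borel_measurable borel \<and> l2_translation_cont g \<and> l2sq (\<lambda>x. indicator A x - g x) \<le> ennreal e"
    using U(3) by (intro exI[of _ "indicator U"]) auto
qed auto

lemma l2_translation_cont_nonneg:
  fixes u :: "real \<Rightarrow> real"
  assumes "u \<in> borel_measurable borel" "\<And>x. 0 \<le> u x" "l2sq (\<lambda>x. complex_of_real (u x)) < \<infinity>"
  shows "l2_translation_cont (\<lambda>x. complex_of_real (u x))"
  using assms
proof (induction u rule: borel_measurable_induct_real)
  case (set A)
  have "(\<lambda>x. complex_of_real (indicator A x)) = indicator A"
    by (auto split: split_indicator)
  moreover have "l2sq (indicator A) = (\<integral>\<^sup>+x. indicator A x \<partial>lborel)"
    unfolding l2sq_def by (intro nn_integral_cong) (auto split: split_indicator)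
  ultimately show ?case
    using set l2_translation_cont_indicator[of A] by simp
next
  case (mult u c)
  have [measurable]: "u \<in> borel_measurable borel" by fact
  show ?case
  proof (cases "c = 0")
    case False
    then have "l2sq (\<lambda>x. complex_of_real (u x)) < \<infinity>"
      using mult.prems by (auto simp: l2sq_cmult ennreal_mult_less_top)
    then show ?thesis
      using l2_translation_cont_cmult[OF mult.IH, of "complex_of_real c"] by simp
  qed (simp add: l2_translation_cont_def l2sq_def)
next
  case (add u v)
  have [measurable]: "u \<in> borel_measurable borel" "v \<in> borel_measurable borel" by fact+
  have "\<bar>u x\<bar> \<le> \<bar>v x + u x\<bar>" "\<bar>v x\<bar> \<le> \<bar>v x + u x\<bar>" for x
    using add.hyps(2)[of x] add.hyps(4)[of x] by linarith+
  then have "l2sq (\<lambda>x. complex_of_real (u x)) \<le> l2sq (\<lambda>x. complex_of_real (v x + u x))"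
    "l2sq (\<lambda>x. complex_of_real (v x)) \<le> l2sq (\<lambda>x. complex_of_real (v x + u x))"
    by (auto intro!: l2sq_mono simp only: norm_of_real)
  with add.prems have "l2_translation_cont (\<lambda>x. complex_of_real (u x))" "l2_translation_cont (\<lambda>x. complex_of_real (v x))"
    by (auto intro!: add.IH)
  from l2_translation_cont_add[OF this(2,1)] show ?case by simp
next
  case (seq U)
  have [measurable]: "u \<in> borel_measurable borel" "\<And>i. U i \<in> borel_measurable borel" by fact+
  have Uu: "U i x \<le> u x" for i x
    using seq.hyps by (intro incseq_le[of "\<lambda>i. U i x"]) (auto simp: incseq_def le_fun_def)
  have U: "l2_translation_cont (\<lambda>x. complex_of_real (U i x))" for i
  proof (rule seq.IH)
    have "l2sq (\<lambda>x. complex_of_real (U i x)) \<le> l2sq (\<lambda>x. complex_of_real (u x))"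
    proof (intro l2sq_mono)
      show "cmod (complex_of_real (U i x)) \<le> cmod (complex_of_real (u x))" for x
        using Uu[of i x] seq.hyps(2)[of i x] unfolding norm_of_real by linarith
    qed
    with seq.prems show "l2sq (\<lambda>x. complex_of_real (U i x)) < \<infinity>" by auto
  qed
  have "(\<lambda>i. l2sq (\<lambda>x. complex_of_real (u x) - complex_of_real (U i x))) \<longlonglongrightarrow> (\<integral>\<^sup>+(x::real). 0 \<partial>lborel)"
    unfolding l2sq_def
  proof (rule nn_integral_dominated_convergence[where w = "\<lambda>x. ennreal ((cmod (complex_of_real (u x)))\<^sup>2)"])
    show "AE x in lborel. ennreal ((cmod (complex_of_real (u x) - complex_of_real (U i x)))\<^sup>2)
       \<le> ennreal ((cmod (complex_of_real (u x)))\<^sup>2)" for i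
    proof (intro AE_I2 ennreal_leI power_mono)
      show "cmod (complex_of_real (u x) - complex_of_real (U i x)) \<le> cmod (complex_of_real (u x))" for x
        using Uu[of i x] seq.hyps(2)[of i x] unfolding of_real_diff[symmetric] norm_of_real by linarith
    qed simp
    show "AE x in lborel. (\<lambda>i. ennreal ((cmod (complex_of_real (u x) - complex_of_real (U i x)))\<^sup>2)) \<longlonglongrightarrow> 0"
    proof (rule AE_I2)
      fix x
      have "(\<lambda>i. (cmod (complex_of_real (u x) - complex_of_real (U i x)))\<^sup>2) \<longlonglongrightarrow> (cmod (complex_of_real (u x) - complex_of_real (u x)))\<^sup>2"
        using seq.hyps by (intro tendsto_intros) auto
      then show "(\<lambda>i. ennreal ((cmod (complex_of_real (u x) - complex_of_real (U i x)))\<^sup>2)) \<longlonglongrightarrow> 0"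
        by (metis diff_self norm_zero tendsto_ennrealI ennreal_0 zero_power2)
    qed
  qed (use seq.prems in \<open>auto simp: l2sq_def\<close>)
  then have lim: "(\<lambda>i. l2sq (\<lambda>x. complex_of_real (u x) - complex_of_real (U i x))) \<longlonglongrightarrow> 0" by simp
  show ?case
  proof (rule l2_translation_cont_closed)
    fix e :: real assume "e > 0"
    from ennreal_tendsto_0D[OF lim this] obtain i where
      "l2sq (\<lambda>x. complex_of_real (u x) - complex_of_real (U i x)) \<le> ennreal e"
      by (auto simp: eventually_sequentially)
    then show "\<exists>g. g \<in> borel_measurable borel \<and> l2_translation_cont g \<and>
        l2sq (\<lambda>x. complex_of_real (u x) - g x) \<le> ennreal e"
      using U[of i] by (intro exI[of _ "\<lambda>x. complex_of_real (U i x)"]) auto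
  qed auto
qed

text \<open>The positive and negative parts of the real and imaginary parts are limits of simple functions, and
those are linear combinations of indicators.\<close>

theorem L2_translation_continuous:
  assumes f: "f \<in> L2"
  shows "l2_translation_cont f"
proof -
  have [measurable]: "f \<in> borel_measurable borel" using f by auto
  have part: "l2_translation_cont (\<lambda>x. complex_of_real (max 0 (u x)))"
    if [measurable]: "u \<in> borel_measurable borel" and "\<And>x. \<bar>u x\<bar> \<le> cmod (f x)" for u :: "real \<Rightarrow> real"
  proof (rule l2_translation_cont_nonneg)
    have "l2sq (\<lambda>x. complex_of_real (max 0 (u x))) \<le> l2sq f"
      using that(2) by (intro l2sq_mono) (auto simp: norm_of_real abs_le_iff)
    then show "l2sq (\<lambda>x. complex_of_real (max 0 (u x))) < \<infinity>"
      using f by (auto simp: L2_iff)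
  qed auto
  let ?p = "\<lambda>c u x. c * complex_of_real (max 0 (u x))"
  have p: "l2_translation_cont (?p c u)"
    if [measurable]: "u \<in> borel_measurable borel" and "\<And>x. \<bar>u x\<bar> \<le> cmod (f x)" for u :: "real \<Rightarrow> real" and c
    by (intro l2_translation_cont_cmult part that) auto
  have "l2_translation_cont (\<lambda>x. (?p 1 (\<lambda>x. Re (f x)) x + ?p (-1) (\<lambda>x. - Re (f x)) x)
      + (?p \<i> (\<lambda>x. Im (f x)) x + ?p (-\<i>) (\<lambda>x. - Im (f x)) x))"
    by (intro l2_translation_cont_add p) (auto simp: abs_Re_le_cmod abs_Im_le_cmod)
  also have "(\<lambda>x. (?p 1 (\<lambda>x. Re (f x)) x + ?p (-1) (\<lambda>x. - Re (f x)) x)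
      + (?p \<i> (\<lambda>x. Im (f x)) x + ?p (-\<i>) (\<lambda>x. - Im (f x)) x)) = f"
    by (auto simp: complex_eq_iff max_def)
  finally show ?thesis .
qed
section \<open>The Plancherel identity\<close>

lemma borel_measurable_cnj [measurable (raw)]:
  "f \<in> borel_measurable M \<Longrightarrow> (\<lambda>x. cnj (f x)) \<in> borel_measurable M"
  by (rule borel_measurable_continuous_on[where f = cnj]) (auto intro: continuous_intros)

lemma fourier_int_eq: "fourier_int g t = (LINT x|lborel. exp (- (\<i> * of_real t * of_real x)) * g x) / of_real (sqrt (2 * pi))"
  by (simp add: fourier_int_def)

lemma norm_exp_i_real [simp]: "cmod (exp (- (\<i> * of_real t * of_real x))) = 1"
  by (simp add: norm_exp_eq_Re)

lemma integrable_exp_mult: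
  assumes "integrable lborel g"
  shows "integrable lborel (\<lambda>x. exp (- (\<i> * of_real t * of_real x)) * g x)"
proof (rule Bochner_Integration.integrable_bound[OF assms])
  show "(\<lambda>x. exp (- (\<i> * of_real t * of_real x)) * g x) \<in> borel_measurable lborel"
    using assms by (auto intro!: borel_measurable_times borel_measurable_continuous_onI continuous_intros
         simp: borel_measurable_integrable[OF assms, simplified])
qed (simp add: norm_mult)

lemma borel_measurable_fourier_int:
  assumes [measurable]: "g \<in> borel_measurable borel"
  shows "fourier_int g \<in> borel_measurable borel"
proof -
  have "(\<lambda>t. LINT x|lborel. exp (- (\<i> * of_real t * of_real x)) * g x) \<in> borel_measurable borel"
    by (intro lborel.borel_measurable_lebesgue_integral) measurable
  then show ?thesis unfolding fourier_int_eq[abs_def] by measurable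
qed

lemma norm_fourier_int_le:
  assumes "integrable lborel g"
  shows "cmod (fourier_int g t) \<le> LINT x|lborel. cmod (g x)"
proof -
  have "cmod (LINT x|lborel. exp (- (\<i> * of_real t * of_real x)) * g x) \<le> (LINT x|lborel. cmod (g x))"
    using integral_norm_bound[of lborel "\<lambda>x. exp (- (\<i> * of_real t * of_real x)) * g x"] by (simp add: norm_mult)
  moreover have "1 \<le> sqrt (2 * pi)"
    using pi_gt3 by (simp add: real_le_rsqrt)
  moreover have "0 \<le> (LINT x|lborel. cmod (g x))" by simp
  ultimately show ?thesis
    unfolding fourier_int_eq norm_divide
    using divide_left_mono[of 1 "sqrt (2 * pi)" "cmod (LINT x|lborel. exp (- (\<i> * of_real t * of_real x)) * g x)"]
    by (simp del: real_sqrt_ge_one)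
qed

lemma fourier_int_diff:
  assumes "integrable lborel f" "integrable lborel g"
  shows "fourier_int (\<lambda>x. f x - g x) t = fourier_int f t - fourier_int g t"
  unfolding fourier_int_eq
  by (simp add: right_diff_distrib integrable_exp_mult assms Bochner_Integration.integral_diff diff_divide_distrib)

text \<open>The multiplication formula, by Fubini's theorem: the kernel of the transform is symmetric in its
two arguments. It is the only form of duality that the Plancherel identity and Fourier inversion need.\<close>

lemma fourier_int_mult:
  assumes u: "integrable lborel u" and v: "integrable lborel v"
  shows "(LINT t|lborel. fourier_int u t * v t) = (LINT x|lborel. u x * fourier_int v x)"
proof -
  have [measurable]: "u \<in> borel_measurable borel" "v \<in> borel_measurable borel"
    using u v by (auto dest: borel_measurable_integrable)
  let ?F = "\<lambda>x t. exp (- (\<i> * complex_of_real t * complex_of_real x)) * u x * v t"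
  have int: "integrable (lborel \<Otimes>\<^sub>M lborel) (case_prod ?F)"
  proof (rule lborel_pair.Fubini_integrable)
    show "integrable lborel (\<lambda>x. LINT t|lborel. norm (case_prod ?F (x, t)))"
      using u v by (simp add: norm_mult)
    show "AE x in lborel. integrable lborel (\<lambda>t. case_prod ?F (x, t))"
    proof (rule AE_I2)
      fix x
      show "integrable lborel (\<lambda>t. case_prod ?F (x, t))"
        by (rule Bochner_Integration.integrable_bound[where f = "\<lambda>t. u x * v t"]) (use v in \<open>auto simp: norm_mult\<close>)
    qed
  qed measurable
  have "(LINT t|lborel. fourier_int u t * v t) * of_real (sqrt (2 * pi)) = (LINT t|lborel. LINT x|lborel. ?F x t)"
    unfolding fourier_int_eq
    by (subst integral_mult_left_zero[symmetric])
       (intro Bochner_Integration.integral_cong refl, simp add: integral_mult_left_zero)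
  also have "\<dots> = (LINT x|lborel. LINT t|lborel. ?F x t)"
    by (rule lborel_pair.Fubini_integral[OF int])
  also have "\<dots> = (LINT x|lborel. u x * fourier_int v x) * of_real (sqrt (2 * pi))"
  proof -
    have "(LINT t|lborel. ?F x t) = u x * fourier_int v x * of_real (sqrt (2 * pi))" for x
    proof -
      have "(LINT t|lborel. ?F x t) = (LINT t|lborel. u x * (exp (- (\<i> * complex_of_real x * complex_of_real t)) * v t))"
        by (intro Bochner_Integration.integral_cong refl) (simp add: mult_ac)
      then show ?thesis by (simp add: integral_mult_right_zero fourier_int_eq)
    qed
    then show ?thesis by (simp add: integral_mult_left_zero)
  qed
  finally show ?thesis by simp
qed

text \<open>The modulation by $x$ appears because this transform is used as the inner integral of a double one;
it moves the centre of the Gaussian to $-x$.\<close>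

lemma gaussian_fourier:
  fixes e :: real
  assumes "e > 0"
  shows "fourier_int (\<lambda>t. exp (- (\<i> * of_real t * of_real x)) * of_real (exp (- (e * t)\<^sup>2 / 2))) y
    = of_real (sqrt (2 * pi) / e * std_normal_density ((x + y) / e))"
proof -
  define v where "v = (x + y) / e"
  have "of_real (exp (- (v\<^sup>2) / 2)) = char std_normal_distribution (- v)"
    by (simp add: char_std_normal_distribution)
  also have "\<dots> = (LINT u|lborel. std_normal_density u *\<^sub>R iexp (- v * u))"
    unfolding char_def by (subst integral_density) auto
  also have "\<dots> = e *\<^sub>R (LINT t|lborel. std_normal_density (e * t) *\<^sub>R iexp (- v * (e * t)))"
    using assms by (subst lborel_integral_real_affine[where c = e and t = 0]) auto
  also have "(\<lambda>t. std_normal_density (e * t) *\<^sub>R iexp (- v * (e * t)))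
    = (\<lambda>t. (exp (- (\<i> * of_real y * of_real t)) * (exp (- (\<i> * of_real t * of_real x)) * of_real (exp (- (e * t)\<^sup>2 / 2)))) / of_real (sqrt (2 * pi)))"
  proof
    fix t
    have "iexp (- v * (e * t)) = exp (- (\<i> * of_real y * of_real t)) * exp (- (\<i> * of_real t * of_real x))"
    proof -
      have "v * (e * t) = (x + y) * t" using assms by (simp add: v_def)
      then have "iexp (- v * (e * t)) = iexp (- ((x + y) * t))"
        by (metis mult_minus_left)
      also have "\<dots> = exp (- (\<i> * of_real y * of_real t)) * exp (- (\<i> * of_real t * of_real x))"
        unfolding exp_add[symmetric] by (simp add: algebra_simps)
      finally show ?thesis .
    qed
    then show "std_normal_density (e * t) *\<^sub>R iexp (- v * (e * t)) =
      (exp (- (\<i> * of_real y * of_real t)) * (exp (- (\<i> * of_real t * of_real x)) * of_real (exp (- (e * t)\<^sup>2 / 2)))) / of_real (sqrt (2 * pi))"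
      by (simp add: std_normal_density_def scaleR_conv_of_real)
  qed
  also have "(LINT t|lborel. \<dots> t) = fourier_int (\<lambda>t. exp (- (\<i> * of_real t * of_real x)) * of_real (exp (- (e * t)\<^sup>2 / 2))) y"
    unfolding fourier_int_eq by simp
  finally show ?thesis
    using assms by (simp add: std_normal_density_def v_def field_simps scaleR_conv_of_real)
qed

lemma integrable_gaussian:
  fixes e :: real
  assumes "e > 0"
  shows "integrable lborel (\<lambda>t. exp (- (e * t)\<^sup>2 / 2))"
proof -
  have "integrable lborel std_normal_density" by simp
  from lborel_integrable_real_affine[OF this, of e 0] assms
  have "integrable lborel (\<lambda>t. sqrt (2 * pi) * std_normal_density (e * t))" by simp
  then show ?thesis by (simp add: std_normal_density_def)
qed

lemma integrable_L2_mult_cnj: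
  assumes f: "f \<in> L2" and g: "g \<in> L2"
  shows "integrable lborel (\<lambda>x. f x * cnj (g x))"
proof (rule Bochner_Integration.integrable_bound)
  have [measurable]: "f \<in> borel_measurable borel" "g \<in> borel_measurable borel" using f g by auto
  show "integrable lborel (\<lambda>x. (cmod (f x))\<^sup>2 + (cmod (g x))\<^sup>2)"
    using f g by (intro Bochner_Integration.integrable_add) (simp_all add: L2_def)
  show "AE x in lborel. norm (f x * cnj (g x)) \<le> norm ((cmod (f x))\<^sup>2 + (cmod (g x))\<^sup>2)"
  proof (rule AE_I2)
    fix x
    have "cmod (f x) * cmod (g x) \<le> 2 * cmod (f x) * cmod (g x)" by simp
    also have "\<dots> \<le> (cmod (f x))\<^sup>2 + (cmod (g x))\<^sup>2" by (rule sum_squares_bound)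
    finally show "norm (f x * cnj (g x)) \<le> norm ((cmod (f x))\<^sup>2 + (cmod (g x))\<^sup>2)"
      by (simp add: norm_mult)
  qed
qed (use f g in measurable)

lemma enn2real_l2sq:
  assumes "f \<in> L2"
  shows "enn2real (l2sq f) = (LINT x|lborel. (cmod (f x))\<^sup>2)"
  using nn_integral_eq_integral[of lborel "\<lambda>x. (cmod (f x))\<^sup>2"] assms by (simp add: L2_def l2sq_def)

text \<open>Stated in the reals, because subtraction of extended nonnegative numbers is truncated.\<close>

lemma l2sq_diff_expand:
  assumes f: "f \<in> L2" and g: "g \<in> L2"
  shows "enn2real (l2sq (\<lambda>x. f x - g x))
    = enn2real (l2sq f) + enn2real (l2sq g) - 2 * Re (LINT x|lborel. f x * cnj (g x))"
proof -
  have sq: "integrable lborel (\<lambda>x. (cmod (f x))\<^sup>2)" "integrable lborel (\<lambda>x. (cmod (g x))\<^sup>2)"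
    using f g by (simp_all add: L2_def)
  note int = integrable_L2_mult_cnj[OF f g]
  have int': "integrable lborel (\<lambda>x. 2 * Re (f x * cnj (g x)))"
    by (rule integrable_mult_right, rule integrable_Re, rule int)
  have "(cmod (f x - g x))\<^sup>2 = (cmod (f x))\<^sup>2 + (cmod (g x))\<^sup>2 - 2 * Re (f x * cnj (g x))" for x
    unfolding cmod_power2 by (simp add: power2_eq_square algebra_simps)
  then have "enn2real (l2sq (\<lambda>x. f x - g x))
    = (LINT x|lborel. (cmod (f x))\<^sup>2 + (cmod (g x))\<^sup>2 - 2 * Re (f x * cnj (g x)))"
    by (simp add: enn2real_l2sq[OF L2_diff[OF f g]])
  also have "\<dots> = (LINT x|lborel. (cmod (f x))\<^sup>2) + (LINT x|lborel. (cmod (g x))\<^sup>2) - (LINT x|lborel. 2 * Re (f x * cnj (g x)))"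
    using sq int' by (subst Bochner_Integration.integral_diff) (auto intro: Bochner_Integration.integrable_add)
  also have "(LINT x|lborel. 2 * Re (f x * cnj (g x))) = 2 * Re (LINT x|lborel. f x * cnj (g x))"
    using integral_Re[OF int] by (simp only: integral_mult_right_zero)
  finally show ?thesis by (simp add: enn2real_l2sq f g)
qed

text \<open>The squared modulus of the transform of $f$ is the transform of the autocorrelation of $f$, up to
normalisation and reflection; the value of the autocorrelation at $0$ is the squared norm.\<close>

definition autocorr :: "(real \<Rightarrow> complex) \<Rightarrow> real \<Rightarrow> complex" where
  "autocorr f h = (LINT x|lborel. f x * cnj (f (x + h)))"

text \<open>By the inequality between the geometric and the arithmetic mean.\<close>

lemma nn_integral_autocorr_le:
  assumes [measurable]: "f \<in> borel_measurable borel"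
  shows "(\<integral>\<^sup>+x. ennreal (cmod (f x * cnj (f (x + h)))) \<partial>lborel) \<le> l2sq f"
proof -
  have "(\<integral>\<^sup>+x. ennreal (cmod (f x * cnj (f (x + h)))) \<partial>lborel)
    \<le> (\<integral>\<^sup>+x. ennreal (1/2) * (ennreal ((cmod (f x))\<^sup>2) + ennreal ((cmod (f (x + h)))\<^sup>2)) \<partial>lborel)"
  proof (intro nn_integral_mono)
    fix x
    have "cmod (f x * cnj (f (x + h))) \<le> 1/2 * ((cmod (f x))\<^sup>2 + (cmod (f (x + h)))\<^sup>2)"
      using sum_squares_bound[of "cmod (f x)" "cmod (f (x + h))"] by (simp add: norm_mult)
    then have "ennreal (cmod (f x * cnj (f (x + h)))) \<le> ennreal (1/2 * ((cmod (f x))\<^sup>2 + (cmod (f (x + h)))\<^sup>2))"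
      by (rule ennreal_leI)
    also have "\<dots> = ennreal (1/2) * (ennreal ((cmod (f x))\<^sup>2) + ennreal ((cmod (f (x + h)))\<^sup>2))"
      by (subst ennreal_mult) (auto simp: ennreal_plus)
    finally show "ennreal (cmod (f x * cnj (f (x + h)))) \<le> \<dots>" .
  qed
  also have "\<dots> = ennreal (1/2) * (l2sq f + l2sq (\<lambda>x. f (x + h)))"
    unfolding l2sq_def by (simp add: nn_integral_cmult nn_integral_add)
  also have "\<dots> = ennreal (1/2) * (2 * l2sq f)"
    by (simp add: l2sq_shift mult_2)
  also have "\<dots> = l2sq f"
  proof -
    have "ennreal (1/2) * ennreal 2 = 1" by (subst ennreal_mult[symmetric]) auto
    then show ?thesis by (simp add: mult.assoc[symmetric])
  qed
  finally show ?thesis .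
qed

lemma norm_autocorr_le:
  assumes f: "f \<in> L2"
  shows "cmod (autocorr f h) \<le> enn2real (l2sq f)"
proof -
  have [measurable]: "f \<in> borel_measurable borel" using f by auto
  have fin: "l2sq f < \<infinity>" using f by (simp add: L2_iff)
  have int: "integrable lborel (\<lambda>x. f x * cnj (f (x + h)))"
    using le_less_trans[OF nn_integral_autocorr_le fin, of h] by (intro integrableI_bounded) auto
  have "ennreal (cmod (autocorr f h)) \<le> l2sq f"
    unfolding autocorr_def
    using integral_norm_bound_ennreal[OF int] nn_integral_autocorr_le[of f h] by auto
  then show ?thesis
    using fin by (metis ennreal_enn2real ennreal_le_iff enn2real_nonneg infinity_ennreal_def)
qed

lemma Re_autocorr:
  assumes f: "f \<in> L2"
  shows "Re (autocorr f h) = enn2real (l2sq f) - enn2real (l2sq (\<lambda>x. f (x + h) - f x)) / 2"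
proof -
  have [measurable]: "f \<in> borel_measurable borel" using f by auto
  have "(\<lambda>x. f (x + h)) \<in> L2" using f by (simp add: L2_iff l2sq_shift)
  from l2sq_diff_expand[OF f this] show ?thesis
    by (simp add: autocorr_def l2sq_shift l2sq_minus_commute[of f] field_simps)
qed

text \<open>The real part of the autocorrelation at $h$ differs from its value at $0$ by half the squared distance
of $f$ from its translate.\<close>

lemma tendsto_Re_autocorr:
  assumes f: "f \<in> L2" and h: "h \<longlonglongrightarrow> (0::real)"
  shows "(\<lambda>k. Re (autocorr f (h k))) \<longlonglongrightarrow> enn2real (l2sq f)"
proof -
  have "(\<lambda>k. l2sq (\<lambda>x. f (x + h k) - f x)) \<longlonglongrightarrow> 0"
    using L2_translation_continuous[OF f] h by (simp add: l2_translation_cont_def)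
  then have "(\<lambda>k. l2sq (\<lambda>x. f (x + h k) - f x)) \<longlonglongrightarrow> ennreal 0" by (simp only: ennreal_0)
  then have "(\<lambda>k. enn2real (l2sq (\<lambda>x. f (x + h k) - f x))) \<longlonglongrightarrow> 0"
    by (rule tendsto_enn2real) simp
  then have "(\<lambda>k. enn2real (l2sq f) - enn2real (l2sq (\<lambda>x. f (x + h k) - f x)) / 2) \<longlonglongrightarrow> enn2real (l2sq f) - 0 / 2"
    by (intro tendsto_diff tendsto_divide tendsto_const) auto
  then show ?thesis by (simp add: Re_autocorr[OF f])
qed

lemma cnj_fourier_int: "cnj (fourier_int f t) = fourier_int (\<lambda>y. cnj (f (- y))) t"
proof -
  have "cnj (LINT x|lborel. exp (- (\<i> * of_real t * of_real x)) * f x)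
    = (LINT x|lborel. exp (\<i> * of_real t * of_real x) * cnj (f x))"
    by (subst Bochner_Integration.integral_cnj[symmetric]) (simp add: exp_cnj)
  also have "\<dots> = (LINT x|lborel. exp (- (\<i> * of_real t * of_real x)) * cnj (f (- x)))"
    by (subst lborel_integral_real_affine[where c = "-1" and t = 0]) auto
  finally show ?thesis by (simp add: fourier_int_eq)
qed

text \<open>A Gaussian factor makes all integrals absolutely convergent, so that the multiplication formula can be
applied twice. The Gaussian of width $1/e$ on the frequency side becomes a normal density of standard
deviation $e$ in the shift.\<close>

lemma fourier_gaussian_autocorr:
  assumes L1: "integrable lborel f" and L2: "f \<in> L2" and e: "e > 0"
  shows "(LINT t|lborel. of_real ((cmod (fourier_int f t))\<^sup>2 * exp (- (e * t)\<^sup>2 / 2)))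
    = (LINT z|lborel. of_real (std_normal_density z) * autocorr f (e * z))"
proof -
  have [measurable]: "f \<in> borel_measurable borel" using L2 by auto
  let ?g = "\<lambda>t. complex_of_real (exp (- (e * t)\<^sup>2 / 2))"
  let ?F = "fourier_int f"
  let ?w = "\<lambda>y. cnj (f (- y))"
  have [measurable]: "?F \<in> borel_measurable borel" by (rule borel_measurable_fourier_int) measurable
  have g: "integrable lborel ?g"
    using integrable_gaussian[OF e] by (intro integrable_of_real)
  have w: "integrable lborel ?w"
    using lborel_integrable_real_affine[OF L1, of "-1" 0] by simp
  have ge: "integrable lborel (\<lambda>t. exp (- (\<i> * of_real t * of_real x)) * ?g t)" for x
    using integrable_exp_mult[OF g, of x] by (simp add: mult.commute mult.left_commute)
  have Fg: "integrable lborel (\<lambda>t. cnj (?F t) * ?g t)"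
  proof (rule Bochner_Integration.integrable_bound)
    show "integrable lborel (\<lambda>t. of_real (LINT x|lborel. cmod (f x)) * ?g t)"
      using g by simp
    show "AE t in lborel. norm (cnj (?F t) * ?g t) \<le> norm (of_real (LINT x|lborel. cmod (f x)) * ?g t)"
      using norm_fourier_int_le[OF L1] by (intro AE_I2) (auto simp: norm_mult intro!: mult_right_mono)
  qed measurable
  \<comment> \<open>The conjugate of the transform of \<open>f\<close> is again a transform, so the multiplication formula applies a
    second time and leaves the transform of a modulated Gaussian.\<close>
  have inner: "fourier_int (\<lambda>t. cnj (?F t) * ?g t) x
     = (LINT z|lborel. of_real (std_normal_density z) * cnj (f (x + e * z)))" for x
  proof -
    have "fourier_int (\<lambda>t. cnj (?F t) * ?g t) x
      = (LINT t|lborel. fourier_int ?w t * (exp (- (\<i> * of_real t * of_real x)) * ?g t)) / of_real (sqrt (2 * pi))"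
      unfolding fourier_int_eq[of _ x] cnj_fourier_int
      by (intro arg_cong2[where f = "(/)"] Bochner_Integration.integral_cong refl) (simp add: mult_ac)
    also have "\<dots> = (LINT y|lborel. ?w y * of_real (sqrt (2 * pi) / e * std_normal_density ((x + y) / e))) / of_real (sqrt (2 * pi))"
      unfolding fourier_int_mult[OF w ge] gaussian_fourier[OF e] ..
    also have "\<dots> = (LINT y|lborel. ?w y * of_real (std_normal_density ((x + y) / e)) / of_real e)"
      by (subst integral_divide_zero[symmetric]) (intro Bochner_Integration.integral_cong refl, simp)
    also have "\<dots> = e *\<^sub>R (LINT z|lborel. ?w (- x + (- e) * z) * of_real (std_normal_density ((x + (- x + (- e) * z)) / e)) / of_real e)"
      using e by (subst lborel_integral_real_affine[where c = "- e" and t = "- x"]) auto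
    also have "\<dots> = (LINT z|lborel. of_real (std_normal_density z) * cnj (f (x + e * z)))"
    proof -
      have "(LINT z|lborel. ?w (- x + (- e) * z) * of_real (std_normal_density ((x + (- x + (- e) * z)) / e)) / of_real e)
        = (LINT z|lborel. of_real (std_normal_density z) * cnj (f (x + e * z)) / of_real e)"
        using e by (intro Bochner_Integration.integral_cong refl) (simp add: std_normal_density_def add.commute)
      then show ?thesis using e by (simp add: scaleR_conv_of_real)
    qed
    finally show ?thesis .
  qed
  let ?H = "\<lambda>x z. of_real (std_normal_density z) * (f x * cnj (f (x + e * z)))"
  have int: "integrable (lborel \<Otimes>\<^sub>M lborel) (case_prod ?H)"
  proof (rule integrableI_bounded)
    have "(\<integral>\<^sup>+p. ennreal (norm (case_prod ?H p)) \<partial>(lborel \<Otimes>\<^sub>M lborel))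
      = (\<integral>\<^sup>+z. \<integral>\<^sup>+x. ennreal (norm (?H x z)) \<partial>lborel \<partial>lborel)"
      by (subst lborel_pair.nn_integral_snd[symmetric]) auto
    also have "\<dots> = (\<integral>\<^sup>+z. ennreal (std_normal_density z) * (\<integral>\<^sup>+x. ennreal (cmod (f x * cnj (f (x + e * z)))) \<partial>lborel) \<partial>lborel)"
      by (simp add: norm_mult ennreal_mult nn_integral_cmult)
    also have "\<dots> \<le> (\<integral>\<^sup>+z. ennreal (std_normal_density z) * l2sq f \<partial>lborel)"
      by (intro nn_integral_mono mult_left_mono nn_integral_autocorr_le) auto
    also have "\<dots> = l2sq f"
      using prob_space.emeasure_space_1[OF prob_space_normal_density[of 1 0]]
      by (simp add: nn_integral_multc emeasure_density)
    also have "\<dots> < \<infinity>" using L2 by (simp add: L2_iff)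
    finally show "(\<integral>\<^sup>+p. ennreal (norm (case_prod ?H p)) \<partial>(lborel \<Otimes>\<^sub>M lborel)) < \<infinity>" .
  qed measurable
  have "(LINT t|lborel. of_real ((cmod (?F t))\<^sup>2 * exp (- (e * t)\<^sup>2 / 2))) = (LINT t|lborel. ?F t * (cnj (?F t) * ?g t))"
    by (intro Bochner_Integration.integral_cong) (auto simp: complex_norm_square mult_ac simp del: of_real_power)
  also have "\<dots> = (LINT x|lborel. f x * (LINT z|lborel. of_real (std_normal_density z) * cnj (f (x + e * z))))"
    unfolding fourier_int_mult[OF L1 Fg] inner ..
  also have "\<dots> = (LINT x|lborel. LINT z|lborel. ?H x z)"
    by (intro Bochner_Integration.integral_cong refl, subst integral_mult_right_zero[symmetric])
       (intro Bochner_Integration.integral_cong refl, simp add: mult_ac)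
  also have "\<dots> = (LINT z|lborel. LINT x|lborel. ?H x z)"
    by (rule lborel_pair.Fubini_integral[OF int, symmetric])
  also have "\<dots> = (LINT z|lborel. of_real (std_normal_density z) * autocorr f (e * z))"
    by (simp add: autocorr_def)
  finally show ?thesis .
qed

text \<open>Let the Gaussian factor in \<open>fourier_gaussian_autocorr\<close> increase to $1$. The left-hand side converges
monotonically to the squared norm of the transform; the right-hand side is a normal average of the
autocorrelation over shifts tending to $0$, hence converges to the squared norm of $f$.\<close>

theorem Plancherel_L1_L2:
  assumes L1: "integrable lborel f" and L2: "f \<in> L2"
  shows "l2sq (fourier_int f) = l2sq f"
proof -
  have [measurable]: "f \<in> borel_measurable borel" using L2 by auto
  have [measurable]: "fourier_int f \<in> borel_measurable borel" by (rule borel_measurable_fourier_int) measurable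
  have mA[measurable]: "autocorr f \<in> borel_measurable borel"
    unfolding autocorr_def[abs_def] by (intro lborel.borel_measurable_lebesgue_integral) measurable
  define e where "e k = 1 / real (Suc k)" for k
  have e: "e k > 0" for k by (simp add: e_def)
  have e0: "e \<longlonglongrightarrow> 0" unfolding e_def by (rule LIMSEQ_Suc[OF lim_1_over_n])
  let ?g = "\<lambda>k t. exp (- (e k * t)\<^sup>2 / 2)"
  define I where "I k = (LINT t|lborel. (cmod (fourier_int f t))\<^sup>2 * ?g k t)" for k
  have I: "(\<integral>\<^sup>+t. ennreal ((cmod (fourier_int f t))\<^sup>2 * ?g k t) \<partial>lborel) = ennreal (I k)" for k
    unfolding I_def
  proof (rule nn_integral_eq_integral)
    let ?B = "(LINT x|lborel. cmod (f x))\<^sup>2"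
    show "integrable lborel (\<lambda>t. (cmod (fourier_int f t))\<^sup>2 * ?g k t)"
    proof (rule Bochner_Integration.integrable_bound)
      show "integrable lborel (\<lambda>t. ?B * ?g k t)" using integrable_gaussian[OF e] by simp
      show "AE t in lborel. norm ((cmod (fourier_int f t))\<^sup>2 * ?g k t) \<le> norm (?B * ?g k t)"
        using norm_fourier_int_le[OF L1] by (intro AE_I2) (auto simp: abs_mult intro!: mult_right_mono power_mono)
    qed measurable
  qed auto
  have "(\<lambda>k. I k) \<longlonglongrightarrow> enn2real (l2sq f)"
  proof -
    have bd: "integrable lborel (\<lambda>z. of_real (std_normal_density z) * autocorr f (e k * z))" for k
    proof (rule Bochner_Integration.integrable_bound)
      show "integrable lborel (\<lambda>z. std_normal_density z * enn2real (l2sq f))" by simp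
      show "AE z in lborel. norm (of_real (std_normal_density z) * autocorr f (e k * z)) \<le> norm (std_normal_density z * enn2real (l2sq f))"
        using norm_autocorr_le[OF L2] by (intro AE_I2) (auto simp: norm_mult abs_mult intro!: mult_left_mono)
    qed measurable
    have "I k = Re (LINT t|lborel. of_real ((cmod (fourier_int f t))\<^sup>2 * ?g k t))" for k
      unfolding I_def by (simp only: integral_complex_of_real Re_complex_of_real)
    also have "\<dots> k = (LINT z|lborel. std_normal_density z * Re (autocorr f (e k * z)))" for k
      unfolding fourier_gaussian_autocorr[OF L1 L2 e]
      using integral_Re[OF bd, of k] by simp
    finally have I_eq: "I = (\<lambda>k. LINT z|lborel. std_normal_density z * Re (autocorr f (e k * z)))" by auto
    have "(\<lambda>k. LINT z|lborel. std_normal_density z * Re (autocorr f (e k * z))) \<longlonglongrightarrow> (LINT z|lborel. std_normal_density z * enn2real (l2sq f))"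
    proof (rule integral_dominated_convergence[where w = "\<lambda>z. std_normal_density z * enn2real (l2sq f)"])
      show "AE z in lborel. (\<lambda>k. std_normal_density z * Re (autocorr f (e k * z))) \<longlonglongrightarrow> std_normal_density z * enn2real (l2sq f)"
        using tendsto_mult_right[OF e0] by (intro AE_I2 tendsto_intros tendsto_Re_autocorr L2) auto
      show "AE z in lborel. norm (std_normal_density z * Re (autocorr f (e k * z))) \<le> std_normal_density z * enn2real (l2sq f)" for k
      proof (rule AE_I2)
        fix z
        have "\<bar>Re (autocorr f (e k * z))\<bar> \<le> enn2real (l2sq f)"
          using norm_autocorr_le[OF L2] abs_Re_le_cmod by (rule order_trans[rotated])
        then show "norm (std_normal_density z * Re (autocorr f (e k * z))) \<le> std_normal_density z * enn2real (l2sq f)"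
          by (simp add: abs_mult mult_left_mono)
      qed
    qed auto
    then show ?thesis using I_eq by simp
  qed
  then have "(\<lambda>k. ennreal (I k)) \<longlonglongrightarrow> ennreal (enn2real (l2sq f))"
    by (rule tendsto_ennrealI)
  moreover have "ennreal (enn2real (l2sq f)) = l2sq f"
    using L2 by (simp add: L2_iff)
  moreover have "(\<lambda>k. ennreal (I k)) \<longlonglongrightarrow> l2sq (fourier_int f)"
    unfolding I[symmetric] l2sq_def
  proof (rule nn_integral_LIMSEQ)
    have "(e j)\<^sup>2 \<le> (e i)\<^sup>2" if "i \<le> j" for i j
      using that e[of j] by (intro power_mono) (auto simp: e_def frac_le)
    then show "incseq (\<lambda>k t. ennreal ((cmod (fourier_int f t))\<^sup>2 * ?g k t))"
      by (auto simp: incseq_def le_fun_def power_mult_distrib intro!: ennreal_leI mult_left_mono mult_right_mono)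
    show "(\<lambda>k. ennreal ((cmod (fourier_int f t))\<^sup>2 * ?g k t)) \<longlonglongrightarrow> ennreal ((cmod (fourier_int f t))\<^sup>2)" for t
    proof -
      have "(\<lambda>k. (cmod (fourier_int f t))\<^sup>2 * ?g k t) \<longlonglongrightarrow> (cmod (fourier_int f t))\<^sup>2 * exp (- (0 * t)\<^sup>2 / 2)"
        by (intro tendsto_intros e0) auto
      then show ?thesis by (intro tendsto_ennrealI) simp
    qed
  qed measurable
  ultimately show ?thesis by (metis LIMSEQ_unique)
qed

section \<open>Completeness of the space of square-integrable functions\<close>

text \<open>The weights $2^k$ leave the sum of the $2^k |d_k|^2$ integrable, and $|d_k|$ is at most
$2^{-k} + 2^k |d_k|^2$ because one of the two terms dominates it.\<close>

lemma AE_summable_of_l2sq_geometric: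
  assumes [measurable]: "\<And>k. d k \<in> borel_measurable borel"
    and le: "\<And>k. l2sq (d k) \<le> ennreal ((1/4) ^ k)"
  shows "AE x in lborel. summable (\<lambda>k. d k x)"
proof -
  have "(\<integral>\<^sup>+x. (\<Sum>k. ennreal (2 ^ k * (cmod (d k x))\<^sup>2)) \<partial>lborel) = (\<Sum>k. ennreal (2 ^ k) * l2sq (d k))"
    by (subst nn_integral_suminf) (auto simp: l2sq_def ennreal_mult nn_integral_cmult)
  also have "\<dots> \<le> (\<Sum>k. ennreal ((1/2) ^ k))"
  proof (intro suminf_le summableI)
    fix k
    have "ennreal (2 ^ k) * l2sq (d k) \<le> ennreal (2 ^ k) * ennreal ((1/4) ^ k)"
      by (intro mult_left_mono le) auto
    also have "\<dots> = ennreal ((1/2) ^ k)"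
      by (simp add: ennreal_mult[symmetric] power_mult_distrib[symmetric])
    finally show "ennreal (2 ^ k) * l2sq (d k) \<le> ennreal ((1/2) ^ k)" .
  qed
  also have "\<dots> = ennreal (\<Sum>k. (1/2) ^ k)"
    by (intro suminf_ennreal2) (auto simp: summable_geometric)
  finally have fin: "(\<integral>\<^sup>+x. (\<Sum>k. ennreal (2 ^ k * (cmod (d k x))\<^sup>2)) \<partial>lborel) \<noteq> \<infinity>"
    by (auto simp: top_unique)
  have "AE x in lborel. (\<Sum>k. ennreal (2 ^ k * (cmod (d k x))\<^sup>2)) \<noteq> \<infinity>"
    by (rule nn_integral_PInf_AE[OF _ fin]) measurable
  then show ?thesis
  proof eventually_elim
    case (elim x)
    then have "summable (\<lambda>k. 2 ^ k * (cmod (d k x))\<^sup>2)"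
      by (intro summable_suminf_not_top) auto
    then have "summable (\<lambda>k. (1/2) ^ k + 2 ^ k * (cmod (d k x))\<^sup>2)"
      by (intro summable_add summable_geometric) auto
    then show "summable (\<lambda>k. d k x)"
    proof (rule summable_comparison_test'[where N = 0])
      fix k :: nat
      show "norm (d k x) \<le> (1/2) ^ k + 2 ^ k * (cmod (d k x))\<^sup>2"
      proof (cases "cmod (d k x) \<le> (1/2) ^ k")
        case False
        then have "1 \<le> 2 ^ k * cmod (d k x)"
          by (simp add: power_one_over field_simps)
        from mult_right_mono[OF this, of "cmod (d k x)"]
        have "cmod (d k x) \<le> 2 ^ k * (cmod (d k x))\<^sup>2" by (simp add: power2_eq_square mult.assoc)
        then show ?thesis by (simp add: add_increasing)
      qed (simp add: add_increasing2)
    qed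
  qed
qed

text \<open>A subsequence with geometrically small increments converges almost everywhere, and Fatou's lemma
transfers the Cauchy estimate to the limit.\<close>

theorem L2_complete:
  assumes f: "\<And>n. f n \<in> L2"
    and cauchy: "\<And>e::real. e > 0 \<Longrightarrow> \<exists>N. \<forall>m\<ge>N. \<forall>n\<ge>N. l2sq (\<lambda>x. f m x - f n x) \<le> ennreal e"
  shows "\<exists>g\<in>L2. (\<lambda>n. l2sq (\<lambda>x. f n x - g x)) \<longlonglongrightarrow> 0"
proof -
  have [measurable]: "f n \<in> borel_measurable borel" for n using f by auto
  have "\<forall>k. \<exists>N. \<forall>m\<ge>N. \<forall>n\<ge>N. l2sq (\<lambda>x. f m x - f n x) \<le> ennreal ((1/4) ^ k)"
    using cauchy by simp
  then obtain N where N: "\<And>k m n. m \<ge> N k \<Longrightarrow> n \<ge> N k \<Longrightarrow> l2sq (\<lambda>x. f m x - f n x) \<le> ennreal ((1/4) ^ k)"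
    by metis
  \<comment> \<open>The sum makes \<open>r (Suc k)\<close> an admissible index at level \<open>k\<close> as well; the summand \<open>k\<close> makes \<open>r\<close> unbounded.\<close>
  define r where "r k = k + (\<Sum>j\<le>k. N j)" for k
  have r1: "N k \<le> r k" for k
    unfolding r_def by (simp add: member_le_sum trans_le_add2)
  have r2: "N k \<le> r (Suc k)" for k
    using r1[of k] by (simp add: r_def)
  have rk: "k \<le> r k" for k by (simp add: r_def)
  define g where "g x = lim (\<lambda>k. f (r k) x)" for x
  have [measurable]: "g \<in> borel_measurable borel" unfolding g_def[abs_def] by measurable
  have "AE x in lborel. summable (\<lambda>k. f (r (Suc k)) x - f (r k) x)"
    by (rule AE_summable_of_l2sq_geometric) (auto intro!: N r1 r2)
  then have lim: "AE x in lborel. (\<lambda>k. f (r k) x) \<longlonglongrightarrow> g x"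
  proof eventually_elim
    case (elim x)
    have "(\<Sum>k<n. f (r (Suc k)) x - f (r k) x) = f (r n) x - f (r 0) x" for n
      by (rule sum_lessThan_telescope)
    then have "(\<lambda>n. f (r n) x - f (r 0) x) \<longlonglongrightarrow> (\<Sum>k. f (r (Suc k)) x - f (r k) x)"
      using summable_LIMSEQ[OF elim] by simp
    then have "convergent (\<lambda>n. f (r n) x - f (r 0) x)" by (rule convergentI)
    then have "convergent (\<lambda>n. f (r n) x)" by (simp add: convergent_diff_const_right_iff)
    then show ?case unfolding g_def by (rule convergent_LIMSEQ_iff[THEN iffD1])
  qed
  have conv: "(\<lambda>n. l2sq (\<lambda>x. f n x - g x)) \<longlonglongrightarrow> 0"
  proof (rule ennreal_tendsto_0I)
    fix e :: real assume "e > 0"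
    from cauchy[OF this] obtain N' where N': "\<And>m n. m \<ge> N' \<Longrightarrow> n \<ge> N' \<Longrightarrow> l2sq (\<lambda>x. f m x - f n x) \<le> ennreal e"
      by blast
    have "l2sq (\<lambda>x. f n x - g x) \<le> ennreal e" if n: "n \<ge> N'" for n
    proof -
      have "l2sq (\<lambda>x. f n x - g x) = (\<integral>\<^sup>+x. liminf (\<lambda>k. ennreal ((cmod (f n x - f (r k) x))\<^sup>2)) \<partial>lborel)"
        unfolding l2sq_def
      proof (rule nn_integral_cong_AE, use lim in eventually_elim)
        case (elim x)
        have "(\<lambda>k. ennreal ((cmod (f n x - f (r k) x))\<^sup>2)) \<longlonglongrightarrow> ennreal ((cmod (f n x - g x))\<^sup>2)"
          by (intro tendsto_ennrealI tendsto_intros elim)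
        then show ?case by (intro lim_imp_Liminf[symmetric]) auto
      qed
      also have "\<dots> \<le> liminf (\<lambda>k. l2sq (\<lambda>x. f n x - f (r k) x))"
        unfolding l2sq_def by (rule nn_integral_liminf) measurable
      also have "\<dots> \<le> ennreal e"
        using n rk by (intro Liminf_le eventually_sequentiallyI[of N'] N') (auto intro: order_trans)
      finally show ?thesis .
    qed
    then show "eventually (\<lambda>n. l2sq (\<lambda>x. f n x - g x) \<le> ennreal e) sequentially"
      by (rule eventually_sequentiallyI)
  qed
  obtain n where n: "l2sq (\<lambda>x. f n x - g x) \<le> ennreal 1"
    using ennreal_tendsto_0D[OF conv, of 1] by (auto simp: eventually_sequentially)
  have "l2sq (\<lambda>x. f n x - g x) < \<infinity>" by (rule le_less_trans[OF n]) simp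
  then have "(\<lambda>x. f n x - g x) \<in> L2" by (simp add: L2_iff)
  from L2_diff[OF f[of n] this] have "g \<in> L2" by simp
  then show ?thesis using conv by auto
qed

section \<open>The Fourier transform as a bijection of the square-integrable functions\<close>

text \<open>The truncations through which \<open>fourier\<close> is defined on functions that are not integrable.\<close>

definition truncate :: "nat \<Rightarrow> (real \<Rightarrow> complex) \<Rightarrow> real \<Rightarrow> complex" where
  "truncate N f x = indicator {- real N..real N} x * f x"

lemma truncate_diff: "truncate N (\<lambda>x. f x - g x) = (\<lambda>x. truncate N f x - truncate N g x)"
  by (auto simp: truncate_def algebra_simps)

lemma norm_truncate_le: "cmod (truncate N f x) \<le> cmod (f x)"
  by (auto simp: truncate_def norm_mult split: split_indicator)

lemma borel_measurable_truncate [measurable]: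
  "f \<in> borel_measurable borel \<Longrightarrow> truncate N f \<in> borel_measurable borel"
  unfolding truncate_def[abs_def] by measurable

lemma l2sq_truncate_le: "l2sq (truncate N f) \<le> l2sq f"
  by (intro l2sq_mono norm_truncate_le)

lemma truncate_L2: "f \<in> L2 \<Longrightarrow> truncate N f \<in> L2"
  using l2sq_truncate_le[of N f] by (auto simp: L2_iff)

lemma integrable_truncate:
  assumes f: "f \<in> L2"
  shows "integrable lborel (truncate N f)"
proof (rule Bochner_Integration.integrable_bound)
  have [measurable]: "f \<in> borel_measurable borel" using f by auto
  show "truncate N f \<in> borel_measurable lborel" by measurable
  have "integrable lborel (indicator {- real N..real N} :: real \<Rightarrow> real)" by simp
  then show "integrable lborel (\<lambda>x. indicator {- real N..real N} x + (cmod (f x))\<^sup>2 :: real)"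
    using f by (intro Bochner_Integration.integrable_add) (auto simp: L2_def)
  have "y \<le> 1 + y\<^sup>2" for y :: real
    using sum_squares_bound[of 1 y] sum_squares_bound[of y 1] zero_le_power2[of y] by (simp, linarith)
  then show "AE x in lborel. norm (truncate N f x) \<le> norm (indicator {- real N..real N} x + (cmod (f x))\<^sup>2 :: real)"
    by (intro AE_I2) (auto simp: truncate_def norm_mult split: split_indicator)
qed

lemma l2sq_truncate_split:
  assumes [measurable]: "f \<in> borel_measurable borel"
  shows "l2sq f = l2sq (truncate N f) + l2sq (\<lambda>x. f x - truncate N f x)"
proof -
  have "l2sq f = (\<integral>\<^sup>+x. ennreal ((cmod (truncate N f x))\<^sup>2) + ennreal ((cmod (f x - truncate N f x))\<^sup>2) \<partial>lborel)"
    unfolding l2sq_def by (intro nn_integral_cong) (auto simp: truncate_def split: split_indicator)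
  then show ?thesis unfolding l2sq_def by (simp add: nn_integral_add)
qed

lemma tendsto_truncate:
  assumes f: "f \<in> L2"
  shows "(\<lambda>N. l2sq (\<lambda>x. f x - truncate N f x)) \<longlonglongrightarrow> 0"
proof -
  have [measurable]: "f \<in> borel_measurable borel" using f by auto
  have "(\<lambda>N. l2sq (\<lambda>x. f x - truncate N f x)) \<longlonglongrightarrow> (\<integral>\<^sup>+(x::real). 0 \<partial>lborel)"
    unfolding l2sq_def
  proof (rule nn_integral_dominated_convergence[where w = "\<lambda>x. ennreal ((cmod (f x))\<^sup>2)"])
    show "AE x in lborel. (\<lambda>N. ennreal ((cmod (f x - truncate N f x))\<^sup>2)) \<longlonglongrightarrow> 0"
    proof (intro AE_I2 tendsto_eventually)
      fix x
      obtain N where "\<bar>x\<bar> \<le> real N" using real_arch_simple by blast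
      then show "eventually (\<lambda>N. ennreal ((cmod (f x - truncate N f x))\<^sup>2) = 0) sequentially"
        by (intro eventually_sequentiallyI[of N]) (auto simp: truncate_def indicator_def)
    qed
    show "AE x in lborel. ennreal ((cmod (f x - truncate N f x))\<^sup>2) \<le> ennreal ((cmod (f x))\<^sup>2)" for N
      by (intro AE_I2) (auto simp: truncate_def split: split_indicator)
  qed (use f in \<open>auto simp: L2_iff l2sq_def\<close>)
  then show ?thesis by simp
qed

lemma fourier_int_truncate_measurable [measurable]:
  "f \<in> L2 \<Longrightarrow> fourier_int (truncate N f) \<in> borel_measurable borel"
  by (intro borel_measurable_fourier_int borel_measurable_truncate L2_measurable)

lemma Plancherel_truncate:
  assumes "f \<in> L2"
  shows "l2sq (fourier_int (truncate N f)) = l2sq (truncate N f)"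
  by (intro Plancherel_L1_L2 integrable_truncate truncate_L2 assms)

lemma fourier_int_truncate_L2:
  assumes "f \<in> L2"
  shows "fourier_int (truncate N f) \<in> L2"
  using assms truncate_L2[OF assms, of N] by (auto simp: L2_iff Plancherel_truncate intro: fourier_int_truncate_measurable)

lemma Plancherel_diff:
  assumes "integrable lborel f" "f \<in> L2" "integrable lborel g" "g \<in> L2"
  shows "l2sq (\<lambda>t. fourier_int f t - fourier_int g t) = l2sq (\<lambda>x. f x - g x)"
proof -
  have "fourier_int (\<lambda>x. f x - g x) = (\<lambda>t. fourier_int f t - fourier_int g t)"
    using assms by (intro ext fourier_int_diff)
  then show ?thesis
    using Plancherel_L1_L2[of "\<lambda>x. f x - g x"] assms by (simp add: L2_diff)
qed

lemma truncate_cauchy: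
  assumes f: "f \<in> L2" and e: "e > (0::real)"
  shows "\<exists>N. \<forall>m\<ge>N. \<forall>n\<ge>N. l2sq (\<lambda>x. truncate m f x - truncate n f x) \<le> ennreal e"
proof -
  have [measurable]: "f \<in> borel_measurable borel" using f by auto
  obtain N where N: "\<And>n. n \<ge> N \<Longrightarrow> l2sq (\<lambda>x. f x - truncate n f x) \<le> ennreal (e / 4)"
    using ennreal_tendsto_0D[OF tendsto_truncate[OF f], of "e / 4"] e by (auto simp: eventually_sequentially)
  have "l2sq (\<lambda>x. truncate m f x - truncate n f x) \<le> ennreal e" if "m \<ge> N" "n \<ge> N" for m n
  proof -
    have "l2sq (\<lambda>x. truncate m f x - truncate n f x)
      \<le> 2 * l2sq (\<lambda>x. truncate m f x - f x) + 2 * l2sq (\<lambda>x. f x - truncate n f x)"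
      by (rule l2sq_triangle) measurable
    also have "\<dots> \<le> 2 * ennreal (e / 4) + 2 * ennreal (e / 4)"
      using N[OF that(1)] N[OF that(2)] l2sq_minus_commute[of f "truncate m f"]
      by (intro add_mono mult_left_mono) auto
    also have "\<dots> = ennreal (2 * (e / 4) + 2 * (e / 4))"
      using e by (simp add: ennreal_plus ennreal_mult del: times_divide_eq_right flip: distrib_right)
    finally show ?thesis by simp
  qed
  then show ?thesis by blast
qed

lemma tendsto_fourier_L1_L2:
  assumes L1: "integrable lborel f" and f: "f \<in> L2"
  shows "(\<lambda>N. l2sq (\<lambda>t. fourier_int (truncate N f) t - fourier_int f t)) \<longlonglongrightarrow> 0"
proof -
  have "l2sq (\<lambda>t. fourier_int (truncate N f) t - fourier_int f t) = l2sq (\<lambda>x. f x - truncate N f x)" for N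
    using L1 f by (subst l2sq_minus_commute) (intro Plancherel_diff integrable_truncate truncate_L2)
  then show ?thesis using tendsto_truncate[OF f] by simp
qed

text \<open>The transforms of the truncations form a Cauchy sequence, so the limit that \<open>fourier\<close> chooses exists.
For integrable functions \<open>fourier\<close> is defined by the integral instead, and agrees with that limit.\<close>

lemma
  assumes f: "f \<in> L2"
  shows fourier_L2: "fourier f \<in> L2"
    and tendsto_fourier: "(\<lambda>N. l2sq (\<lambda>t. fourier_int (truncate N f) t - fourier f t)) \<longlonglongrightarrow> 0"
proof -
  have "fourier f \<in> L2 \<and> (\<lambda>N. l2sq (\<lambda>t. fourier_int (truncate N f) t - fourier f t)) \<longlonglongrightarrow> 0"
  proof (cases "integrable lborel f")
    case True
    have [measurable]: "f \<in> borel_measurable borel" using f by auto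
    have "fourier_int f \<in> L2"
      using f Plancherel_L1_L2[OF True f] by (simp add: L2_iff borel_measurable_fourier_int)
    then show ?thesis
      using tendsto_fourier_L1_L2[OF True f] True by (simp add: fourier_def)
  next
    case False
    let ?P = "\<lambda>G. G \<in> L2 \<and> (\<lambda>N. l2sq (\<lambda>t. fourier_int (truncate N f) t - G t)) \<longlonglongrightarrow> 0"
    have "\<exists>G. ?P G"
    proof -
      have "\<exists>G\<in>L2. (\<lambda>N. l2sq (\<lambda>t. fourier_int (truncate N f) t - G t)) \<longlonglongrightarrow> 0"
      proof (rule L2_complete)
        show "\<exists>N. \<forall>m\<ge>N. \<forall>n\<ge>N. l2sq (\<lambda>t. fourier_int (truncate m f) t - fourier_int (truncate n f) t) \<le> ennreal e"
          if "e > 0" for e :: real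
          using truncate_cauchy[OF f that] by (simp add: Plancherel_diff integrable_truncate truncate_L2 f)
      qed (rule fourier_int_truncate_L2[OF f])
      then show ?thesis by blast
    qed
    then have "?P (SOME G. ?P G)" by (rule someI_ex)
    moreover have "fourier f = (SOME G. ?P G)"
      using False unfolding fourier_def l2sq_def truncate_def[abs_def] by simp
    ultimately show ?thesis by simp
  qed
  then show "fourier f \<in> L2" "(\<lambda>N. l2sq (\<lambda>t. fourier_int (truncate N f) t - fourier f t)) \<longlonglongrightarrow> 0"
    by auto
qed

text \<open>The transform of a function that is square-integrable but not integrable is an arbitrary representative
of a limit, so statements about it hold almost everywhere and are proved by exhibiting another limit of the same sequence.\<close>

lemma fourier_AE_eqI:
  assumes f: "f \<in> L2" and H: "H \<in> L2"
    and lim: "(\<lambda>N. l2sq (\<lambda>t. fourier_int (truncate N f) t - H t)) \<longlonglongrightarrow> 0"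
  shows "AE t in lborel. fourier f t = H t"
proof -
  have [measurable]: "fourier f \<in> borel_measurable borel" "H \<in> borel_measurable borel"
    using fourier_L2[OF f] H by auto
  note [measurable] = fourier_int_truncate_measurable[OF f]
  have "(\<lambda>N::nat. l2sq (\<lambda>t. fourier f t - H t)) \<longlonglongrightarrow> 0"
  proof (rule ennreal_tendsto_0_le)
    show "l2sq (\<lambda>t. fourier f t - H t) \<le> 2 * l2sq (\<lambda>t. fourier_int (truncate N f) t - fourier f t)
       + 2 * l2sq (\<lambda>t. fourier_int (truncate N f) t - H t)" for N
      using l2sq_triangle[of "fourier f" H "fourier_int (truncate N f)"]
      by (simp add: l2sq_minus_commute[of "fourier f"])
    show "(\<lambda>N. 2 * l2sq (\<lambda>t. fourier_int (truncate N f) t - fourier f t)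
       + 2 * l2sq (\<lambda>t. fourier_int (truncate N f) t - H t)) \<longlonglongrightarrow> 0"
      by (intro ennreal_tendsto_0_add ennreal_tendsto_0_cmult lim tendsto_fourier f) auto
  qed
  then have "l2sq (\<lambda>t. fourier f t - H t) = 0"
    by (simp add: LIMSEQ_const_iff)
  then show ?thesis by (subst (asm) l2sq_0_iff) auto
qed

lemma fourier_diff_AE:
  assumes f: "f \<in> L2" and g: "g \<in> L2"
  shows "AE t in lborel. fourier (\<lambda>x. f x - g x) t = fourier f t - fourier g t"
proof (rule fourier_AE_eqI)
  note [measurable] = fourier_int_truncate_measurable[OF f] fourier_int_truncate_measurable[OF g]
  have [measurable]: "fourier f \<in> borel_measurable borel" "fourier g \<in> borel_measurable borel"
    using fourier_L2[OF f] fourier_L2[OF g] by auto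
  show "(\<lambda>x. f x - g x) \<in> L2" "(\<lambda>t. fourier f t - fourier g t) \<in> L2"
    by (intro L2_diff fourier_L2 f g)+
  show "(\<lambda>N. l2sq (\<lambda>t. fourier_int (truncate N (\<lambda>x. f x - g x)) t - (fourier f t - fourier g t))) \<longlonglongrightarrow> 0"
  proof (rule ennreal_tendsto_0_le)
    show "l2sq (\<lambda>t. fourier_int (truncate N (\<lambda>x. f x - g x)) t - (fourier f t - fourier g t))
       \<le> 2 * l2sq (\<lambda>t. fourier_int (truncate N f) t - fourier f t)
         + 2 * l2sq (\<lambda>t. fourier_int (truncate N g) t - fourier g t)" for N
      using l2sq_diff_le[of "\<lambda>t. fourier_int (truncate N f) t - fourier f t" "\<lambda>t. fourier_int (truncate N g) t - fourier g t"]
      by (simp add: truncate_diff fourier_int_diff integrable_truncate f g algebra_simps)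
    show "(\<lambda>N. 2 * l2sq (\<lambda>t. fourier_int (truncate N f) t - fourier f t)
         + 2 * l2sq (\<lambda>t. fourier_int (truncate N g) t - fourier g t)) \<longlonglongrightarrow> 0"
      by (intro ennreal_tendsto_0_add ennreal_tendsto_0_cmult tendsto_fourier f g) auto
  qed
qed

lemma l2sq_reflect:
  assumes "f \<in> borel_measurable borel"
  shows "l2sq (\<lambda>x. f (- x)) = l2sq f"
  using l2sq_affine[OF assms, of "-1" 0] by simp

text \<open>The candidate for the preimage of $G$ is its inverse transform $u$. Expand the squared distance between
$G$ and the transform of a truncation $v$ of $u$. The multiplication formula turns the mixed term into
the pairing of $v$ with $u$, which is the squared norm of $v$, and Plancherel turns the two other terms
into the squared norms of $v$ and $u$. The distance is therefore the norm of the part of $u$ that was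
cut off.\<close>

lemma fourier_truncated_inverse:
  assumes L1: "integrable lborel G" and L2: "G \<in> L2"
  defines "u \<equiv> \<lambda>x. fourier_int G (- x)"
  shows "l2sq (\<lambda>t. fourier_int (truncate R u) t - G t) = l2sq (\<lambda>x. u x - truncate R u x)"
proof -
  have [measurable]: "G \<in> borel_measurable borel" using L2 by auto
  have [measurable]: "u \<in> borel_measurable borel"
    unfolding u_def using borel_measurable_fourier_int[of G] by measurable
  have lu: "l2sq u = l2sq G"
    unfolding u_def by (simp add: l2sq_reflect borel_measurable_fourier_int Plancherel_L1_L2[OF L1 L2])
  have u: "u \<in> L2" using L2 by (simp add: L2_iff lu)
  let ?v = "truncate R u"
  have v: "?v \<in> L2" "integrable lborel ?v" using u by (auto intro: truncate_L2 integrable_truncate)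
  have Fv: "fourier_int ?v \<in> L2" by (rule fourier_int_truncate_L2[OF u])
  have d1: "(\<lambda>t. fourier_int ?v t - G t) \<in> L2" and d2: "(\<lambda>x. u x - ?v x) \<in> L2"
    by (intro L2_diff Fv L2 u v)+
  \<comment> \<open>the mixed term is the squared norm of the truncation\<close>
  have "(LINT t|lborel. fourier_int ?v t * cnj (G t)) = (LINT x|lborel. ?v x * fourier_int (\<lambda>t. cnj (G t)) x)"
    using v L1 by (intro fourier_int_mult) auto
  also have "\<dots> = (LINT x|lborel. of_real ((cmod (?v x))\<^sup>2))"
  proof (intro Bochner_Integration.integral_cong refl)
    fix x
    have "fourier_int (\<lambda>t. cnj (G t)) x = cnj (u x)"
    proof -
      have "cnj (fourier_int G (- x)) = fourier_int (\<lambda>t. cnj (G t)) x"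
        unfolding fourier_int_eq by (simp add: exp_cnj flip: Bochner_Integration.integral_cnj)
      then show ?thesis by (simp add: u_def)
    qed
    then show "?v x * fourier_int (\<lambda>t. cnj (G t)) x = of_real ((cmod (?v x))\<^sup>2)"
      by (auto simp: truncate_def complex_norm_square split: split_indicator simp del: of_real_power)
  qed
  also have "\<dots> = of_real (enn2real (l2sq ?v))"
    by (simp add: enn2real_l2sq[OF v(1)] del: of_real_power)
  finally have "enn2real (l2sq (\<lambda>t. fourier_int ?v t - G t))
    = enn2real (l2sq (fourier_int ?v)) + enn2real (l2sq G) - 2 * enn2real (l2sq ?v)"
    using l2sq_diff_expand[OF Fv L2] by simp
  then have "enn2real (l2sq (\<lambda>t. fourier_int ?v t - G t)) + enn2real (l2sq ?v) = enn2real (l2sq u)"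
    by (simp add: Plancherel_truncate[OF u] lu)
  moreover have "enn2real (l2sq u) = enn2real (l2sq ?v) + enn2real (l2sq (\<lambda>x. u x - ?v x))"
    using v(1) d2 by (subst l2sq_truncate_split[of u R]) (auto simp: L2_iff enn2real_plus)
  ultimately have "enn2real (l2sq (\<lambda>t. fourier_int ?v t - G t)) = enn2real (l2sq (\<lambda>x. u x - ?v x))"
    by simp
  then show ?thesis
    using d1 d2 by (simp add: L2_iff) (metis ennreal_enn2real infinity_ennreal_def)
qed

text \<open>The inverse transforms of the truncations of $G$ form a Cauchy sequence by Plancherel; its limit is the
preimage, since \<open>fourier_truncated_inverse\<close> and Plancherel control the three errors made in
comparing its truncated transforms with $G$.\<close>

theorem fourier_surj:
  assumes G: "G \<in> L2"
  shows "\<exists>u\<in>L2. AE t in lborel. fourier u t = G t"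
proof -
  have [measurable]: "G \<in> borel_measurable borel" using G by auto
  note L1 = integrable_truncate[OF G] and L2 = truncate_L2[OF G]
  define u where "u N = (\<lambda>x. fourier_int (truncate N G) (- x))" for N
  have uL2: "u N \<in> L2" for N
  proof -
    have [measurable]: "fourier_int (truncate N G) \<in> borel_measurable borel"
      by (rule fourier_int_truncate_measurable[OF G])
    show ?thesis
      using fourier_int_truncate_L2[OF G, of N] unfolding u_def L2_iff by (auto simp: l2sq_reflect)
  qed
  have "l2sq (\<lambda>x. u m x - u n x) = l2sq (\<lambda>x. truncate m G x - truncate n G x)" for m n
  proof -
    have [measurable]: "fourier_int (truncate N G) \<in> borel_measurable borel" for N
      by (rule fourier_int_truncate_measurable[OF G])
    have "l2sq (\<lambda>x. u m x - u n x) = l2sq (\<lambda>x. fourier_int (truncate m G) x - fourier_int (truncate n G) x)"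
      unfolding u_def by (rule l2sq_reflect) measurable
    also have "\<dots> = l2sq (\<lambda>x. truncate m G x - truncate n G x)"
      by (intro Plancherel_diff L1 L2)
    finally show ?thesis .
  qed
  then obtain v where v: "v \<in> L2" and uv: "(\<lambda>N. l2sq (\<lambda>x. u N x - v x)) \<longlonglongrightarrow> 0"
    using L2_complete[of u] uL2 truncate_cauchy[OF G] by auto
  have "AE t in lborel. fourier v t = G t"
  proof (rule fourier_AE_eqI[OF v G], rule ennreal_tendsto_0I)
    fix e :: real assume e: "e > 0"
    have "eventually (\<lambda>N. l2sq (\<lambda>x. u N x - v x) \<le> ennreal (e / 10)) sequentially"
      using uv e by (intro ennreal_tendsto_0D) auto
    moreover have "eventually (\<lambda>N. l2sq (\<lambda>t. G t - truncate N G t) \<le> ennreal (e / 10)) sequentially"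
      using tendsto_truncate[OF G] e by (intro ennreal_tendsto_0D) auto
    ultimately have "eventually (\<lambda>N. l2sq (\<lambda>x. u N x - v x) \<le> ennreal (e / 10) \<and>
        l2sq (\<lambda>t. G t - truncate N G t) \<le> ennreal (e / 10)) sequentially"
      by eventually_elim auto
    then obtain N where N: "l2sq (\<lambda>x. u N x - v x) \<le> ennreal (e / 10)"
      "l2sq (\<lambda>t. G t - truncate N G t) \<le> ennreal (e / 10)"
      by (auto simp: eventually_sequentially)
    have "eventually (\<lambda>R. l2sq (\<lambda>x. u N x - truncate R (u N) x) \<le> ennreal (e / 10)) sequentially"
      using tendsto_truncate[OF uL2] e by (intro ennreal_tendsto_0D) auto
    then show "eventually (\<lambda>R. l2sq (\<lambda>t. fourier_int (truncate R v) t - G t) \<le> ennreal e) sequentially"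
    proof eventually_elim
      case (elim R)
      note [measurable] = fourier_int_truncate_measurable[OF v] fourier_int_truncate_measurable[OF uL2]
      have 1: "l2sq (\<lambda>t. fourier_int (truncate R v) t - fourier_int (truncate R (u N)) t) \<le> ennreal (e / 10)"
      proof -
        have "l2sq (\<lambda>t. fourier_int (truncate R v) t - fourier_int (truncate R (u N)) t)
          = l2sq (truncate R (\<lambda>x. v x - u N x))"
          unfolding truncate_diff by (intro Plancherel_diff integrable_truncate truncate_L2 v uL2)
        also have "\<dots> \<le> l2sq (\<lambda>x. v x - u N x)" by (rule l2sq_truncate_le)
        finally show ?thesis using N(1) l2sq_minus_commute[of v "u N"] by simp
      qed
      have 2: "l2sq (\<lambda>t. fourier_int (truncate R (u N)) t - truncate N G t) \<le> ennreal (e / 10)"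
        using fourier_truncated_inverse[OF L1 L2, of R N] elim by (simp add: u_def)
      have 3: "l2sq (\<lambda>t. truncate N G t - G t) \<le> ennreal (e / 10)"
        using N(2) l2sq_minus_commute[of G "truncate N G"] by simp
      have "l2sq (\<lambda>t. fourier_int (truncate R v) t - G t)
        \<le> 2 * l2sq (\<lambda>t. fourier_int (truncate R v) t - fourier_int (truncate R (u N)) t)
          + 2 * l2sq (\<lambda>t. fourier_int (truncate R (u N)) t - G t)"
        by (rule l2sq_triangle) measurable
      also have "\<dots> \<le> 2 * l2sq (\<lambda>t. fourier_int (truncate R v) t - fourier_int (truncate R (u N)) t)
          + 2 * (2 * l2sq (\<lambda>t. fourier_int (truncate R (u N)) t - truncate N G t) + 2 * l2sq (\<lambda>t. truncate N G t - G t))"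
        by (intro add_left_mono mult_left_mono l2sq_triangle) auto
      also have "\<dots> \<le> 2 * ennreal (e / 10) + 2 * (2 * ennreal (e / 10) + 2 * ennreal (e / 10))"
        by (intro add_mono mult_left_mono 1 2 3) auto
      also have "\<dots> = ennreal (2 * (e/10) + 2 * (2 * (e/10) + 2 * (e/10)))"
        using e by (simp add: ennreal_plus ennreal_mult del: times_divide_eq_right flip: distrib_right)
      finally show ?case by simp
    qed
  qed
  then show ?thesis using v by blast
qed

lemma
  assumes "G \<in> L2"
  shows fourier_inv_L2: "fourier_inv G \<in> L2"
    and fourier_fourier_inv: "AE t in lborel. fourier (fourier_inv G) t = G t"
proof -
  have "\<exists>f. f \<in> L2 \<and> (AE t in lborel. fourier f t = G t)" using fourier_surj[OF assms] by blast
  from someI_ex[OF this] show "fourier_inv G \<in> L2" "AE t in lborel. fourier (fourier_inv G) t = G t"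
    by (auto simp: fourier_inv_def)
qed

text \<open>This is how the loss of an estimator that is given by its transform is computed.\<close>

theorem sobolev_norm_sq_fourier_inv_diff:
  assumes G: "G \<in> L2" and f: "f \<in> L2"
  shows "sobolev_norm_sq s (\<lambda>x. fourier_inv G x - f x)
    = (\<integral>\<^sup>+t. ennreal ((1 + t\<^sup>2) powr s * (cmod (G t - fourier f t))\<^sup>2) \<partial>lborel)"
  unfolding sobolev_norm_sq_def
proof (rule nn_integral_cong_AE)
  show "AE t in lborel. ennreal ((1 + t\<^sup>2) powr s * (cmod (fourier (\<lambda>x. fourier_inv G x - f x) t))\<^sup>2)
      = ennreal ((1 + t\<^sup>2) powr s * (cmod (G t - fourier f t))\<^sup>2)"
    using fourier_diff_AE[OF fourier_inv_L2[OF G] f] fourier_fourier_inv[OF G]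
    by eventually_elim simp
qed

section \<open>Moments of the empirical characteristic function\<close>

context prob_space
begin

text \<open>The expansion of the powers of a partial sum: all products that contain the new summand
or the old partial sum to the first power have mean zero by independence, which leaves the recursions with increments $4$ and $6 \cdot 4 \cdot 4 n + 16$.\<close>

lemma
  fixes Z :: "nat \<Rightarrow> 'a \<Rightarrow> real"
  assumes indep: "indep_vars (\<lambda>_. borel) Z UNIV"
    and bound: "\<And>j \<omega>. \<bar>Z j \<omega>\<bar> \<le> 2"
    and mean: "\<And>j. expectation (Z j) = 0"
  shows second_moment_sum_le: "expectation (\<lambda>\<omega>. (\<Sum>j<n. Z j \<omega>)\<^sup>2) \<le> 4 * real n"
    and fourth_moment_sum_le: "expectation (\<lambda>\<omega>. (\<Sum>j<n. Z j \<omega>) ^ 4) \<le> 64 * (real n)\<^sup>2"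
proof -
  have Zm[measurable]: "Z j \<in> borel_measurable M" for j
    using indep by (auto simp: indep_vars_def)
  define S where "S n \<omega> = (\<Sum>j<n. Z j \<omega>)" for n \<omega>
  have Sm[measurable]: "S n \<in> borel_measurable M" for n
    unfolding S_def[abs_def] by measurable
  have SSuc: "S (Suc n) \<omega> = Z n \<omega> + S n \<omega>" for n \<omega> by (simp add: S_def)
  have Sb: "\<bar>S n \<omega>\<bar> \<le> 2 * real n" for n \<omega>
  proof -
    have "\<bar>S n \<omega>\<bar> \<le> (\<Sum>j<n. \<bar>Z j \<omega>\<bar>)" unfolding S_def by (rule sum_abs)
    also have "\<dots> \<le> (\<Sum>j<n. 2)" by (intro sum_mono bound)
    finally show ?thesis by simp
  qed
  have intZ[simp]: "integrable M (\<lambda>\<omega>. Z n \<omega> ^ a)" for n a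
    by (rule integrable_const_bound[where B = "2 ^ a"]) (auto simp: power_abs intro!: power_mono bound)
  have intS[simp]: "integrable M (\<lambda>\<omega>. S n \<omega> ^ b)" for n b
  proof (rule integrable_const_bound[where B = "(2 * real n) ^ b"])
    show "AE \<omega> in M. norm (S n \<omega> ^ b) \<le> (2 * real n) ^ b"
      unfolding real_norm_def power_abs by (intro AE_I2 power_mono Sb abs_ge_zero)
  qed measurable
  have indepS: "indep_var borel (Z n) borel (S n)" for n
    unfolding S_def[abs_def]
    by (rule indep_vars_sum) (auto intro: indep_vars_subset[OF indep])
  have indepP: "indep_var borel (\<lambda>\<omega>. Z n \<omega> ^ a) borel (\<lambda>\<omega>. S n \<omega> ^ b)" for n a b
    using indep_var_compose[OF indepS, of "\<lambda>x. x ^ a" borel "\<lambda>x. x ^ b" borel] by (simp add: comp_def)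
  have prod: "expectation (\<lambda>\<omega>. Z n \<omega> ^ a * S n \<omega> ^ b) = expectation (\<lambda>\<omega>. Z n \<omega> ^ a) * expectation (\<lambda>\<omega>. S n \<omega> ^ b)"
    "integrable M (\<lambda>\<omega>. Z n \<omega> ^ a * S n \<omega> ^ b)" for n a b
    by (rule indep_var_lebesgue_integral indep_var_integrable; intro intZ intS indepP)+
  have ES: "expectation (S n) = 0" for n
    unfolding S_def[abs_def] using intZ[of _ 1] by (simp add: mean)
  have EZ: "expectation (\<lambda>\<omega>. Z n \<omega> ^ a) \<le> 2 ^ a" for n a
  proof -
    have "expectation (\<lambda>\<omega>. Z n \<omega> ^ a) \<le> expectation (\<lambda>\<omega>. 2 ^ a)"
    proof (rule integral_mono)
      fix \<omega>
      have "\<bar>Z n \<omega>\<bar> ^ a \<le> 2 ^ a" by (intro power_mono bound) auto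
      then show "Z n \<omega> ^ a \<le> 2 ^ a" by (simp flip: power_abs)
    qed auto
    then show ?thesis by (simp add: prob_space)
  qed
  have 2: "expectation (\<lambda>\<omega>. (S n \<omega>)\<^sup>2) \<le> 4 * real n" for n
  proof (induction n)
    case (Suc n)
    have "(S (Suc n) \<omega>)\<^sup>2 = Z n \<omega> ^ 2 * S n \<omega> ^ 0 + 2 * (Z n \<omega> ^ 1 * S n \<omega> ^ 1) + Z n \<omega> ^ 0 * S n \<omega> ^ 2" for \<omega>
      unfolding SSuc by (simp add: power2_eq_square algebra_simps)
    then have "expectation (\<lambda>\<omega>. (S (Suc n) \<omega>)\<^sup>2)
      = expectation (\<lambda>\<omega>. Z n \<omega> ^ 2 * S n \<omega> ^ 0) + 2 * expectation (\<lambda>\<omega>. Z n \<omega> ^ 1 * S n \<omega> ^ 1)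
        + expectation (\<lambda>\<omega>. Z n \<omega> ^ 0 * S n \<omega> ^ 2)"
      using prod(2)[of n] by (simp only: Bochner_Integration.integral_add Bochner_Integration.integrable_add
         integral_mult_right_zero integrable_mult_right)
    also have "\<dots> = expectation (\<lambda>\<omega>. (Z n \<omega>)\<^sup>2) + expectation (\<lambda>\<omega>. (S n \<omega>)\<^sup>2)"
      unfolding prod(1) by (simp add: mean prob_space)
    also have "\<dots> \<le> 4 * real (Suc n)" using Suc EZ[of n 2] by simp
    finally show ?case .
  qed (simp add: S_def)
  then show "expectation (\<lambda>\<omega>. (\<Sum>j<n. Z j \<omega>)\<^sup>2) \<le> 4 * real n" by (simp add: S_def)
  have "expectation (\<lambda>\<omega>. S n \<omega> ^ 4) \<le> 64 * (real n)\<^sup>2"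
  proof (induction n)
    case (Suc n)
    have "S (Suc n) \<omega> ^ 4 = Z n \<omega> ^ 4 * S n \<omega> ^ 0 + (4 * (Z n \<omega> ^ 3 * S n \<omega> ^ 1) + (6 * (Z n \<omega> ^ 2 * S n \<omega> ^ 2)
        + (4 * (Z n \<omega> ^ 1 * S n \<omega> ^ 3) + Z n \<omega> ^ 0 * S n \<omega> ^ 4)))" for \<omega>
      unfolding SSuc by (simp add: eval_nat_numeral algebra_simps)
    then have "expectation (\<lambda>\<omega>. S (Suc n) \<omega> ^ 4)
      = expectation (\<lambda>\<omega>. Z n \<omega> ^ 4 * S n \<omega> ^ 0) + (4 * expectation (\<lambda>\<omega>. Z n \<omega> ^ 3 * S n \<omega> ^ 1)
        + (6 * expectation (\<lambda>\<omega>. Z n \<omega> ^ 2 * S n \<omega> ^ 2)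
        + (4 * expectation (\<lambda>\<omega>. Z n \<omega> ^ 1 * S n \<omega> ^ 3) + expectation (\<lambda>\<omega>. Z n \<omega> ^ 0 * S n \<omega> ^ 4))))"
      using prod(2)[of n] by (simp only: Bochner_Integration.integral_add Bochner_Integration.integrable_add
         integral_mult_right_zero integrable_mult_right)
    also have "\<dots> = expectation (\<lambda>\<omega>. Z n \<omega> ^ 4)
        + (6 * (expectation (\<lambda>\<omega>. (Z n \<omega>)\<^sup>2) * expectation (\<lambda>\<omega>. (S n \<omega>)\<^sup>2)) + expectation (\<lambda>\<omega>. S n \<omega> ^ 4))"
      unfolding prod(1) by (simp add: mean ES prob_space)
    also have "\<dots> \<le> 2 ^ 4 + (6 * (2\<^sup>2 * (4 * real n)) + 64 * (real n)\<^sup>2)"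
      by (intro add_mono mult_mono EZ 2 Suc.IH) auto
    also have "\<dots> \<le> 64 * (real (Suc n))\<^sup>2"
      by (simp add: power2_eq_square algebra_simps)
    finally show ?case .
  qed (simp add: S_def)
  then show "expectation (\<lambda>\<omega>. (\<Sum>j<n. Z j \<omega>) ^ 4) \<le> 64 * (real n)\<^sup>2" by (simp add: S_def)
qed

text \<open>Real and imaginary part of $e^{-itX_j}$ minus its mean are bounded by $2$; each of them contributes the
bounds for real sums. The factor $1/\sqrt{2\pi}$ of the empirical transform is estimated by $1$.\<close>

lemma
  fixes X :: "nat \<Rightarrow> 'a \<Rightarrow> real" and \<phi> :: complex
  assumes indep: "indep_vars (\<lambda>_. borel) X UNIV"
    and mean: "\<And>j. (LINT \<omega>|M. exp (- (\<i> * of_real t * of_real (X j \<omega>)))) = of_real (sqrt (2 * pi)) * \<phi>"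
    and n: "n > 0"
  shows empirical_fourier_second_moment:
      "(\<integral>\<^sup>+\<omega>. ennreal ((cmod (empirical_fourier n (\<lambda>j. X j \<omega>) t - \<phi>))\<^sup>2) \<partial>M) \<le> ennreal (8 / real n)"
    and empirical_fourier_fourth_moment:
      "(\<integral>\<^sup>+\<omega>. ennreal ((cmod (empirical_fourier n (\<lambda>j. X j \<omega>) t - \<phi>)) ^ 4) \<partial>M) \<le> ennreal (256 / (real n)\<^sup>2)"
proof -
  have Xm[measurable]: "X j \<in> borel_measurable M" for j
    using indep by (auto simp: indep_vars_def)
  define ch where "ch = of_real (sqrt (2 * pi)) * \<phi>"
  let ?e = "\<lambda>x::real. exp (- (\<i> * of_real t * of_real x))"
  have inte: "integrable M (\<lambda>\<omega>. ?e (X j \<omega>))" for j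
    by (rule integrable_const_bound[where B = 1]) auto
  have mean': "(LINT \<omega>|M. ?e (X j \<omega>)) = ch" for j using mean by (simp add: ch_def)
  have "cmod ch \<le> expectation (\<lambda>\<omega>. cmod (?e (X 0 \<omega>)))"
    unfolding mean'[of 0, symmetric] by (rule integral_norm_bound)
  then have ch1: "cmod ch \<le> 1" by (simp add: prob_space)
  have Zb: "cmod (?e x - ch) \<le> 2" for x
    using norm_triangle_ineq4[of "?e x" ch] ch1 by simp
  define R where "R j \<omega> = Re (?e (X j \<omega>) - ch)" for j \<omega>
  define I where "I j \<omega> = Im (?e (X j \<omega>) - ch)" for j \<omega>
  have R: "indep_vars (\<lambda>_. borel) R UNIV"
    unfolding R_def[abs_def] by (rule indep_vars_compose2[OF indep]) measurable
  have I: "indep_vars (\<lambda>_. borel) I UNIV"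
    unfolding I_def[abs_def] by (rule indep_vars_compose2[OF indep]) measurable
  have Rb: "\<bar>R j \<omega>\<bar> \<le> 2" and Ib: "\<bar>I j \<omega>\<bar> \<le> 2" for j \<omega>
    unfolding R_def I_def using abs_Re_le_cmod abs_Im_le_cmod Zb order_trans by blast+
  have int: "integrable M (\<lambda>\<omega>. ?e (X j \<omega>) - ch)" "(LINT \<omega>|M. ?e (X j \<omega>) - ch) = 0" for j
    using inte[of j] mean'[of j] by (auto simp: prob_space)
  have RE: "expectation (R j) = 0" and IE: "expectation (I j) = 0" for j
    unfolding R_def[abs_def] I_def[abs_def] using integral_Re[OF int(1)] integral_Im[OF int(1)] int(2) by simp_all
  define SR where "SR \<omega> = (\<Sum>j<n. R j \<omega>)" for \<omega>
  define SI where "SI \<omega> = (\<Sum>j<n. I j \<omega>)" for \<omega>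
  have [measurable]: "R j \<in> borel_measurable M" "I j \<in> borel_measurable M" for j
    using R I by (auto simp: indep_vars_def)
  have [measurable]: "SR \<in> borel_measurable M" "SI \<in> borel_measurable M"
    unfolding SR_def[abs_def] SI_def[abs_def] by measurable
  have Sb: "\<bar>SR \<omega>\<bar> \<le> 2 * real n" "\<bar>SI \<omega>\<bar> \<le> 2 * real n" for \<omega>
  proof -
    have "\<bar>SR \<omega>\<bar> \<le> (\<Sum>j<n. \<bar>R j \<omega>\<bar>)" "\<bar>SI \<omega>\<bar> \<le> (\<Sum>j<n. \<bar>I j \<omega>\<bar>)" unfolding SR_def SI_def by (rule sum_abs)+
    moreover have "(\<Sum>j<n. \<bar>R j \<omega>\<bar>) \<le> (\<Sum>j<n. 2)" "(\<Sum>j<n. \<bar>I j \<omega>\<bar>) \<le> (\<Sum>j<n. 2)" by (intro sum_mono Rb Ib)+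
    ultimately show "\<bar>SR \<omega>\<bar> \<le> 2 * real n" "\<bar>SI \<omega>\<bar> \<le> 2 * real n" by simp_all
  qed
  have intS: "integrable M (\<lambda>\<omega>. SR \<omega> ^ k)" "integrable M (\<lambda>\<omega>. SI \<omega> ^ k)" for k
  proof -
    have b: "AE \<omega> in M. norm (SR \<omega> ^ k) \<le> (2 * real n) ^ k" "AE \<omega> in M. norm (SI \<omega> ^ k) \<le> (2 * real n) ^ k"
      unfolding real_norm_def power_abs by (intro AE_I2 power_mono Sb abs_ge_zero)+
    show "integrable M (\<lambda>\<omega>. SR \<omega> ^ k)" by (rule integrable_const_bound[OF b(1)]) measurable
    show "integrable M (\<lambda>\<omega>. SI \<omega> ^ k)" by (rule integrable_const_bound[OF b(2)]) measurable
  qed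
  have diff: "cmod (empirical_fourier n (\<lambda>j. X j \<omega>) t - \<phi>) \<le> cmod (Complex (SR \<omega>) (SI \<omega>)) / real n" for \<omega>
  proof -
    have "(\<Sum>j<n. ?e (X j \<omega>)) - of_nat n * ch = Complex (SR \<omega>) (SI \<omega>)"
      by (simp add: SR_def SI_def R_def I_def complex_eq_iff sum_subtractf)
    moreover have "empirical_fourier n (\<lambda>j. X j \<omega>) t - \<phi>
      = ((\<Sum>j<n. ?e (X j \<omega>)) - of_nat n * ch) / of_real (real n * sqrt (2 * pi))"
      using n by (simp add: empirical_fourier_def ch_def field_simps)
    ultimately have "cmod (empirical_fourier n (\<lambda>j. X j \<omega>) t - \<phi>) = cmod (Complex (SR \<omega>) (SI \<omega>)) / (real n * sqrt (2 * pi))"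
      by (simp add: norm_divide norm_mult)
    also have "\<dots> \<le> cmod (Complex (SR \<omega>) (SI \<omega>)) / (real n * 1)"
      using n pi_gt3 by (intro divide_left_mono mult_left_mono) (auto simp: real_le_rsqrt)
    finally show ?thesis by simp
  qed
  have "(\<integral>\<^sup>+\<omega>. ennreal ((cmod (empirical_fourier n (\<lambda>j. X j \<omega>) t - \<phi>))\<^sup>2) \<partial>M)
    \<le> (\<integral>\<^sup>+\<omega>. ennreal (((SR \<omega>)\<^sup>2 + (SI \<omega>)\<^sup>2) / (real n)\<^sup>2) \<partial>M)"
  proof (intro nn_integral_mono ennreal_leI)
    fix \<omega>
    show "(cmod (empirical_fourier n (\<lambda>j. X j \<omega>) t - \<phi>))\<^sup>2 \<le> ((SR \<omega>)\<^sup>2 + (SI \<omega>)\<^sup>2) / (real n)\<^sup>2"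
      using power_mono[OF diff[of \<omega>], of 2] by (simp add: power_divide cmod_power2)
  qed
  also have "\<dots> = ennreal ((expectation (\<lambda>\<omega>. (SR \<omega>)\<^sup>2) + expectation (\<lambda>\<omega>. (SI \<omega>)\<^sup>2)) / (real n)\<^sup>2)"
    using intS by (subst nn_integral_eq_integral) auto
  also have "\<dots> \<le> ennreal (8 / real n)"
    using second_moment_sum_le[OF R Rb RE, of n] second_moment_sum_le[OF I Ib IE, of n] n
    by (intro ennreal_leI) (simp add: SR_def SI_def divide_le_eq power2_eq_square)
  finally show "(\<integral>\<^sup>+\<omega>. ennreal ((cmod (empirical_fourier n (\<lambda>j. X j \<omega>) t - \<phi>))\<^sup>2) \<partial>M) \<le> ennreal (8 / real n)" .
  have "(\<integral>\<^sup>+\<omega>. ennreal ((cmod (empirical_fourier n (\<lambda>j. X j \<omega>) t - \<phi>)) ^ 4) \<partial>M)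
    \<le> (\<integral>\<^sup>+\<omega>. ennreal ((2 * SR \<omega> ^ 4 + 2 * SI \<omega> ^ 4) / (real n) ^ 4) \<partial>M)"
  proof (intro nn_integral_mono ennreal_leI)
    fix \<omega>
    have "cmod (Complex (SR \<omega>) (SI \<omega>)) ^ 4 = ((SR \<omega>)\<^sup>2 + (SI \<omega>)\<^sup>2)\<^sup>2"
      using power_mult[of "cmod (Complex (SR \<omega>) (SI \<omega>))" 2 2] by (simp add: cmod_power2)
    also have "\<dots> \<le> 2 * SR \<omega> ^ 4 + 2 * SI \<omega> ^ 4"
      using norm_add_sq_le[of "(SR \<omega>)\<^sup>2" "(SI \<omega>)\<^sup>2"] by simp
    finally show "(cmod (empirical_fourier n (\<lambda>j. X j \<omega>) t - \<phi>)) ^ 4 \<le> (2 * SR \<omega> ^ 4 + 2 * SI \<omega> ^ 4) / (real n) ^ 4"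
      using power_mono[OF diff[of \<omega>], of 4] n by (auto simp: power_divide elim!: order_trans intro!: divide_right_mono)
  qed
  also have "\<dots> = ennreal ((2 * expectation (\<lambda>\<omega>. SR \<omega> ^ 4) + 2 * expectation (\<lambda>\<omega>. SI \<omega> ^ 4)) / (real n) ^ 4)"
    using intS by (subst nn_integral_eq_integral) auto
  also have "\<dots> \<le> ennreal (256 / (real n)\<^sup>2)"
    using fourth_moment_sum_le[OF R Rb RE, of n] fourth_moment_sum_le[OF I Ib IE, of n] n
    by (intro ennreal_leI) (simp add: SR_def SI_def divide_le_eq eval_nat_numeral)
  finally show "(\<integral>\<^sup>+\<omega>. ennreal ((cmod (empirical_fourier n (\<lambda>j. X j \<omega>) t - \<phi>)) ^ 4) \<partial>M) \<le> ennreal (256 / (real n)\<^sup>2)" .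
qed

end

section \<open>Transforms of densities and of kernel estimators\<close>

lemma densities_L2D:
  assumes "f \<in> densities_L2"
  shows "f \<in> borel_measurable borel" "0 \<le> f x" "integrable lborel f" "(\<lambda>x. complex_of_real (f x)) \<in> L2"
    "integrable lborel (\<lambda>x. complex_of_real (f x))"
proof -
  show [measurable]: "f \<in> borel_measurable borel" and "(\<lambda>x. complex_of_real (f x)) \<in> L2"
    using assms by (auto simp: densities_L2_def)
  show nn: "0 \<le> f x" for x using assms by (auto simp: densities_L2_def)
  have "prob_space (density lborel f)" using assms by (simp add: densities_L2_def)
  from prob_space.emeasure_space_1[OF this] have "(\<integral>\<^sup>+x. ennreal (f x) \<partial>lborel) = 1"
    by (simp add: emeasure_density)
  then show int: "integrable lborel f"
    using nn by (intro integrableI_nonneg) auto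
  show "integrable lborel (\<lambda>x. complex_of_real (f x))" using int by (rule integrable_of_real)
qed

lemma fourier_density:
  "f \<in> densities_L2 \<Longrightarrow> fourier (\<lambda>x. complex_of_real (f x)) = fourier_int (\<lambda>x. complex_of_real (f x))"
  using densities_L2D(5)[of f] by (simp add: fourier_def)

text \<open>It identifies the mean of the empirical transform of a sample with the transform of its density.\<close>

lemma expectation_exp_eq_fourier_int:
  assumes X: "distributed M lborel X (\<lambda>x. ennreal (f x))" and nn: "\<And>x. 0 \<le> f x"
  shows "(LINT \<omega>|M. exp (- (\<i> * of_real t * of_real (X \<omega>))))
    = of_real (sqrt (2 * pi)) * fourier_int (\<lambda>x. complex_of_real (f x)) t"
proof -
  have [measurable]: "f \<in> borel_measurable borel"
    using distributed_real_measurable[OF _ X] nn by simp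
  have [measurable]: "X \<in> measurable M lborel" using X by (rule distributed_measurable)
  have "(LINT \<omega>|M. exp (- (\<i> * of_real t * of_real (X \<omega>))))
    = (LINT x|distr M lborel X. exp (- (\<i> * of_real t * of_real x)))"
    by (subst integral_distr) measurable
  also have "\<dots> = (LINT x|density lborel f. exp (- (\<i> * of_real t * of_real x)))"
    by (simp add: distributed_distr_eq_density[OF X])
  also have "\<dots> = (LINT x|lborel. f x *\<^sub>R exp (- (\<i> * of_real t * of_real x)))"
    using nn by (subst integral_density) auto
  finally show ?thesis by (simp add: fourier_int_eq scaleR_conv_of_real mult.commute)
qed

text \<open>The convolution theorem, proved by Fubini's theorem. Nonnegativity of both functions makes the
integral of the modulus of the integrand a product of two integrals.\<close>

lemma fourier_int_conv:
  assumes f: "integrable lborel f" "\<And>x. 0 \<le> f x" and g: "integrable lborel g" "\<And>x. 0 \<le> g x"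
  shows "fourier_int (\<lambda>y. complex_of_real (conv f g y)) t
    = of_real (sqrt (2 * pi)) * fourier_int (\<lambda>x. complex_of_real (f x)) t * fourier_int (\<lambda>x. complex_of_real (g x)) t"
proof -
  have [measurable]: "f \<in> borel_measurable borel" "g \<in> borel_measurable borel"
    using f g by (auto dest: borel_measurable_integrable)
  let ?e = "\<lambda>y::real. exp (- (\<i> * of_real t * of_real y))"
  let ?H = "\<lambda>x y. ?e y * of_real (f (y - x) * g x)"
  have fc: "integrable lborel (\<lambda>x. complex_of_real (f x))" using f(1) by (rule integrable_of_real)
  have fs: "integrable lborel (\<lambda>y. f (y - x))" for x
    using lborel_integrable_real_affine[OF f(1), of 1 "- x"] by simp
  have fsI: "(LINT y|lborel. f (y - x)) = (LINT y|lborel. f y)" for x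
    using lborel_integral_real_affine[of 1 f "- x"] by simp
  have int: "integrable (lborel \<Otimes>\<^sub>M lborel) (case_prod ?H)"
  proof (rule lborel_pair.Fubini_integrable)
    have "(LINT y|lborel. norm (case_prod ?H (x, y))) = g x * (LINT y|lborel. f y)" for x
      using f(2) g(2) by (simp add: norm_mult abs_mult fsI mult.commute)
    then show "integrable lborel (\<lambda>x. LINT y|lborel. norm (case_prod ?H (x, y)))"
      using g(1) by simp
    show "AE x in lborel. integrable lborel (\<lambda>y. case_prod ?H (x, y))"
    proof (rule AE_I2)
      fix x
      show "integrable lborel (\<lambda>y. case_prod ?H (x, y))"
        by (rule Bochner_Integration.integrable_bound[where f = "\<lambda>y. f (y - x) * g x"])
           (use fs[of x] in \<open>auto simp: norm_mult abs_mult\<close>)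
    qed
  qed measurable
  have "(LINT y|lborel. ?e y * of_real (conv f g y)) = (LINT y|lborel. LINT x|lborel. ?H x y)"
    unfolding conv_def by (simp flip: integral_complex_of_real)
  also have "\<dots> = (LINT x|lborel. LINT y|lborel. ?H x y)"
    by (rule lborel_pair.Fubini_integral[OF int])
  also have "\<dots> = (LINT x|lborel. (?e x * of_real (g x)) * (of_real (sqrt (2 * pi)) * fourier_int (\<lambda>x. complex_of_real (f x)) t))"
  proof (intro Bochner_Integration.integral_cong refl)
    fix x
    have "(LINT y|lborel. ?H x y) = (LINT u|lborel. ?H x (x + 1 * u))"
      by (subst lborel_integral_real_affine[where c = 1 and t = x]) auto
    also have "\<dots> = (LINT u|lborel. (?e x * of_real (g x)) * (?e u * of_real (f u)))"
    proof (intro Bochner_Integration.integral_cong refl)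
      fix u
      have "?e (x + 1 * u) = ?e x * ?e u"
        unfolding exp_add[symmetric] by (simp add: algebra_simps)
      then show "?H x (x + 1 * u) = (?e x * of_real (g x)) * (?e u * of_real (f u))"
        by (simp add: mult_ac)
    qed
    finally show "(LINT y|lborel. ?H x y) = (?e x * of_real (g x)) * (of_real (sqrt (2 * pi)) * fourier_int (\<lambda>x. complex_of_real (f x)) t)"
      by (simp add: fourier_int_eq)
  qed
  also have "\<dots> = (LINT x|lborel. ?e x * of_real (g x)) * (of_real (sqrt (2 * pi)) * fourier_int (\<lambda>x. complex_of_real (f x)) t)"
    by (rule integral_mult_left_zero)
  finally show ?thesis
    unfolding fourier_int_eq[of "\<lambda>y. complex_of_real (conv f g y)"] fourier_int_eq[of "\<lambda>x. complex_of_real (g x)"]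
    by (simp add: mult_ac)
qed

lemma conv_nonneg: "(\<And>x. 0 \<le> f x) \<Longrightarrow> (\<And>x. 0 \<le> g x) \<Longrightarrow> 0 \<le> conv f g y"
  by (simp add: conv_def)

text \<open>Each summand is a reflected, rescaled and translated kernel; the reflection is why the transform of $K$
is evaluated at $-ht$.\<close>

lemma
  assumes K: "integrable lborel K" and h: "h > 0"
  shows integrable_kernel_estimator: "integrable lborel (kernel_estimator K h n y)"
    and fourier_int_kernel_estimator:
      "fourier_int (kernel_estimator K h n y) t
        = of_real (sqrt (2 * pi)) * fourier_int K (- (h * t)) * empirical_fourier n y t"
proof -
  have int: "integrable lborel (\<lambda>x. K ((z - x) / h))" for z
    using lborel_integrable_real_affine[OF K, of "- 1 / h" "z / h"] h by (simp add: diff_divide_distrib)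
  then show "integrable lborel (kernel_estimator K h n y)"
    unfolding kernel_estimator_def[abs_def] by auto
  have one: "(LINT x|lborel. exp (- (\<i> * of_real t * of_real x)) * K ((z - x) / h))
    = of_real h * (exp (- (\<i> * of_real t * of_real z)) * (of_real (sqrt (2 * pi)) * fourier_int K (- (h * t))))" for z
  proof -
    have "(LINT x|lborel. exp (- (\<i> * of_real t * of_real x)) * K ((z - x) / h))
      = h *\<^sub>R (LINT u|lborel. exp (- (\<i> * of_real t * of_real (z + (- h) * u))) * K ((z - (z + (- h) * u)) / h))"
      using h by (subst lborel_integral_real_affine[where c = "- h" and t = z]) auto
    also have "(LINT u|lborel. exp (- (\<i> * of_real t * of_real (z + (- h) * u))) * K ((z - (z + (- h) * u)) / h))
      = (LINT u|lborel. exp (- (\<i> * of_real t * of_real z)) * (exp (- (\<i> * of_real (- (h * t)) * of_real u)) * K u))"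
    proof (intro Bochner_Integration.integral_cong refl)
      fix u
      have "exp (- (\<i> * of_real t * of_real (z + (- h) * u)))
        = exp (- (\<i> * of_real t * of_real z)) * exp (- (\<i> * of_real (- (h * t)) * of_real u))"
        unfolding exp_add[symmetric] by (simp add: algebra_simps)
      then show "exp (- (\<i> * of_real t * of_real (z + (- h) * u))) * K ((z - (z + (- h) * u)) / h)
        = exp (- (\<i> * of_real t * of_real z)) * (exp (- (\<i> * of_real (- (h * t)) * of_real u)) * K u)"
        using h by simp
    qed
    finally show ?thesis
      by (simp add: scaleR_conv_of_real fourier_int_eq)
  qed
  have "(LINT x|lborel. exp (- (\<i> * of_real t * of_real x)) * kernel_estimator K h n y x)
    = of_real (1 / (real n * h)) * (LINT x|lborel. (\<Sum>j<n. exp (- (\<i> * of_real t * of_real x)) * K ((y j - x) / h)))"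
    unfolding kernel_estimator_def integral_mult_right_zero[symmetric]
    by (intro Bochner_Integration.integral_cong refl) (simp add: sum_distrib_left mult_ac)
  also have "\<dots> = of_real (1 / (real n * h)) * (\<Sum>j<n. of_real h * (exp (- (\<i> * of_real t * of_real (y j))) *
      (of_real (sqrt (2 * pi)) * fourier_int K (- (h * t)))))"
    by (subst Bochner_Integration.integral_sum) (auto simp: one intro!: integrable_exp_mult int)
  also have "\<dots> = of_real (1 / real n) * (of_real (sqrt (2 * pi)) * fourier_int K (- (h * t))) *
      (\<Sum>j<n. exp (- (\<i> * of_real t * of_real (y j))))"
    unfolding sum_distrib_left using h by (intro sum.cong refl) (simp add: field_simps)
  finally show "fourier_int (kernel_estimator K h n y) t
        = of_real (sqrt (2 * pi)) * fourier_int K (- (h * t)) * empirical_fourier n y t"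
    unfolding fourier_int_eq[of "kernel_estimator K h n y"] empirical_fourier_def by simp
qed

lemma kernel_estimator_L2:
  assumes K: "integrable lborel K" "K \<in> L2" and h: "h > 0"
  shows "kernel_estimator K h n y \<in> L2"
proof -
  have [measurable]: "K \<in> borel_measurable borel" using K by auto
  have one: "(\<lambda>x. K ((z - x) / h)) \<in> L2" for z
  proof -
    have "l2sq K = ennreal (1 / h) * l2sq (\<lambda>x. K ((z - x) / h))"
      using l2sq_affine[of K "- 1 / h" "z / h"] h by (simp add: diff_divide_distrib)
    then show ?thesis
      using K(2) h by (auto simp: L2_iff ennreal_mult_less_top)
  qed
  have sum: "(\<lambda>x. \<Sum>j<n. K ((y j - x) / h)) \<in> L2"
  proof (induction n)
    case (Suc n)
    from L2_add[OF this one[of "y n"]] show ?case by (simp add: add.commute)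
  qed (simp add: L2_iff l2sq_def)
  then show ?thesis
    unfolding kernel_estimator_def[abs_def] by (rule L2_cmult)
qed

lemma fourier_kernel_estimator:
  assumes "integrable lborel K" "h > 0"
  shows "fourier (kernel_estimator K h n y) t
    = of_real (sqrt (2 * pi)) * fourier_int K (- (h * t)) * empirical_fourier n y t"
  using integrable_kernel_estimator[OF assms] fourier_int_kernel_estimator[OF assms]
  by (simp add: fourier_def)

lemma measurable_empirical_fourier:
  assumes [measurable]: "\<And>j. X j \<in> borel_measurable M"
  shows "(\<lambda>(\<omega>, t). empirical_fourier n (\<lambda>j. X j \<omega>) t) \<in> borel_measurable (M \<Otimes>\<^sub>M lborel)"
  unfolding empirical_fourier_def by measurable

section \<open>Risk of the kernel estimator\<close>

lemma measurable_kernel_estimator_loss: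
  assumes K: "integrable lborel K" and h: "h > 0" and [measurable]: "\<phi> \<in> borel_measurable borel"
    and [measurable]: "\<And>j. Y j \<in> borel_measurable M"
  shows "(\<lambda>\<omega>. l2sq (\<lambda>t. fourier (kernel_estimator K h n (\<lambda>j. Y j \<omega>)) t - \<phi> t)) \<in> borel_measurable M"
proof -
  have [measurable]: "K \<in> borel_measurable borel" using K by (auto dest: borel_measurable_integrable)
  have [measurable]: "fourier_int K \<in> borel_measurable borel" by (rule borel_measurable_fourier_int) measurable
  note [measurable] = measurable_empirical_fourier[of Y M n]
  show ?thesis
    unfolding fourier_kernel_estimator[OF K h] l2sq_def
    by (rule lborel.borel_measurable_nn_integral) measurable
qed

text \<open>Near $0$ the order of the kernel gives the bound; away from $0$ its left-hand side is bounded, because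
the kernel is integrable, whereas $|u|^r$ stays away from zero.\<close>

lemma kernel_class_bias_bound:
  assumes K: "K \<in> kernel_class r" and r: "r > 0"
  shows "\<exists>B\<ge>0. \<forall>u. u \<noteq> 0 \<longrightarrow> cmod (1 - of_real (sqrt (2 * pi)) * fourier_int K u) \<le> B * \<bar>u\<bar> powr r"
proof -
  have int: "integrable lborel K" using K by (simp add: kernel_class_def)
  let ?b = "\<lambda>u. cmod (1 - of_real (sqrt (2 * pi)) * fourier_int K u)"
  obtain \<kappa> where "((\<lambda>t. ?b t / \<bar>t\<bar> powr r) \<longlongrightarrow> \<kappa>) (at 0)"
    using K by (auto simp: kernel_class_def fourier_def int)
  from order_tendstoD(2)[OF this, of "\<kappa> + 1"]
  obtain \<delta> where \<delta>: "\<delta> > 0" "\<And>u. u \<noteq> 0 \<Longrightarrow> \<bar>u\<bar> < \<delta> \<Longrightarrow> ?b u / \<bar>u\<bar> powr r < \<kappa> + 1"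
    by (auto simp: eventually_at dist_real_def)
  define A where "A = 1 + sqrt (2 * pi) * (LINT x|lborel. cmod (K x))"
  have A: "?b u \<le> A" for u
  proof -
    have "?b u \<le> 1 + cmod (of_real (sqrt (2 * pi)) * fourier_int K u)"
      using norm_triangle_ineq4[of 1 "of_real (sqrt (2 * pi)) * fourier_int K u"] by simp
    also have "\<dots> \<le> A"
      unfolding A_def norm_mult using norm_fourier_int_le[OF int, of u]
      by (intro add_left_mono mult_mono) auto
    finally show ?thesis .
  qed
  have A0: "0 \<le> A" by (simp add: A_def)
  \<comment> \<open>the first summand serves the arguments below \<open>\<delta>\<close>, the second one those above\<close>
  define B where "B = max 0 (\<kappa> + 1) + A / \<delta> powr r"
  have "?b u \<le> B * \<bar>u\<bar> powr r" if u: "u \<noteq> 0" for u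
  proof (cases "\<bar>u\<bar> < \<delta>")
    case True
    then have "?b u \<le> (\<kappa> + 1) * \<bar>u\<bar> powr r"
      using \<delta>(2)[OF u True] u by (simp add: divide_less_eq)
    also have "\<dots> \<le> B * \<bar>u\<bar> powr r"
      using A0 \<delta>(1) by (intro mult_right_mono) (auto simp: B_def add_increasing2)
    finally show ?thesis .
  next
    case False
    then have "\<delta> powr r \<le> \<bar>u\<bar> powr r" using \<delta>(1) r by (intro powr_mono2) auto
    then have "A * \<delta> powr r \<le> A * \<bar>u\<bar> powr r" using A0 by (rule mult_left_mono)
    then have "A \<le> A / \<delta> powr r * \<bar>u\<bar> powr r" using \<delta>(1) by (simp add: field_simps)
    also have "\<dots> \<le> B * \<bar>u\<bar> powr r"
      by (intro mult_right_mono) (auto simp: B_def)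
    finally show ?thesis using A[of u] by simp
  qed
  moreover have "B \<ge> 0" using A0 by (simp add: B_def)
  ultimately show ?thesis by blast
qed

lemma l2sq_dilate:
  assumes "f \<in> borel_measurable borel" "h > 0"
  shows "l2sq (\<lambda>t. f (- (h * t))) = ennreal (1 / h) * l2sq f"
proof -
  have "l2sq f = ennreal h * l2sq (\<lambda>t. f (- (h * t)))"
    using l2sq_affine[OF assms(1), of "- h" 0] assms(2) by simp
  moreover have "ennreal (1 / h) * ennreal h = 1"
    using assms(2) by (subst ennreal_mult[symmetric]) auto
  ultimately show ?thesis by (simp add: mult.assoc[symmetric])
qed

text \<open>On the frequency side the kernel estimator multiplies the empirical transform by the transform of the
rescaled kernel. The fluctuation of the empirical transform has variance of order $1/n$ and is integrated
against the rescaled kernel, of squared norm of order $1/h$; the bias is of order $h^{2r}$ by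
\<open>kernel_class_bias_bound\<close> and the smoothness of $\phi$. The bandwidth balances $1/(nh)$ with
$h^{2r}$.\<close>

lemma (in prob_space) kernel_estimator_risk:
  fixes Y :: "nat \<Rightarrow> 'a \<Rightarrow> real" and \<phi> :: "real \<Rightarrow> complex"
  assumes K: "K \<in> kernel_class r" and r: "r > 0" and c: "c > 0"
    and indep: "indep_vars (\<lambda>_. borel) Y UNIV"
    and mean: "\<And>j t. (LINT \<omega>|M. exp (- (\<i> * of_real t * of_real (Y j \<omega>)))) = of_real (sqrt (2 * pi)) * \<phi> t"
    and \<phi>m[measurable]: "\<phi> \<in> borel_measurable borel"
    and \<phi>: "(\<integral>\<^sup>+t. ennreal ((1 + t\<^sup>2) powr r * (cmod (\<phi> t))\<^sup>2) \<partial>lborel) < \<infinity>"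
  shows "\<exists>C\<ge>0. \<forall>n>0. (\<integral>\<^sup>+\<omega>. l2sq (\<lambda>t. fourier (kernel_estimator K (c * real n powr (- 1 / (2 * r + 1))) n (\<lambda>j. Y j \<omega>)) t - \<phi> t) \<partial>M)
    \<le> ennreal (C * real n powr (- 2 * r / (2 * r + 1)))"
proof -
  have int: "integrable lborel K" and KL2: "K \<in> L2" using K by (auto simp: kernel_class_def)
  have [measurable]: "K \<in> borel_measurable borel" using KL2 by auto
  have FKm[measurable]: "fourier_int K \<in> borel_measurable borel" by (rule borel_measurable_fourier_int) measurable
  have Ym[measurable]: "Y j \<in> borel_measurable M" for j
    using indep by (auto simp: indep_vars_def)
  obtain B where B: "B \<ge> 0" "\<And>u. u \<noteq> 0 \<Longrightarrow> cmod (1 - of_real (sqrt (2 * pi)) * fourier_int K u) \<le> B * \<bar>u\<bar> powr r"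
    using kernel_class_bias_bound[OF K r] by blast
  obtain S where S: "S \<ge> 0" "(\<integral>\<^sup>+t. ennreal ((1 + t\<^sup>2) powr r * (cmod (\<phi> t))\<^sup>2) \<partial>lborel) = ennreal S"
    using \<phi> by (auto simp: less_top_ennreal)
  obtain k where k: "k \<ge> 0" "l2sq K = ennreal k"
    using KL2 by (auto simp: L2_iff less_top_ennreal)
  interpret MP: pair_sigma_finite M lborel ..
  define C where "C = 32 * pi * k / c + 2 * B\<^sup>2 * c powr (2 * r) * S"
  have "(\<integral>\<^sup>+\<omega>. l2sq (\<lambda>t. fourier (kernel_estimator K (c * real n powr (- 1 / (2 * r + 1))) n (\<lambda>j. Y j \<omega>)) t - \<phi> t) \<partial>M)
    \<le> ennreal (C * real n powr (- 2 * r / (2 * r + 1)))" if n: "n > 0" for n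
  proof -
    define h where "h = c * real n powr (- 1 / (2 * r + 1))"
    have h: "h > 0" using c n by (simp add: h_def)
    let ?q = "complex_of_real (sqrt (2 * pi))"
    let ?k = "\<lambda>t. fourier_int K (- (h * t))"
    let ?m = "\<lambda>\<omega> t. empirical_fourier n (\<lambda>j. Y j \<omega>) t"
    have mm[measurable]: "(\<lambda>(\<omega>, t). ?m \<omega> t) \<in> borel_measurable (M \<Otimes>\<^sub>M lborel)"
      unfolding empirical_fourier_def by measurable
    have mm2[measurable]: "(\<lambda>\<omega>. ?m \<omega> t) \<in> borel_measurable M" for t
      unfolding empirical_fourier_def by measurable
    have F: "fourier (kernel_estimator K h n y) t = ?q * ?k t * empirical_fourier n y t" for y t
      by (rule fourier_kernel_estimator[OF int h])
    have q2: "(cmod ?q)\<^sup>2 = 2 * pi" by (simp add: norm_of_real)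
    have pt: "(cmod (?q * ?k t * ?m \<omega> t - \<phi> t))\<^sup>2
        \<le> 4 * pi * (cmod (?k t))\<^sup>2 * (cmod (?m \<omega> t - \<phi> t))\<^sup>2 + 2 * ((cmod (1 - ?q * ?k t))\<^sup>2 * (cmod (\<phi> t))\<^sup>2)" for \<omega> t
    proof -
      have "?q * ?k t * ?m \<omega> t - \<phi> t = ?q * ?k t * (?m \<omega> t - \<phi> t) + - ((1 - ?q * ?k t) * \<phi> t)"
        by (simp add: algebra_simps)
      then have "(cmod (?q * ?k t * ?m \<omega> t - \<phi> t))\<^sup>2
        \<le> 2 * (cmod (?q * ?k t * (?m \<omega> t - \<phi> t)))\<^sup>2 + 2 * (cmod (- ((1 - ?q * ?k t) * \<phi> t)))\<^sup>2"
        using norm_add_sq_le by metis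
      also have "\<dots> = 4 * pi * (cmod (?k t))\<^sup>2 * (cmod (?m \<omega> t - \<phi> t))\<^sup>2 + 2 * ((cmod (1 - ?q * ?k t))\<^sup>2 * (cmod (\<phi> t))\<^sup>2)"
        unfolding norm_minus_cancel norm_mult power_mult_distrib q2 by simp
      finally show ?thesis .
    qed
    have inner: "(\<integral>\<^sup>+\<omega>. ennreal ((cmod (?q * ?k t * ?m \<omega> t - \<phi> t))\<^sup>2) \<partial>M)
      \<le> ennreal (32 * pi / real n) * ennreal ((cmod (?k t))\<^sup>2)
        + ennreal (2 * B\<^sup>2 * h powr (2 * r)) * ennreal ((1 + t\<^sup>2) powr r * (cmod (\<phi> t))\<^sup>2)"
      if t: "t \<noteq> 0" for t
    proof -
      have "(\<integral>\<^sup>+\<omega>. ennreal ((cmod (?q * ?k t * ?m \<omega> t - \<phi> t))\<^sup>2) \<partial>M)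
        \<le> (\<integral>\<^sup>+\<omega>. ennreal (4 * pi * (cmod (?k t))\<^sup>2) * ennreal ((cmod (?m \<omega> t - \<phi> t))\<^sup>2)
            + ennreal (2 * ((cmod (1 - ?q * ?k t))\<^sup>2 * (cmod (\<phi> t))\<^sup>2)) \<partial>M)"
        using pt by (intro nn_integral_mono) (simp add: ennreal_mult[symmetric] ennreal_plus[symmetric] del: ennreal_plus)
      also have "\<dots> = ennreal (4 * pi * (cmod (?k t))\<^sup>2) * (\<integral>\<^sup>+\<omega>. ennreal ((cmod (?m \<omega> t - \<phi> t))\<^sup>2) \<partial>M)
            + ennreal (2 * ((cmod (1 - ?q * ?k t))\<^sup>2 * (cmod (\<phi> t))\<^sup>2))"
        by (simp add: nn_integral_add nn_integral_cmult emeasure_space_1)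
      also have "\<dots> \<le> ennreal (4 * pi * (cmod (?k t))\<^sup>2) * ennreal (8 / real n)
            + ennreal (2 * B\<^sup>2 * h powr (2 * r) * ((1 + t\<^sup>2) powr r * (cmod (\<phi> t))\<^sup>2))"
      proof (intro add_mono mult_left_mono ennreal_leI empirical_fourier_second_moment indep mean n)
        have "cmod (1 - ?q * ?k t) \<le> B * \<bar>h * t\<bar> powr r"
          using B(2)[of "- (h * t)"] t h by simp
        then have "(cmod (1 - ?q * ?k t))\<^sup>2 \<le> (B * \<bar>h * t\<bar> powr r)\<^sup>2"
          by (intro power_mono) auto
        also have "\<dots> = B\<^sup>2 * h powr (2 * r) * (t\<^sup>2) powr r"
        proof -
          have "(\<bar>h * t\<bar> powr r)\<^sup>2 = \<bar>h * t\<bar> powr (2 * r)"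
            by (simp add: power2_eq_square flip: powr_add)
          also have "\<dots> = h powr (2 * r) * \<bar>t\<bar> powr (2 * r)"
            using h by (simp add: abs_mult powr_mult)
          also have "\<bar>t\<bar> powr (2 * r) = (t\<^sup>2) powr r"
            using t by (simp add: powr_powr[symmetric] powr_numeral)
          finally show ?thesis by (simp add: power_mult_distrib)
        qed
        also have "\<dots> \<le> B\<^sup>2 * h powr (2 * r) * (1 + t\<^sup>2) powr r"
          using r by (intro mult_left_mono powr_mono2) auto
        finally show "2 * ((cmod (1 - ?q * ?k t))\<^sup>2 * (cmod (\<phi> t))\<^sup>2)
            \<le> 2 * B\<^sup>2 * h powr (2 * r) * ((1 + t\<^sup>2) powr r * (cmod (\<phi> t))\<^sup>2)"
          using mult_right_mono[of "(cmod (1 - ?q * ?k t))\<^sup>2" "B\<^sup>2 * h powr (2 * r) * (1 + t\<^sup>2) powr r" "(cmod (\<phi> t))\<^sup>2"]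
          by (simp add: mult_ac)
      qed auto
      also have "\<dots> = ennreal (32 * pi / real n) * ennreal ((cmod (?k t))\<^sup>2)
        + ennreal (2 * B\<^sup>2 * h powr (2 * r)) * ennreal ((1 + t\<^sup>2) powr r * (cmod (\<phi> t))\<^sup>2)"
        by (simp add: ennreal_mult[symmetric] field_simps)
      finally show ?thesis .
    qed
    have "(\<integral>\<^sup>+\<omega>. l2sq (\<lambda>t. fourier (kernel_estimator K h n (\<lambda>j. Y j \<omega>)) t - \<phi> t) \<partial>M)
      = (\<integral>\<^sup>+t. \<integral>\<^sup>+\<omega>. ennreal ((cmod (?q * ?k t * ?m \<omega> t - \<phi> t))\<^sup>2) \<partial>M \<partial>lborel)"
      unfolding F l2sq_def by (rule MP.Fubini'[symmetric]) measurable
    also have "\<dots> \<le> (\<integral>\<^sup>+t. ennreal (32 * pi / real n) * ennreal ((cmod (?k t))\<^sup>2)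
        + ennreal (2 * B\<^sup>2 * h powr (2 * r)) * ennreal ((1 + t\<^sup>2) powr r * (cmod (\<phi> t))\<^sup>2) \<partial>lborel)"
    \<comment> \<open>at frequency \<open>0\<close> the order of the kernel gives no information, as \<open>kernel_class\<close> is a punctured limit\<close>
    proof (rule nn_integral_mono_AE)
      have "AE t in lborel. t \<noteq> (0::real)" by (rule AE_lborel_singleton)
      then show "AE t in lborel. (\<integral>\<^sup>+\<omega>. ennreal ((cmod (?q * ?k t * ?m \<omega> t - \<phi> t))\<^sup>2) \<partial>M)
        \<le> ennreal (32 * pi / real n) * ennreal ((cmod (?k t))\<^sup>2)
        + ennreal (2 * B\<^sup>2 * h powr (2 * r)) * ennreal ((1 + t\<^sup>2) powr r * (cmod (\<phi> t))\<^sup>2)"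
        by eventually_elim (rule inner)
    qed
    also have "\<dots> = ennreal (32 * pi / real n) * l2sq ?k + ennreal (2 * B\<^sup>2 * h powr (2 * r)) * ennreal S"
      unfolding S(2)[symmetric] l2sq_def by (simp add: nn_integral_add nn_integral_cmult)
    also have "l2sq ?k = ennreal (1 / h) * ennreal k"
      using l2sq_dilate[OF FKm h] Plancherel_L1_L2[OF int KL2] k(2) by simp
    also have "ennreal (32 * pi / real n) * (ennreal (1 / h) * ennreal k) + ennreal (2 * B\<^sup>2 * h powr (2 * r)) * ennreal S
      = ennreal (32 * pi * k / (real n * h) + 2 * B\<^sup>2 * h powr (2 * r) * S)"
      using h k S by (simp add: ennreal_mult[symmetric] field_simps flip: ennreal_plus)
    also have "32 * pi * k / (real n * h) + 2 * B\<^sup>2 * h powr (2 * r) * S = C * real n powr (- 2 * r / (2 * r + 1))"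
    proof -
      have "real n * real n powr (- 1 / (2 * r + 1)) = real n powr (1 + (- 1 / (2 * r + 1)))"
        using n by (simp only: powr_add) simp
      also have "1 + (- 1 / (2 * r + 1)) = - (- 2 * r / (2 * r + 1))"
        using r by (simp add: field_simps)
      finally have 1: "real n * h = c / real n powr (- 2 * r / (2 * r + 1))"
        by (simp add: h_def powr_minus divide_inverse)
      have "h powr (2 * r) = c powr (2 * r) * (real n powr (- 1 / (2 * r + 1))) powr (2 * r)"
        using c by (simp add: h_def powr_mult)
      also have "(real n powr (- 1 / (2 * r + 1))) powr (2 * r) = real n powr (- 2 * r / (2 * r + 1))"
        by (simp add: powr_powr)
      finally show ?thesis unfolding 1 C_def by (simp add: algebra_simps)
    qed
    finally show ?thesis by (simp add: h_def)
  qed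
  moreover have "C \<ge> 0" using c k S B by (simp add: C_def)
  ultimately show ?thesis by blast
qed

section \<open>The error of inverting the estimated characteristic function\<close>

text \<open>The factor by which the squared transform of the target enters the squared error at a given frequency
when $\phi$ is replaced by its estimate $z$: the relative error of $z$ where $|z|^2$ reaches the cut-off
$b$, and $1$ where the frequency is discarded. The factor $2$ comes from separating this error from that
of the kernel estimator.\<close>

definition inversion_error :: "real \<Rightarrow> complex \<Rightarrow> complex \<Rightarrow> real" where
  "inversion_error b z \<phi> = (if b \<le> (cmod z)\<^sup>2 then 2 * (cmod (z - \<phi>))\<^sup>2 / (cmod z)\<^sup>2 else 1)"

lemma inversion_error_nonneg: "0 \<le> inversion_error b z \<phi>"
  by (simp add: inversion_error_def)

lemma borel_measurable_inversion_error [measurable (raw)]: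
  assumes [measurable]: "b \<in> borel_measurable M" "z \<in> borel_measurable M" "\<phi> \<in> borel_measurable M"
  shows "(\<lambda>x. inversion_error (b x) (z x) (\<phi> x)) \<in> borel_measurable M"
  unfolding inversion_error_def by measurable

text \<open>Here $L$ stands for the weight $(1+t^2)^s$. On the frequencies that are kept, the cut-off bounds
$L / |z|^2$ by $1/\alpha$.\<close>

lemma deconvolution_error_split:
  assumes \<alpha>: "\<alpha> > 0" and L: "L > 0"
  shows "L * (cmod (v * cnj z / complex_of_real (sqrt (2 * pi) * (cmod z)\<^sup>2) * (if \<alpha> * L \<le> (cmod z)\<^sup>2 then 1 else 0) - g))\<^sup>2
    \<le> (cmod (v - of_real (sqrt (2 * pi)) * \<phi> * g))\<^sup>2 / \<alpha> + L * (cmod g)\<^sup>2 * inversion_error (\<alpha> * L) z \<phi>"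
proof (cases "\<alpha> * L \<le> (cmod z)\<^sup>2")
  case True
  let ?q = "complex_of_real (sqrt (2 * pi))"
  have "0 < \<alpha> * L" using \<alpha> L by simp
  with True have z2: "0 < (cmod z)\<^sup>2" by linarith
  then have z: "z \<noteq> 0" by auto
  let ?u = "(v - ?q * \<phi> * g) / (?q * z)" and ?w = "- ((z - \<phi>) * g / z)"
  have "v * cnj z / complex_of_real (sqrt (2 * pi) * (cmod z)\<^sup>2) = v / (?q * z)"
    using z by (simp add: complex_norm_square field_simps del: of_real_power)
  then have "v * cnj z / complex_of_real (sqrt (2 * pi) * (cmod z)\<^sup>2) * (if \<alpha> * L \<le> (cmod z)\<^sup>2 then 1 else 0) - g = ?u + ?w"
    using z True by (simp add: field_simps)
  then have "L * (cmod (v * cnj z / complex_of_real (sqrt (2 * pi) * (cmod z)\<^sup>2) * (if \<alpha> * L \<le> (cmod z)\<^sup>2 then 1 else 0) - g))\<^sup>2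
      \<le> L * (2 * (cmod ?u)\<^sup>2 + 2 * (cmod ?w)\<^sup>2)"
    using L norm_add_sq_le[of ?u ?w] by simp
  also have "\<dots> = (cmod (v - ?q * \<phi> * g))\<^sup>2 * (L / (cmod z)\<^sup>2) / pi + L * (cmod g)\<^sup>2 * (2 * (cmod (z - \<phi>))\<^sup>2 / (cmod z)\<^sup>2)"
  proof -
    have "(cmod ?u)\<^sup>2 = (cmod (v - ?q * \<phi> * g))\<^sup>2 / (2 * pi * (cmod z)\<^sup>2)"
      by (simp add: norm_divide norm_mult power_divide power_mult_distrib)
    moreover have "(cmod ?w)\<^sup>2 = (cmod (z - \<phi>))\<^sup>2 * (cmod g)\<^sup>2 / (cmod z)\<^sup>2"
      unfolding norm_minus_cancel by (simp only: norm_divide norm_mult power_divide power_mult_distrib)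
    ultimately show ?thesis using z2 by (simp add: distrib_left mult_ac)
  qed
  also have "\<dots> \<le> (cmod (v - ?q * \<phi> * g))\<^sup>2 * (1 / \<alpha>) / 1 + L * (cmod g)\<^sup>2 * (2 * (cmod (z - \<phi>))\<^sup>2 / (cmod z)\<^sup>2)"
  proof (intro add_right_mono)
    have "L / (cmod z)\<^sup>2 \<le> 1 / \<alpha>" using True z2 \<alpha> by (simp add: field_simps)
    from mult_left_mono[OF this, of "(cmod (v - ?q * \<phi> * g))\<^sup>2"]
    show "(cmod (v - ?q * \<phi> * g))\<^sup>2 * (L / (cmod z)\<^sup>2) / pi \<le> (cmod (v - ?q * \<phi> * g))\<^sup>2 * (1 / \<alpha>) / 1"
      using pi_gt3 L \<alpha> by (intro frac_le) auto
  qed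
  finally show ?thesis using True by (simp add: inversion_error_def)
next
  case False
  then show ?thesis using \<alpha> by (simp add: inversion_error_def)
qed

text \<open>This bound is used where $\phi$ is too small to be estimated; with $b$ at least of order $1/m$ it is of
constant order in mean.\<close>

lemma inversion_error_le_crude:
  assumes b: "b > 0"
  shows "inversion_error b z \<phi> \<le> 2 * (cmod (z - \<phi>))\<^sup>2 / b + 1"
proof (cases "b \<le> (cmod z)\<^sup>2")
  case True
  then have "2 * (cmod (z - \<phi>))\<^sup>2 / (cmod z)\<^sup>2 \<le> 2 * (cmod (z - \<phi>))\<^sup>2 / b"
    using b by (intro divide_left_mono mult_pos_pos) auto
  with True show ?thesis by (simp add: inversion_error_def)
qed (use b in \<open>simp add: inversion_error_def\<close>)

text \<open>Where the frequency is kept, one factor $1/|z|^2$ is traded for $1/|\phi|^2$ through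
$|\phi|^2 \le 2|z-\phi|^2 + 2|z|^2$, at the price of a term with the fourth power of $z - \phi$. Where it is
discarded although $|\phi|^2 \ge 4b$, the error $|z - \phi|$ must exceed $|\phi|/2$.\<close>

lemma inversion_error_le_sharp:
  assumes b: "b > 0" and \<phi>: "\<phi> \<noteq> 0"
  shows "inversion_error b z \<phi> \<le> (if (cmod \<phi>)\<^sup>2 < 4 * b then 1 else 0)
    + (4 * (cmod (z - \<phi>))\<^sup>2 + 4 * (cmod (z - \<phi>)) ^ 4 / b) / (cmod \<phi>)\<^sup>2"
proof (cases "b \<le> (cmod z)\<^sup>2")
  case True
  define D where "D = (cmod (z - \<phi>))\<^sup>2"
  have D4: "(cmod (z - \<phi>)) ^ 4 = D\<^sup>2" by (simp add: D_def flip: power_mult)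
  have D0: "D \<ge> 0" by (simp add: D_def)
  have p: "0 < (cmod \<phi>)\<^sup>2" using \<phi> by simp
  have z: "0 < (cmod z)\<^sup>2" using True b by linarith
  have "(cmod \<phi>)\<^sup>2 \<le> 2 * D + 2 * (cmod z)\<^sup>2"
    using norm_add_sq_le[of "- (z - \<phi>)" z] unfolding D_def norm_minus_cancel by simp
  then have "2 * D * (cmod \<phi>)\<^sup>2 \<le> 2 * D * (2 * D + 2 * (cmod z)\<^sup>2)"
    using D0 by (intro mult_left_mono) auto
  then have "2 * D / (cmod z)\<^sup>2 \<le> (4 * D + 4 * D\<^sup>2 / (cmod z)\<^sup>2) / (cmod \<phi>)\<^sup>2"
    using p z by (simp add: field_simps power2_eq_square[of D])
  also have "\<dots> \<le> (4 * D + 4 * D\<^sup>2 / b) / (cmod \<phi>)\<^sup>2"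
    using True b z by (intro divide_right_mono add_left_mono divide_left_mono) auto
  finally show ?thesis using True by (simp add: inversion_error_def D4 D_def[symmetric])
next
  case False
  show ?thesis
  proof (cases "(cmod \<phi>)\<^sup>2 < 4 * b")
    case True
    then show ?thesis using False b by (simp add: inversion_error_def)
  next
    case large: False
    with False have "(2 * cmod z)\<^sup>2 < (cmod \<phi>)\<^sup>2" by (simp add: power_mult_distrib)
    then have "2 * cmod z < cmod \<phi>" by (rule power2_less_imp_less) simp
    then have "cmod \<phi> \<le> 2 * cmod (z - \<phi>)"
      using norm_triangle_ineq2[of \<phi> z] by (simp add: norm_minus_commute)
    then have "(cmod \<phi>)\<^sup>2 \<le> (2 * cmod (z - \<phi>))\<^sup>2" by (intro power_mono) auto
    then have "1 \<le> 4 * (cmod (z - \<phi>))\<^sup>2 / (cmod \<phi>)\<^sup>2" using \<phi> by (simp add: field_simps power_mult_distrib)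
    also have "\<dots> \<le> (4 * (cmod (z - \<phi>))\<^sup>2 + 4 * (cmod (z - \<phi>)) ^ 4 / b) / (cmod \<phi>)\<^sup>2"
      using b by (intro divide_right_mono) auto
    finally show ?thesis using False large by (simp add: inversion_error_def)
  qed
qed

text \<open>The two pointwise bounds are integrated with the moments of the empirical transform. As $b$ is at
least of order $1/m$, the fourth moment, of order $1/m^2$, divided by $b$ is again of order $1/m$.\<close>

lemma (in prob_space) expectation_inversion_error_le:
  fixes X :: "nat \<Rightarrow> 'a \<Rightarrow> real" and \<phi> :: complex
  assumes indep: "indep_vars (\<lambda>_. borel) X UNIV"
    and mean: "\<And>j. (LINT \<omega>|M. exp (- (\<i> * of_real t * of_real (X j \<omega>)))) = of_real (sqrt (2 * pi)) * \<phi>"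
    and m: "m > 0" and \<phi>: "\<phi> \<noteq> 0" and c: "c > 0" and b: "c / real m \<le> b"
  shows "(\<integral>\<^sup>+\<omega>. ennreal (inversion_error b (empirical_fourier m (\<lambda>j. X j \<omega>) t) \<phi>) \<partial>M)
    \<le> ennreal ((if (cmod \<phi>)\<^sup>2 < 4 * b then 1 else 0) + (32 + 1024 / c) * min 1 (1 / (real m * (cmod \<phi>)\<^sup>2)))"
proof -
  have Xm[measurable]: "X j \<in> borel_measurable M" for j
    using indep by (auto simp: indep_vars_def)
  let ?D = "\<lambda>\<omega>. cmod (empirical_fourier m (\<lambda>j. X j \<omega>) t - \<phi>)"
  let ?R = "\<lambda>\<omega>. inversion_error b (empirical_fourier m (\<lambda>j. X j \<omega>) t) \<phi>"
  let ?i = "if (cmod \<phi>)\<^sup>2 < 4 * b then 1 else 0 :: real"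
  have [measurable]: "?D \<in> borel_measurable M" unfolding empirical_fourier_def by measurable
  have b0: "b > 0" using b c m by (meson divide_pos_pos less_le_trans of_nat_0_less_iff)
  have cb: "1 / b \<le> real m / c" using b b0 c m by (simp add: field_simps)
  have p: "0 < (cmod \<phi>)\<^sup>2" using \<phi> by simp
  note m2 = empirical_fourier_second_moment[OF indep mean m]
  note m4 = empirical_fourier_fourth_moment[OF indep mean m]
  have crude: "(\<integral>\<^sup>+\<omega>. ennreal (?R \<omega>) \<partial>M) \<le> ennreal (1 + 16 / c)"
  proof -
    have "(\<integral>\<^sup>+\<omega>. ennreal (?R \<omega>) \<partial>M) \<le> (\<integral>\<^sup>+\<omega>. ennreal (2 / b) * ennreal ((?D \<omega>)\<^sup>2) + 1 \<partial>M)"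
    proof (intro nn_integral_mono)
      fix \<omega>
      have "ennreal (?R \<omega>) \<le> ennreal (2 / b * (?D \<omega>)\<^sup>2 + 1)"
        using inversion_error_le_crude[OF b0] by (intro ennreal_leI) simp
      then show "ennreal (?R \<omega>) \<le> ennreal (2 / b) * ennreal ((?D \<omega>)\<^sup>2) + 1"
        using b0 by (simp add: ennreal_mult ennreal_plus del: times_divide_eq_left)
    qed
    also have "\<dots> = ennreal (2 / b) * (\<integral>\<^sup>+\<omega>. ennreal ((?D \<omega>)\<^sup>2) \<partial>M) + 1"
      by (simp add: nn_integral_add nn_integral_cmult emeasure_space_1)
    also have "\<dots> \<le> ennreal (2 / b) * ennreal (8 / real m) + 1"
      by (intro add_mono mult_left_mono m2) auto
    also have "\<dots> = ennreal (2 / b * (8 / real m) + 1)"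
      using b0 by (simp add: ennreal_mult'[symmetric] ennreal_plus del: times_divide_eq_left times_divide_eq_right)
    also have "\<dots> \<le> ennreal (1 + 16 / c)"
    proof (intro ennreal_leI)
      have "2 / b * (8 / real m) = 16 / real m * (1 / b)" by simp
      also have "\<dots> \<le> 16 / real m * (real m / c)" by (intro mult_left_mono cb) auto
      finally show "2 / b * (8 / real m) + 1 \<le> 1 + 16 / c" using m by simp
    qed
    finally show ?thesis .
  qed
  have sharp: "(\<integral>\<^sup>+\<omega>. ennreal (?R \<omega>) \<partial>M) \<le> ennreal (?i + (32 + 1024 / c) * (1 / (real m * (cmod \<phi>)\<^sup>2)))"
  proof -
    have "(\<integral>\<^sup>+\<omega>. ennreal (?R \<omega>) \<partial>M) \<le> (\<integral>\<^sup>+\<omega>. ennreal ?i + (ennreal (4 / (cmod \<phi>)\<^sup>2) * ennreal ((?D \<omega>)\<^sup>2)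
        + ennreal (4 / (b * (cmod \<phi>)\<^sup>2)) * ennreal ((?D \<omega>) ^ 4)) \<partial>M)"
    proof (intro nn_integral_mono)
      fix \<omega>
      have "ennreal (?R \<omega>) \<le> ennreal (?i + (4 / (cmod \<phi>)\<^sup>2 * (?D \<omega>)\<^sup>2 + 4 / (b * (cmod \<phi>)\<^sup>2) * (?D \<omega>) ^ 4))"
        using inversion_error_le_sharp[OF b0 \<phi>] by (intro ennreal_leI) (simp add: add_divide_distrib)
      also have "\<dots> = ennreal ?i + (ennreal (4 / (cmod \<phi>)\<^sup>2) * ennreal ((?D \<omega>)\<^sup>2)
        + ennreal (4 / (b * (cmod \<phi>)\<^sup>2)) * ennreal ((?D \<omega>) ^ 4))"
        using b0 p by (simp add: ennreal_mult ennreal_plus del: times_divide_eq_left)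
      finally show "ennreal (?R \<omega>) \<le> \<dots>" .
    qed
    also have "\<dots> = ennreal ?i + (ennreal (4 / (cmod \<phi>)\<^sup>2) * (\<integral>\<^sup>+\<omega>. ennreal ((?D \<omega>)\<^sup>2) \<partial>M)
        + ennreal (4 / (b * (cmod \<phi>)\<^sup>2)) * (\<integral>\<^sup>+\<omega>. ennreal ((?D \<omega>) ^ 4) \<partial>M))"
      by (simp add: nn_integral_add nn_integral_cmult emeasure_space_1)
    also have "\<dots> \<le> ennreal ?i + (ennreal (4 / (cmod \<phi>)\<^sup>2) * ennreal (8 / real m)
        + ennreal (4 / (b * (cmod \<phi>)\<^sup>2)) * ennreal (256 / (real m)\<^sup>2))"
      by (intro add_mono mult_left_mono m2 m4) auto
    also have "\<dots> = ennreal (?i + (4 / (cmod \<phi>)\<^sup>2 * (8 / real m) + 4 / (b * (cmod \<phi>)\<^sup>2) * (256 / (real m)\<^sup>2)))"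
      using b0 p by (simp add: ennreal_mult[symmetric] ennreal_plus del: times_divide_eq_left times_divide_eq_right)
    also have "\<dots> \<le> ennreal (?i + (32 + 1024 / c) * (1 / (real m * (cmod \<phi>)\<^sup>2)))"
    proof (intro ennreal_leI add_left_mono)
      have "4 / (cmod \<phi>)\<^sup>2 * (8 / real m) + 4 / (b * (cmod \<phi>)\<^sup>2) * (256 / (real m)\<^sup>2)
        = 32 / (real m * (cmod \<phi>)\<^sup>2) + 1024 / ((real m)\<^sup>2 * (cmod \<phi>)\<^sup>2) * (1 / b)"
        by (simp add: field_simps)
      also have "\<dots> \<le> 32 / (real m * (cmod \<phi>)\<^sup>2) + 1024 / ((real m)\<^sup>2 * (cmod \<phi>)\<^sup>2) * (real m / c)"
        by (intro add_left_mono mult_left_mono cb) auto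
      also have "\<dots> = (32 + 1024 / c) * (1 / (real m * (cmod \<phi>)\<^sup>2))"
      proof -
        have 1: "32 / (real m * (cmod \<phi>)\<^sup>2) = 32 * (1 / (real m * (cmod \<phi>)\<^sup>2))" by simp
        have 2: "1024 / ((real m)\<^sup>2 * (cmod \<phi>)\<^sup>2) * (real m / c) = 1024 / c * (1 / (real m * (cmod \<phi>)\<^sup>2))"
          using m by (simp add: power2_eq_square[of "real m"])
        show ?thesis unfolding 1 2 by (rule distrib_right[symmetric])
      qed
      finally show "4 / (cmod \<phi>)\<^sup>2 * (8 / real m) + 4 / (b * (cmod \<phi>)\<^sup>2) * (256 / (real m)\<^sup>2)
        \<le> (32 + 1024 / c) * (1 / (real m * (cmod \<phi>)\<^sup>2))" .
    qed
    finally show ?thesis .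
  qed
  \<comment> \<open>The constant of the sharp bound exceeds that of the crude one, so it serves both sides of the minimum.\<close>
  show ?thesis
  proof (cases "1 \<le> 1 / (real m * (cmod \<phi>)\<^sup>2)")
    case True
    have "(\<integral>\<^sup>+\<omega>. ennreal (?R \<omega>) \<partial>M) \<le> ennreal (?i + (32 + 1024 / c) * 1)"
    proof (rule order_trans[OF crude ennreal_leI])
      have "16 / c \<le> 1024 / c" using c by (intro divide_right_mono) auto
      then show "1 + 16 / c \<le> ?i + (32 + 1024 / c) * 1" by simp
    qed
    with True show ?thesis by (simp only: min_absorb1)
  next
    case False
    then have "min 1 (1 / (real m * (cmod \<phi>)\<^sup>2)) = 1 / (real m * (cmod \<phi>)\<^sup>2)" by simp
    with sharp show ?thesis by (simp only:)
  qed
qed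

section \<open>Rates\<close>

lemma min_1_le_powr:
  assumes "x > 0" "0 \<le> \<theta>" "\<theta> \<le> (1::real)"
  shows "min 1 x \<le> x powr \<theta>"
proof (cases "x \<le> 1")
  case True
  then have "x powr 1 \<le> x powr \<theta>" using assms by (intro powr_mono') auto
  then show ?thesis using assms True by simp
next
  case False
  then show ?thesis using assms by (simp add: ge_one_powr_ge_zero)
qed

text \<open>Here $w = 1 + t^2$ and $P = |\phi|^2$. If $P$ is below the cut-off, ordinary smoothness bounds
$w^{a+s} \alpha$ from below by a constant, so that a power of it dominates $1$. The minimum is bounded by its
interpolation $x^\theta$ for an exponent $\theta$ between $0$ and $1$; the choice $\theta = \min(1, \kappa)$ keeps the
resulting growth $w^{a \theta}$ below $w^{p-s}$, since $a \theta \le (a + s) \kappa = p - s$.\<close>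

lemma spectral_cutoff_rate:
  fixes a s p d \<alpha> P w m C :: real
  defines "\<kappa> \<equiv> (p - s) / (a + s)"
  assumes w: "w \<ge> 1" and d: "d > 0" and P: "d \<le> w powr a * P" and a: "a > 0" and s: "0 \<le> s" "s < p"
    and \<alpha>: "\<alpha> > 0" and m: "m > 0" and C: "C \<ge> 0"
  shows "(if P < 4 * (\<alpha> * w powr s) then 1 else 0) + C * min 1 (1 / (m * P))
    \<le> w powr (p - s) * ((4 / d * \<alpha>) powr \<kappa> + C * max 1 (1 / d) * m powr (- min 1 \<kappa>))"
proof -
  have \<kappa>: "\<kappa> > 0" using a s by (simp add: \<kappa>_def)
  have w0: "w > 0" using w by simp
  have "0 < w powr a * P" using P d by linarith
  then have P0: "P > 0" using zero_less_mult_pos[of "w powr a" P] w0 by simp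
  have 1: "(if P < 4 * (\<alpha> * w powr s) then 1 else 0) \<le> w powr (p - s) * (4 / d * \<alpha>) powr \<kappa>"
  proof (cases "P < 4 * (\<alpha> * w powr s)")
    case True
    have "d \<le> w powr a * P" by (rule P)
    also have "\<dots> \<le> w powr a * (4 * (\<alpha> * w powr s))" using True by (intro mult_left_mono) auto
    also have "\<dots> = 4 * \<alpha> * w powr (a + s)" by (simp add: powr_add)
    finally have "1 \<le> 4 / d * \<alpha> * w powr (a + s)" using d by (simp add: field_simps)
    then have "1 \<le> (4 / d * \<alpha> * w powr (a + s)) powr \<kappa>"
      using \<kappa> by (intro ge_one_powr_ge_zero) auto
    also have "\<dots> = (4 / d * \<alpha>) powr \<kappa> * (w powr (a + s)) powr \<kappa>"
      using d \<alpha> by (subst powr_mult) auto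
    also have "(w powr (a + s)) powr \<kappa> = w powr (p - s)"
      using a s by (simp add: powr_powr \<kappa>_def)
    finally show ?thesis using True by (simp add: mult.commute)
  qed auto
  define \<theta> where "\<theta> = min 1 \<kappa>"
  have \<theta>: "0 \<le> \<theta>" "\<theta> \<le> 1" "\<theta> \<le> \<kappa>" using \<kappa> by (auto simp: \<theta>_def)
  define x where "x = w powr a / m"
  have x: "x > 0" using w0 m by (simp add: x_def)
  have "1 / (m * P) \<le> 1 / d * x"
    using P d m P0 by (simp add: x_def field_simps)
  also have "\<dots> \<le> max 1 (1 / d) * x" using x by (intro mult_right_mono) auto
  finally have "min 1 (1 / (m * P)) \<le> min (max 1 (1 / d) * 1) (max 1 (1 / d) * x)" by auto
  also have "\<dots> = max 1 (1 / d) * min 1 x" by (simp add: min_mult_distrib_left)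
  also have "\<dots> \<le> max 1 (1 / d) * x powr \<theta>"
    using min_1_le_powr[OF x \<theta>(1,2)] by (intro mult_left_mono) auto
  also have "x powr \<theta> = w powr (a * \<theta>) * m powr (- \<theta>)"
    unfolding x_def using w0 m by (subst powr_divide) (auto simp: powr_powr powr_minus divide_inverse)
  also have "\<dots> \<le> w powr (p - s) * m powr (- \<theta>)"
  proof (intro mult_right_mono powr_mono w)
    have "a * \<theta> \<le> (a + s) * \<kappa>" using a s \<theta> \<kappa> by (intro mult_mono) auto
    also have "\<dots> = p - s" using a s by (simp add: \<kappa>_def)
    finally show "a * \<theta> \<le> p - s" .
  qed auto
  finally have "min 1 (1 / (m * P)) \<le> max 1 (1 / d) * (w powr (p - s) * m powr (- \<theta>))"
    by (simp add: mult_left_mono)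
  then have 2: "C * min 1 (1 / (m * P)) \<le> C * (max 1 (1 / d) * (w powr (p - s) * m powr (- \<theta>)))"
    using C by (rule mult_left_mono)
  show ?thesis using add_mono[OF 1 2] by (simp add: \<theta>_def algebra_simps)
qed

text \<open>The threshold is the sum of the two orders $n^{-2(s+a)/\nu}$ and $1/m$; the first one is used alone in
the denominator of the kernel term, and both appear when the power $\kappa$ is taken.\<close>

lemma balanced_threshold_rate:
  fixes a p s c n m A B C S :: real
  defines "\<kappa> \<equiv> (p - s) / (a + s)" and "\<nu> \<equiv> 2 * (p + a) + 1"
  assumes a: "a > 0" and s: "0 \<le> s" "s < p" and c: "c > 0" and n: "n \<ge> 1" and m: "m \<ge> 1"
    and nn: "A > 0" "B \<ge> 0" "C \<ge> 0" "S \<ge> 0"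
    and \<alpha>: "\<alpha> = c * (n powr (- 2 * (s + a) / \<nu>) + 1 / m)"
  shows "C * n powr (- 2 * (p + a) / \<nu>) / \<alpha> + S * ((A * \<alpha>) powr \<kappa> + B * m powr (- min 1 \<kappa>))
    \<le> (C / c + S * ((2 * A * c) powr \<kappa> + B)) * (n powr (- 2 * (p - s) / \<nu>) + m powr (- min 1 \<kappa>))"
proof -
  have \<kappa>: "\<kappa> > 0" using a s by (simp add: \<kappa>_def)
  have \<nu>: "\<nu> > 0" using a s by (simp add: \<nu>_def)
  define x where "x = n powr (- 2 * (s + a) / \<nu>)"
  define u where "u = n powr (- 2 * (p - s) / \<nu>)"
  define v where "v = m powr (- min 1 \<kappa>)"
  have x: "x > 0" and u: "u > 0" and v: "v > 0" using n m by (auto simp: x_def u_def v_def)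
  have \<alpha>': "\<alpha> = c * (x + 1 / m)" by (simp add: \<alpha> x_def)
  have "C * n powr (- 2 * (p + a) / \<nu>) / \<alpha> \<le> C * n powr (- 2 * (p + a) / \<nu>) / (c * x)"
    using c x m nn by (intro divide_left_mono mult_pos_pos) (auto simp: \<alpha>' add_pos_pos)
  also have "\<dots> = C / c * (n powr (- 2 * (p + a) / \<nu>) / x)" by simp
  also have "n powr (- 2 * (p + a) / \<nu>) / x = u"
    unfolding x_def u_def powr_diff[symmetric] by (simp add: algebra_simps flip: diff_divide_distrib)
  also have "C / c * u \<le> C / c * (u + v)" using nn c v by (intro mult_left_mono) auto
  finally have 1: "C * n powr (- 2 * (p + a) / \<nu>) / \<alpha> \<le> C / c * (u + v)" .
  have "(A * \<alpha>) powr \<kappa> \<le> (2 * A * c * max x (1 / m)) powr \<kappa>"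
  proof (rule powr_mono2)
    have "A * \<alpha> = A * c * (x + 1 / m)" by (simp add: \<alpha>')
    also have "\<dots> \<le> A * c * (2 * max x (1 / m))" using nn c by (intro mult_left_mono) auto
    finally show "A * \<alpha> \<le> 2 * A * c * max x (1 / m)" by simp
  qed (use \<kappa> nn c x m in \<open>auto simp: \<alpha>'\<close>)
  also have "\<dots> = (2 * A * c) powr \<kappa> * max x (1 / m) powr \<kappa>"
    using nn c x by (subst powr_mult) auto
  also have "max x (1 / m) powr \<kappa> \<le> x powr \<kappa> + (1 / m) powr \<kappa>"
    by (auto simp: max_def)
  also have "x powr \<kappa> = u"
  proof -
    have "(s + a) * \<kappa> = p - s" using a s by (simp add: \<kappa>_def add.commute)
    then have "- 2 * (s + a) / \<nu> * \<kappa> = - 2 * (p - s) / \<nu>"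
      by (metis mult.assoc times_divide_eq_left)
    then show ?thesis by (simp only: x_def u_def powr_powr)
  qed
  also have "(1 / m) powr \<kappa> = m powr (- \<kappa>)" using m by (simp add: powr_minus_divide powr_divide)
  also have "\<dots> \<le> v" unfolding v_def using m by (intro powr_mono) auto
  finally have "(A * \<alpha>) powr \<kappa> \<le> (2 * A * c) powr \<kappa> * (u + v)" by (simp add: mult_left_mono)
  moreover have "B * v \<le> B * (u + v)" using nn u by (intro mult_left_mono) auto
  ultimately have "(A * \<alpha>) powr \<kappa> + B * v \<le> ((2 * A * c) powr \<kappa> + B) * (u + v)"
    by (simp add: distrib_right)
  then have "S * ((A * \<alpha>) powr \<kappa> + B * v) \<le> S * (((2 * A * c) powr \<kappa> + B) * (u + v))"
    using nn by (intro mult_left_mono)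
  from add_mono[OF 1 this] show ?thesis by (simp add: u_def v_def algebra_simps)
qed

section \<open>The risk of the deconvolution estimator\<close>

text \<open>The right-hand side depends on the samples through explicit formulas. The left-hand side involves chosen
representatives, so its measurability in the samples is not evident; hence the bound is made for each sample point before any
expectation is taken.\<close>

lemma sobolev_loss_le:
  fixes fX :: "real \<Rightarrow> complex"
  assumes v: "v \<in> L2" and \<alpha>: "\<alpha> > 0" and s: "s \<ge> 0" and fX: "fX \<in> L2"
    and [measurable]: "\<phi> \<in> borel_measurable borel"
  shows "sobolev_norm_sq s (\<lambda>x. deconv_estimator s \<alpha> v (empirical_fourier m e) x - fX x)
    \<le> ennreal (1 / \<alpha>) * l2sq (\<lambda>t. fourier v t - of_real (sqrt (2 * pi)) * \<phi> t * fourier fX t)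
      + (\<integral>\<^sup>+t. ennreal ((1 + t\<^sup>2) powr s * (cmod (fourier fX t))\<^sup>2 *
           inversion_error (\<alpha> * (1 + t\<^sup>2) powr s) (empirical_fourier m e t) (\<phi> t)) \<partial>lborel)"
proof -
  let ?z = "empirical_fourier m e"
  have [measurable]: "fourier v \<in> borel_measurable borel" "fourier fX \<in> borel_measurable borel"
    using fourier_L2[OF v] fourier_L2[OF fX] by auto
  have [measurable]: "?z \<in> borel_measurable borel" unfolding empirical_fourier_def by measurable
  define G where "G t = fourier v t * cnj (?z t) / complex_of_real (sqrt (2 * pi) * (cmod (?z t))\<^sup>2) *
    (if \<alpha> * (1 + t\<^sup>2) powr s \<le> (cmod (?z t))\<^sup>2 then 1 else 0)" for t
  have L: "1 \<le> (1 + t\<^sup>2) powr s" for t :: real using s by (intro ge_one_powr_ge_zero) auto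
  have L0: "0 < (1 + t\<^sup>2) powr s" for t :: real using L[of t] by linarith
  have "(cmod (z / complex_of_real (ell s t)))\<^sup>2 = (cmod z)\<^sup>2 / (1 + t\<^sup>2) powr s" for z and t :: real
    by (simp add: ell_def norm_divide power_divide power2_eq_square[of "_ powr _"] flip: powr_add)
  then have "\<alpha> \<le> (cmod (z / complex_of_real (ell s t)))\<^sup>2 \<longleftrightarrow> \<alpha> * (1 + t\<^sup>2) powr s \<le> (cmod z)\<^sup>2" for z and t :: real
    using L0[of t] by (simp add: pos_le_divide_eq)
  then have est: "deconv_estimator s \<alpha> v ?z = fourier_inv G"
    unfolding deconv_estimator_def by (intro arg_cong[where f = fourier_inv] ext) (simp add: G_def indicator_def)
  have [measurable]: "G \<in> borel_measurable borel" unfolding G_def by measurable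
  have "(cmod (G t))\<^sup>2 \<le> (cmod (fourier v t))\<^sup>2 * (1 / \<alpha>)" for t
  proof -
    have "1 * (cmod (G t))\<^sup>2 \<le> (1 + t\<^sup>2) powr s * (cmod (G t))\<^sup>2"
      using L by (intro mult_right_mono) auto
    also have "\<dots> \<le> (cmod (fourier v t))\<^sup>2 * (1 / \<alpha>)"
      using deconvolution_error_split[OF \<alpha> L0, where g = 0] unfolding G_def by simp
    finally show ?thesis by simp
  qed
  then have "l2sq G \<le> (\<integral>\<^sup>+t. ennreal ((cmod (fourier v t))\<^sup>2) * ennreal (1 / \<alpha>) \<partial>lborel)"
    unfolding l2sq_def using \<alpha> by (intro nn_integral_mono) (simp add: ennreal_leI flip: ennreal_mult)
  also have "\<dots> = l2sq (fourier v) * ennreal (1 / \<alpha>)" by (simp add: nn_integral_multc l2sq_def)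
  also have "\<dots> < \<infinity>" using fourier_L2[OF v] by (simp add: L2_iff ennreal_mult_less_top)
  finally have G: "G \<in> L2" by (simp add: L2_iff)
  have "sobolev_norm_sq s (\<lambda>x. deconv_estimator s \<alpha> v ?z x - fX x)
    = (\<integral>\<^sup>+t. ennreal ((1 + t\<^sup>2) powr s * (cmod (G t - fourier fX t))\<^sup>2) \<partial>lborel)"
    unfolding est by (rule sobolev_norm_sq_fourier_inv_diff[OF G fX])
  also have "\<dots> \<le> (\<integral>\<^sup>+t. ennreal (1 / \<alpha>) * ennreal ((cmod (fourier v t - of_real (sqrt (2 * pi)) * \<phi> t * fourier fX t))\<^sup>2)
      + ennreal ((1 + t\<^sup>2) powr s * (cmod (fourier fX t))\<^sup>2 *
           inversion_error (\<alpha> * (1 + t\<^sup>2) powr s) (?z t) (\<phi> t)) \<partial>lborel)"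
  proof (intro nn_integral_mono)
    fix t :: real
    let ?A = "(cmod (fourier v t - of_real (sqrt (2 * pi)) * \<phi> t * fourier fX t))\<^sup>2"
    let ?B = "(1 + t\<^sup>2) powr s * (cmod (fourier fX t))\<^sup>2 * inversion_error (\<alpha> * (1 + t\<^sup>2) powr s) (?z t) (\<phi> t)"
    have "ennreal ((1 + t\<^sup>2) powr s * (cmod (G t - fourier fX t))\<^sup>2) \<le> ennreal (1 / \<alpha> * ?A + ?B)"
      using deconvolution_error_split[OF \<alpha> L0[of t], of "fourier v t" "?z t" "fourier fX t" "\<phi> t"]
      unfolding G_def by (intro ennreal_leI) simp
    also have "\<dots> = ennreal (1 / \<alpha>) * ennreal ?A + ennreal ?B"
      using \<alpha> by (subst ennreal_plus) (auto simp: inversion_error_nonneg simp flip: ennreal_mult)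
    finally show "ennreal ((1 + t\<^sup>2) powr s * (cmod (G t - fourier fX t))\<^sup>2) \<le> \<dots>" .
  qed
  also have "\<dots> = ennreal (1 / \<alpha>) * l2sq (\<lambda>t. fourier v t - of_real (sqrt (2 * pi)) * \<phi> t * fourier fX t)
      + (\<integral>\<^sup>+t. ennreal ((1 + t\<^sup>2) powr s * (cmod (fourier fX t))\<^sup>2 *
           inversion_error (\<alpha> * (1 + t\<^sup>2) powr s) (?z t) (\<phi> t)) \<partial>lborel)"
    unfolding l2sq_def by (simp add: nn_integral_add nn_integral_cmult)
  finally show ?thesis .
qed

text \<open>Exchange the order of integration, so that the mean of the inversion error is taken at each fixed
frequency, and let the surplus smoothness of $g$ absorb the growth in the frequency.\<close>

lemma (in prob_space) expected_inversion_loss_le: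
  fixes eps :: "nat \<Rightarrow> 'a \<Rightarrow> real" and \<phi> g :: "real \<Rightarrow> complex" and a p s :: real
  defines "\<kappa> \<equiv> (p - s) / (a + s)"
  assumes indep: "indep_vars (\<lambda>_. borel) eps UNIV"
    and mean: "\<And>j t. (LINT \<omega>|M. exp (- (\<i> * of_real t * of_real (eps j \<omega>)))) = of_real (sqrt (2 * pi)) * \<phi> t"
    and [measurable]: "\<phi> \<in> borel_measurable borel" "g \<in> borel_measurable borel"
    and smooth: "\<And>t. d \<le> (1 + t\<^sup>2) powr a * (cmod (\<phi> t))\<^sup>2" and d: "d > 0" and a: "a > 0" and s: "0 \<le> s" "s < p"
    and m: "m > 0" and c: "c > 0" and \<alpha>: "c / real m \<le> \<alpha>"
  shows "(\<integral>\<^sup>+\<omega>. \<integral>\<^sup>+t. ennreal ((1 + t\<^sup>2) powr s * (cmod (g t))\<^sup>2 *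
        inversion_error (\<alpha> * (1 + t\<^sup>2) powr s) (empirical_fourier m (\<lambda>j. eps j \<omega>) t) (\<phi> t)) \<partial>lborel \<partial>M)
    \<le> ennreal ((4 / d * \<alpha>) powr \<kappa> + (32 + 1024 / c) * max 1 (1 / d) * real m powr (- min 1 \<kappa>))
      * (\<integral>\<^sup>+t. ennreal ((1 + t\<^sup>2) powr p * (cmod (g t))\<^sup>2) \<partial>lborel)"
    (is "_ \<le> ennreal ?Q * _")
proof -
  have epsm[measurable]: "eps j \<in> borel_measurable M" for j
    using indep by (auto simp: indep_vars_def)
  note [measurable] = measurable_empirical_fourier[of eps M m]
  have [measurable]: "(\<lambda>\<omega>. empirical_fourier m (\<lambda>j. eps j \<omega>) t) \<in> borel_measurable M" for t
    unfolding empirical_fourier_def by measurable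
  interpret MP: pair_sigma_finite M lborel ..
  have \<alpha>0: "\<alpha> > 0" using \<alpha> c m by (meson divide_pos_pos less_le_trans of_nat_0_less_iff)
  have "(\<integral>\<^sup>+\<omega>. \<integral>\<^sup>+t. ennreal ((1 + t\<^sup>2) powr s * (cmod (g t))\<^sup>2 *
        inversion_error (\<alpha> * (1 + t\<^sup>2) powr s) (empirical_fourier m (\<lambda>j. eps j \<omega>) t) (\<phi> t)) \<partial>lborel \<partial>M)
    = (\<integral>\<^sup>+t. \<integral>\<^sup>+\<omega>. ennreal ((1 + t\<^sup>2) powr s * (cmod (g t))\<^sup>2 *
        inversion_error (\<alpha> * (1 + t\<^sup>2) powr s) (empirical_fourier m (\<lambda>j. eps j \<omega>) t) (\<phi> t)) \<partial>M \<partial>lborel)"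
    by (rule MP.Fubini'[symmetric]) measurable
  also have "\<dots> \<le> (\<integral>\<^sup>+t. ennreal ?Q * ennreal ((1 + t\<^sup>2) powr p * (cmod (g t))\<^sup>2) \<partial>lborel)"
  proof (intro nn_integral_mono)
    fix t :: real
    let ?w = "1 + t\<^sup>2"
    let ?g = "?w powr s * (cmod (g t))\<^sup>2"
    have L: "1 \<le> ?w powr s" using s by (intro ge_one_powr_ge_zero) auto
    have \<phi>0: "\<phi> t \<noteq> 0" using smooth[of t] d by auto
    have b: "c / real m \<le> \<alpha> * ?w powr s"
    proof (rule order_trans[OF \<alpha>])
      show "\<alpha> \<le> \<alpha> * ?w powr s" using mult_left_mono[OF L, of \<alpha>] \<alpha>0 by simp
    qed
    have "(\<integral>\<^sup>+\<omega>. ennreal (?g * inversion_error (\<alpha> * ?w powr s) (empirical_fourier m (\<lambda>j. eps j \<omega>) t) (\<phi> t)) \<partial>M)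
      = ennreal ?g * (\<integral>\<^sup>+\<omega>. ennreal (inversion_error (\<alpha> * ?w powr s) (empirical_fourier m (\<lambda>j. eps j \<omega>) t) (\<phi> t)) \<partial>M)"
      by (subst nn_integral_cmult[symmetric]) (auto simp: ennreal_mult inversion_error_nonneg)
    also have "\<dots> \<le> ennreal ?g * ennreal ((if (cmod (\<phi> t))\<^sup>2 < 4 * (\<alpha> * ?w powr s) then 1 else 0)
        + (32 + 1024 / c) * min 1 (1 / (real m * (cmod (\<phi> t))\<^sup>2)))"
      by (intro mult_left_mono expectation_inversion_error_le indep mean m \<phi>0 c b) auto
    also have "\<dots> \<le> ennreal ?g * ennreal (?w powr (p - s) * ?Q)"
      unfolding \<kappa>_def using m c smooth by (intro mult_left_mono ennreal_leI spectral_cutoff_rate d a s \<alpha>0) auto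
    also have "\<dots> = ennreal ?Q * ennreal (?w powr p * (cmod (g t))\<^sup>2)"
    proof -
      have "?w powr p = ?w powr s * ?w powr (p - s)" by (simp flip: powr_add)
      moreover have "0 \<le> ?Q" using c by auto
      ultimately show ?thesis by (simp add: mult_ac flip: ennreal_mult)
    qed
    finally show "(\<integral>\<^sup>+\<omega>. ennreal (?g * inversion_error (\<alpha> * ?w powr s) (empirical_fourier m (\<lambda>j. eps j \<omega>) t) (\<phi> t)) \<partial>M)
      \<le> ennreal ?Q * ennreal (?w powr p * (cmod (g t))\<^sup>2)" .
  qed
  also have "\<dots> = ennreal ?Q * (\<integral>\<^sup>+t. ennreal ((1 + t\<^sup>2) powr p * (cmod (g t))\<^sup>2) \<partial>lborel)"
    by (rule nn_integral_cmult) measurable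
  finally show ?thesis .
qed

theorem corollary4p4:
  fixes M :: "'w measure"
    and fX feps :: "real \<Rightarrow> real"
    and Y eps :: "nat \<Rightarrow> 'w \<Rightarrow> real"
    and K :: "real \<Rightarrow> complex"
    and a p s c c' :: real
    and h :: "nat \<Rightarrow> real"
    and \<alpha> :: "nat \<Rightarrow> nat \<Rightarrow> real"
  assumes "prob_space M"
    and "fX \<in> densities_L2" and "feps \<in> densities_L2"
    and "\<And>t. (cmod (fourier (\<lambda>x. complex_of_real (feps x)) t))\<^sup>2 > 0"
    and "prob_space.indep_vars M (\<lambda>_. borel) Y UNIV"
    and "\<And>j. distributed M lborel (Y j) (\<lambda>y. ennreal (conv fX feps y))"
    and "prob_space.indep_vars M (\<lambda>_. borel) eps UNIV"
    and "\<And>j. distributed M lborel (eps j) (\<lambda>x. ennreal (feps x))"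
    and "a > 1 / 2" and "ordinary_smooth a feps"
    and "p > 0" and "(\<lambda>x. complex_of_real (fX x)) \<in> sobolev_space p"
    and "K \<in> kernel_class (p + a)"
    and "c > 0" and "\<And>n. h n = c * real n powr (- 1 / (2 * (p + a) + 1))"
    and "0 \<le> s" and "s < p"
    and "c' > 0"
    and "\<And>n m. \<alpha> n m = c' * (real n powr (- 2 * (s + a) / (2 * (p + a) + 1)) + 1 / real m)"
  shows "\<exists>C::real. \<forall>\<^sub>F (n, m) in sequentially \<times>\<^sub>F sequentially.
    (\<integral>\<^sup>+ \<omega>. sobolev_norm_sq s (\<lambda>x.
        deconv_estimator s (\<alpha> n m)
          (kernel_estimator K (h n) n (\<lambda>j. Y j \<omega>))
          (empirical_fourier m (\<lambda>j. eps j \<omega>)) x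
        - complex_of_real (fX x)) \<partial>M)
    \<le> ennreal (C * (real n powr (- 2 * (p - s) / (2 * (p + a) + 1))
                    + real m powr (- min 1 ((p - s) / (a + s)))))"
proof -
  interpret prob_space M by fact
  note Y_indep = assms(5) and eps_indep = assms(7) and K = assms(13) and c = assms(14)
    and h = assms(15) and s = assms(16,17) and c' = assms(18) and \<alpha> = assms(19)
  have a: "a > 0" using \<open>a > 1 / 2\<close> by simp
  note dX = densities_L2D[OF assms(2)] and de = densities_L2D[OF assms(3)]
  let ?q = "complex_of_real (sqrt (2 * pi))"
  define gX where "gX = fourier (\<lambda>x. complex_of_real (fX x))"
  define ge where "ge = fourier (\<lambda>x. complex_of_real (feps x))"
  define gY where "gY t = ?q * ge t * gX t" for t
  have gX: "gX = fourier_int (\<lambda>x. complex_of_real (fX x))" and ge: "ge = fourier_int (\<lambda>x. complex_of_real (feps x))"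
    unfolding gX_def ge_def using assms(2,3) by (auto intro: fourier_density)
  have [measurable]: "gX \<in> borel_measurable borel" "ge \<in> borel_measurable borel"
    unfolding gX_def ge_def using fourier_L2[OF dX(4)] fourier_L2[OF de(4)] by auto
  have [measurable]: "gY \<in> borel_measurable borel" unfolding gY_def by measurable
  have Ym: "Y j \<in> borel_measurable M" for j
    using Y_indep by (auto simp: indep_vars_def)
  have KL1: "integrable lborel K" and KL2: "K \<in> L2" using K by (auto simp: kernel_class_def)
  have mean_eps: "(LINT \<omega>|M. exp (- (\<i> * of_real t * of_real (eps j \<omega>)))) = ?q * ge t" for j t
    unfolding ge by (rule expectation_exp_eq_fourier_int[OF assms(8) de(2)])
  have mean_Y: "(LINT \<omega>|M. exp (- (\<i> * of_real t * of_real (Y j \<omega>)))) = ?q * gY t" for j t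
    unfolding expectation_exp_eq_fourier_int[OF assms(6) conv_nonneg[OF dX(2) de(2)]]
      fourier_int_conv[OF dX(3,2) de(3,2)] gY_def gX ge by (simp add: mult_ac)
  obtain d where d: "d > 0" "\<And>t. d \<le> (1 + t\<^sup>2) powr a * (cmod (ge t))\<^sup>2" "\<And>t. (1 + t\<^sup>2) powr a * (cmod (ge t))\<^sup>2 \<le> 1 / d"
    using \<open>ordinary_smooth a feps\<close> by (auto simp: ordinary_smooth_def ge_def)
  obtain S where S: "S \<ge> 0" "(\<integral>\<^sup>+t. ennreal ((1 + t\<^sup>2) powr p * (cmod (gX t))\<^sup>2) \<partial>lborel) = ennreal S"
    using assms(12) by (auto simp: sobolev_space_def sobolev_norm_sq_def gX_def less_top_ennreal)
  \<comment> \<open>convolution with \<open>feps\<close> adds its order of smoothness\<close>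
  have gY_smooth: "(\<integral>\<^sup>+t. ennreal ((1 + t\<^sup>2) powr (p + a) * (cmod (gY t))\<^sup>2) \<partial>lborel) < \<infinity>"
  proof -
    have "(\<integral>\<^sup>+t. ennreal ((1 + t\<^sup>2) powr (p + a) * (cmod (gY t))\<^sup>2) \<partial>lborel)
      \<le> (\<integral>\<^sup>+t. ennreal (2 * pi / d) * ennreal ((1 + t\<^sup>2) powr p * (cmod (gX t))\<^sup>2) \<partial>lborel)"
    proof (intro nn_integral_mono)
      fix t :: real
      have "(1 + t\<^sup>2) powr (p + a) * (cmod (gY t))\<^sup>2
        = 2 * pi * ((1 + t\<^sup>2) powr a * (cmod (ge t))\<^sup>2) * ((1 + t\<^sup>2) powr p * (cmod (gX t))\<^sup>2)"
        by (simp add: gY_def norm_mult power_mult_distrib powr_add mult_ac)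
      also have "\<dots> \<le> 2 * pi * (1 / d) * ((1 + t\<^sup>2) powr p * (cmod (gX t))\<^sup>2)"
        by (intro mult_right_mono mult_left_mono d) auto
      finally have "ennreal ((1 + t\<^sup>2) powr (p + a) * (cmod (gY t))\<^sup>2) \<le> ennreal (2 * pi / d * ((1 + t\<^sup>2) powr p * (cmod (gX t))\<^sup>2))"
        by (intro ennreal_leI) simp
      then show "ennreal ((1 + t\<^sup>2) powr (p + a) * (cmod (gY t))\<^sup>2)
        \<le> ennreal (2 * pi / d) * ennreal ((1 + t\<^sup>2) powr p * (cmod (gX t))\<^sup>2)"
        using d(1) by (simp add: ennreal_mult del: times_divide_eq_left)
    qed
    also have "\<dots> = ennreal (2 * pi / d) * ennreal S"
      unfolding S(2)[symmetric] by (rule nn_integral_cmult) measurable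
    also have "\<dots> < \<infinity>" by (simp add: ennreal_mult_less_top)
    finally show ?thesis .
  qed
  obtain C where C: "C \<ge> 0" "\<And>n. n > 0 \<Longrightarrow>
      (\<integral>\<^sup>+\<omega>. l2sq (\<lambda>t. fourier (kernel_estimator K (h n) n (\<lambda>j. Y j \<omega>)) t - gY t) \<partial>M)
        \<le> ennreal (C * real n powr (- 2 * (p + a) / (2 * (p + a) + 1)))"
    using kernel_estimator_risk[OF K _ c Y_indep mean_Y _ gY_smooth] a \<open>p > 0\<close> unfolding h by auto
  define \<kappa> where "\<kappa> = (p - s) / (a + s)"
  define B where "B = (32 + 1024 / c') * max 1 (1 / d)"
  have B: "B \<ge> 0" using c' by (auto simp: B_def)
  define C' where "C' = C / c' + S * ((2 * (4 / d) * c') powr \<kappa> + B)"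
  have "(\<integral>\<^sup>+ \<omega>. sobolev_norm_sq s (\<lambda>x. deconv_estimator s (\<alpha> n m)
          (kernel_estimator K (h n) n (\<lambda>j. Y j \<omega>)) (empirical_fourier m (\<lambda>j. eps j \<omega>)) x
        - complex_of_real (fX x)) \<partial>M)
    \<le> ennreal (C' * (real n powr (- 2 * (p - s) / (2 * (p + a) + 1)) + real m powr (- min 1 ((p - s) / (a + s)))))"
    if n: "n \<ge> 1" and m: "m \<ge> 1" for n m
  proof -
    let ?fY = "\<lambda>\<omega>. kernel_estimator K (h n) n (\<lambda>j. Y j \<omega>)"
    let ?loss = "\<lambda>\<omega>. l2sq (\<lambda>t. fourier (?fY \<omega>) t - gY t)"
    let ?inv = "\<lambda>\<omega>. \<integral>\<^sup>+t. ennreal ((1 + t\<^sup>2) powr s * (cmod (gX t))\<^sup>2 *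
           inversion_error (\<alpha> n m * (1 + t\<^sup>2) powr s) (empirical_fourier m (\<lambda>j. eps j \<omega>) t) (ge t)) \<partial>lborel"
    let ?Q = "(4 / d * \<alpha> n m) powr \<kappa> + B * real m powr (- min 1 \<kappa>)"
    let ?R = "C * real n powr (- 2 * (p + a) / (2 * (p + a) + 1))"
    have hn: "h n > 0" using n c by (simp add: h)
    have \<alpha>m: "c' / real m \<le> \<alpha> n m" and \<alpha>0: "\<alpha> n m > 0"
      using c' n m by (auto simp: \<alpha> distrib_left intro!: mult_pos_pos add_pos_pos)
    have [measurable]: "?loss \<in> borel_measurable M"
      by (rule measurable_kernel_estimator_loss[OF KL1 hn _ Ym]) measurable
    have "(\<integral>\<^sup>+ \<omega>. sobolev_norm_sq s (\<lambda>x. deconv_estimator s (\<alpha> n m) (?fY \<omega>) (empirical_fourier m (\<lambda>j. eps j \<omega>)) x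
        - complex_of_real (fX x)) \<partial>M) \<le> (\<integral>\<^sup>+\<omega>. ennreal (1 / \<alpha> n m) * ?loss \<omega> + ?inv \<omega> \<partial>M)"
    proof (intro nn_integral_mono)
      fix \<omega>
      show "sobolev_norm_sq s (\<lambda>x. deconv_estimator s (\<alpha> n m) (?fY \<omega>) (empirical_fourier m (\<lambda>j. eps j \<omega>)) x
        - complex_of_real (fX x)) \<le> ennreal (1 / \<alpha> n m) * ?loss \<omega> + ?inv \<omega>"
        using sobolev_loss_le[OF kernel_estimator_L2[OF KL1 KL2 hn] \<alpha>0 s(1) dX(4), of ge n "\<lambda>j. Y j \<omega>" m "\<lambda>j. eps j \<omega>"]
        by (simp add: gY_def gX_def)
    qed
    also have "\<dots> = (\<integral>\<^sup>+\<omega>. ennreal (1 / \<alpha> n m) * ?loss \<omega> \<partial>M) + (\<integral>\<^sup>+\<omega>. ?inv \<omega> \<partial>M)"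
    proof (rule nn_integral_add)
      have [measurable]: "eps j \<in> borel_measurable M" for j
        using eps_indep by (auto simp: indep_vars_def)
      note [measurable] = measurable_empirical_fourier[of eps M m]
      show "?inv \<in> borel_measurable M" by (rule lborel.borel_measurable_nn_integral) measurable
    qed measurable
    also have "\<dots> = ennreal (1 / \<alpha> n m) * (\<integral>\<^sup>+\<omega>. ?loss \<omega> \<partial>M) + (\<integral>\<^sup>+\<omega>. ?inv \<omega> \<partial>M)"
      by (simp add: nn_integral_cmult)
    also have "\<dots> \<le> ennreal (1 / \<alpha> n m) * ennreal ?R + ennreal ?Q * ennreal S"
      unfolding S(2)[symmetric] B_def \<kappa>_def using n m
      by (intro add_mono mult_left_mono C expected_inversion_loss_le eps_indep mean_eps d a s c' \<alpha>m) auto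
    also have "\<dots> = ennreal (?R / \<alpha> n m + S * ?Q)"
      using \<alpha>0 C(1) B S(1) by (simp add: mult_ac flip: ennreal_mult ennreal_plus)
    also have "\<dots> \<le> ennreal (C' * (real n powr (- 2 * (p - s) / (2 * (p + a) + 1)) + real m powr (- min 1 ((p - s) / (a + s)))))"
      unfolding C'_def \<kappa>_def using n m d(1)
      by (intro ennreal_leI balanced_threshold_rate a s c' B C S \<alpha>) auto
    finally show ?thesis .
  qed
  then show ?thesis
    unfolding eventually_prod_sequentially by (intro exI[of _ C'] exI[of _ 1]) auto
qed

end
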